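(* Let $m\ge1$ and $\ell\ge1$ be integers, let $X$ be a $\mathcal D$-measurable $D([0,1]^m)$-valued random variable, and suppose that $\mathbb E\|X\|^\ell<\infty$. Then the projective moment $\mathbb E[X^{\widehat\otimes\ell}]$ and the injective moment $\mathbb E[X^{\check\otimes\ell}]$ exist in Pettis sense.
   Context: $D([0,1]^m)$ is the set of functions $f:[0,1]^m\to\mathbb R$ such that at every $t=(t_1,\dots,t_m)\in[0,1]^m$ the limit of $f(s)$ exists (as a finite real number) as $s\to t$ within each set $J_1\times\dots\times J_m$, where each $J_i$ is either $[t_i,1]$ or $[0,t_i)$ (the latter only if $t_i>0$). It is a Banach space with the norm $\|f\|=\sup_{t\in[0,1]^m}|f(t)|$. $\mathcal D$ is the $\sigma$-field on it generated by all point evaluations $f\mapsto f(t)$. A $\mathcal D$-measurable $D([0,1]^m)$-valued random variable is a map $X$ from a probability space $(\Omega,\mathcal F,\mathbb P)$ to $D([0,1]^m)$ such that $X(t)$ is a real random variable for each $t\in[0,1]^m$; then $\|X\|$ is a random variable. For a Banach space $B$, $B^{\widehat\otimes\ell}$ and $B^{\check\otimes\ell}$ denote the $\ell$-fold projective and injective (completed) tensor powers of $B$. For a $B$-valued $X$, write $X^{\widehat\otimes\ell}$ or $X^{\check\otimes\ell}$ for $X\otimes\dots\otimes X$ ($\ell$ factors) regarded as a function $\Omega\to B^{\widehat\otimes\ell}$ or $\Omega\to B^{\check\otimes\ell}$. Here $B=D([0,1]^m)$. A function $F:\Omega\to E$ into a Banach space $E$ is Dunford integrable if $\langle\chi,F\rangle$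 is measurable and integrable for every $\chi\in E^*$; its Dunford integral is the unique element $\int_\Omega F\,\mathrm d\mathbb P\in E^{**}$ with $\langle\int_\Omega F\,\mathrm d\mathbb P,\chi\rangle=\int_\Omega\langle\chi,F\rangle\,\mathrm d\mathbb P$ for all $\chi\in E^*$. $F$ is Pettis integrable if it is Dunford integrable and $\int_AF\,\mathrm d\mathbb P\in E$ for every measurable $A\subseteq\Omega$. The projective (injective) moment exists in Pettis sense if $X^{\widehat\otimes\ell}$ (respectively $X^{\check\otimes\ell}$) is Pettis integrable in $B^{\widehat\otimes\ell}$ (respectively $B^{\check\otimes\ell}$). *)

theory Defs
  imports "HOL-Probability.Probability" "HOL-Analysis.Finite_Function_Topology"
begin

section \<open>The space of cadlag functions on the unit cube\<close>

definition unit_cube :: "(real ^ 'm) set" where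
  "unit_cube = {t. \<forall>i. 0 \<le> t $ i \<and> t $ i \<le> 1}"

text \<open>
  The product of the \<open>J\<^sub>i\<close>, where \<open>J\<^sub>i = [0, t\<^sub>i)\<close> for \<open>i \<in> L\<close> and
  \<open>J\<^sub>i = [t\<^sub>i, 1]\<close> otherwise.
\<close>
definition cube_orthant :: "real ^ 'm \<Rightarrow> 'm set \<Rightarrow> (real ^ 'm) set" where
  "cube_orthant t L = {s \<in> unit_cube. \<forall>i. if i \<in> L then s $ i < t $ i else t $ i \<le> s $ i}"

text \<open>
  The filter is not punctured at \<open>t\<close>: the point \<open>t\<close> belongs to the orthant with \<open>L = {}\<close>,
  so the limit in that orthant has to be \<open>f t\<close>, which is right-continuity.
\<close>
definition cadlag_on_cube :: "(real ^ 'm \<Rightarrow> real) \<Rightarrow> bool" where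
  "cadlag_on_cube f \<longleftrightarrow>
     (\<forall>t\<in>unit_cube. \<forall>L \<subseteq> {i. 0 < t $ i}.
        \<exists>y. (f \<longlongrightarrow> y) (inf (nhds t) (principal (cube_orthant t L))))"

lemma cadlag_const: "cadlag_on_cube (\<lambda>_. c)"
  unfolding cadlag_on_cube_def by (blast intro: tendsto_const)

text \<open>Functions on the cube are represented by their extension by zero.\<close>
typedef (overloaded) 'm skorokhod =
  "{f :: real ^ 'm::finite \<Rightarrow> real. cadlag_on_cube f \<and> (\<forall>t. t \<notin> unit_cube \<longrightarrow> f t = 0)}"
  morphisms eval Abs_skorokhod
  by (rule exI[of _ "\<lambda>_. 0"]) (simp add: cadlag_const)

setup_lifting type_definition_skorokhod

lemma compact_unit_cube: "compact (unit_cube :: (real ^ 'm::finite) set)"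
proof -
  have *: "unit_cube = cbox (0 :: real ^ 'm) 1"
    by (auto simp: unit_cube_def mem_box_cart)
  show ?thesis by (subst *) (rule compact_cbox)
qed

lemma unit_cube_nonempty: "unit_cube \<noteq> ({} :: (real ^ 'm::finite) set)"
proof -
  have "(0 :: real ^ 'm) \<in> unit_cube" by (simp add: unit_cube_def)
  then show ?thesis by blast
qed

lemma cadlag_locally_bounded:
  fixes f :: "real ^ 'm::finite \<Rightarrow> real"
  assumes f: "cadlag_on_cube f" and t: "t \<in> unit_cube"
  shows "\<exists>U B. open U \<and> t \<in> U \<and> (\<forall>s\<in>U \<inter> unit_cube. \<bar>f s\<bar> \<le> B)"
proof -
  have "\<exists>B. \<forall>\<^sub>F s in nhds t. s \<in> cube_orthant t L \<longrightarrow> \<bar>f s\<bar> \<le> B" if L: "L \<subseteq> {i. 0 < t $ i}" for L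
  proof -
    obtain y where "(f \<longlongrightarrow> y) (inf (nhds t) (principal (cube_orthant t L)))"
      using f t L unfolding cadlag_on_cube_def by blast
    then have "\<forall>\<^sub>F s in inf (nhds t) (principal (cube_orthant t L)). dist (f s) y < 1"
      by (rule tendstoD) simp
    then have "\<forall>\<^sub>F s in nhds t. s \<in> cube_orthant t L \<longrightarrow> dist (f s) y < 1"
      by (simp add: eventually_inf_principal)
    then have "\<forall>\<^sub>F s in nhds t. s \<in> cube_orthant t L \<longrightarrow> \<bar>f s\<bar> \<le> \<bar>y\<bar> + 1"
      by eventually_elim (auto simp: dist_real_def)
    then show ?thesis by blast
  qed
  then obtain B where B: "\<And>L. L \<subseteq> {i. 0 < t $ i} \<Longrightarrow>
      \<forall>\<^sub>F s in nhds t. s \<in> cube_orthant t L \<longrightarrow> \<bar>f s\<bar> \<le> B L"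
    by metis
  have "\<forall>\<^sub>F s in nhds t. \<forall>L\<in>Pow {i. 0 < t $ i}. s \<in> cube_orthant t L \<longrightarrow> \<bar>f s\<bar> \<le> B L"
    by (intro eventually_ball_finite) (auto intro: B)
  then obtain U where U: "open U" "t \<in> U"
    "\<And>s L. s \<in> U \<Longrightarrow> L \<subseteq> {i. 0 < t $ i} \<Longrightarrow> s \<in> cube_orthant t L \<Longrightarrow> \<bar>f s\<bar> \<le> B L"
    unfolding eventually_nhds by blast
  have "\<bar>f s\<bar> \<le> (\<Sum>L\<in>Pow {i. 0 < t $ i}. \<bar>B L\<bar>)" if "s \<in> U \<inter> unit_cube" for s
  proof -
    let ?L = "{i. s $ i < t $ i}"
    have L: "?L \<subseteq> {i. 0 < t $ i}"
      using that by (auto simp: unit_cube_def intro: le_less_trans)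
    have "s \<in> cube_orthant t ?L"
      using that by (auto simp: cube_orthant_def)
    then have "\<bar>f s\<bar> \<le> B ?L" using U(3) L that by blast
    also have "\<dots> \<le> \<bar>B ?L\<bar>" by simp
    also have "\<dots> \<le> (\<Sum>L\<in>Pow {i. 0 < t $ i}. \<bar>B L\<bar>)"
      using L by (intro member_le_sum) auto
    finally show ?thesis .
  qed
  with U(1,2) show ?thesis by blast
qed

lemma cadlag_bounded:
  fixes f :: "real ^ 'm::finite \<Rightarrow> real"
  assumes f: "cadlag_on_cube f"
  shows "\<exists>B. \<forall>s\<in>unit_cube. \<bar>f s\<bar> \<le> B"
proof -
  obtain U B where UB: "\<And>t. t \<in> unit_cube \<Longrightarrow>
      open (U t) \<and> t \<in> U t \<and> (\<forall>s\<in>U t \<inter> unit_cube. \<bar>f s\<bar> \<le> B t)"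
    using cadlag_locally_bounded[OF f] by metis
  obtain D where D: "D \<subseteq> unit_cube" "finite D" "unit_cube \<subseteq> (\<Union>t\<in>D. U t)"
    using compactE_image[OF compact_unit_cube, of unit_cube U] UB by blast
  have "\<bar>f s\<bar> \<le> (\<Sum>t\<in>D. \<bar>B t\<bar>)" if s: "s \<in> unit_cube" for s
  proof -
    obtain t where t: "t \<in> D" "s \<in> U t" using D s by blast
    then have "\<bar>f s\<bar> \<le> B t" using UB D s by blast
    also have "\<dots> \<le> \<bar>B t\<bar>" by simp
    also have "\<dots> \<le> (\<Sum>t\<in>D. \<bar>B t\<bar>)" using t D by (intro member_le_sum) auto
    finally show ?thesis .
  qed
  then show ?thesis by blast
qed

lemma cadlag_add:
  assumes "cadlag_on_cube f" "cadlag_on_cube g"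
  shows "cadlag_on_cube (\<lambda>t. f t + g t)"
  unfolding cadlag_on_cube_def
proof (intro ballI allI impI)
  fix t :: "real ^ 'a" and L
  assume t: "t \<in> unit_cube" "L \<subseteq> {i. 0 < t $ i}"
  obtain y where "(f \<longlongrightarrow> y) (inf (nhds t) (principal (cube_orthant t L)))"
    using assms(1) t unfolding cadlag_on_cube_def by blast
  moreover obtain z where "(g \<longlongrightarrow> z) (inf (nhds t) (principal (cube_orthant t L)))"
    using assms(2) t unfolding cadlag_on_cube_def by blast
  ultimately show "\<exists>x. ((\<lambda>t. f t + g t) \<longlongrightarrow> x) (inf (nhds t) (principal (cube_orthant t L)))"
    by (auto dest: tendsto_add)
qed

lemma cadlag_scale:
  assumes "cadlag_on_cube f"
  shows "cadlag_on_cube (\<lambda>t. r * f t)"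
  unfolding cadlag_on_cube_def
proof (intro ballI allI impI)
  fix t :: "real ^ 'a" and L
  assume t: "t \<in> unit_cube" "L \<subseteq> {i. 0 < t $ i}"
  obtain y where "(f \<longlongrightarrow> y) (inf (nhds t) (principal (cube_orthant t L)))"
    using assms t unfolding cadlag_on_cube_def by blast
  then show "\<exists>x. ((\<lambda>t. r * f t) \<longlongrightarrow> x) (inf (nhds t) (principal (cube_orthant t L)))"
    by (auto dest: tendsto_mult_left)
qed

instantiation skorokhod :: (finite) real_vector
begin

lift_definition zero_skorokhod :: "'a skorokhod" is "\<lambda>_. 0"
  by (simp add: cadlag_const)

lift_definition plus_skorokhod :: "'a skorokhod \<Rightarrow> 'a skorokhod \<Rightarrow> 'a skorokhod"
  is "\<lambda>f g t. f t + g t"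
  by (auto intro: cadlag_add)

lift_definition uminus_skorokhod :: "'a skorokhod \<Rightarrow> 'a skorokhod" is "\<lambda>f t. - f t"
  using cadlag_scale[where r = "-1"] by auto

lift_definition minus_skorokhod :: "'a skorokhod \<Rightarrow> 'a skorokhod \<Rightarrow> 'a skorokhod"
  is "\<lambda>f g t. f t - g t"
  using cadlag_add[OF _ cadlag_scale[where r = "-1"]] by auto

lift_definition scaleR_skorokhod :: "real \<Rightarrow> 'a skorokhod \<Rightarrow> 'a skorokhod" is "\<lambda>r f t. r * f t"
  by (auto intro: cadlag_scale)

instance
  by standard (transfer; simp add: fun_eq_iff algebra_simps)+

end

lemmas eval_simps =
  zero_skorokhod.rep_eq plus_skorokhod.rep_eq uminus_skorokhod.rep_eq minus_skorokhod.rep_eq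
  scaleR_skorokhod.rep_eq

lemma eval_outside: "t \<notin> unit_cube \<Longrightarrow> eval f t = 0"
  by transfer auto

lemma bdd_above_eval: "bdd_above ((\<lambda>t. \<bar>eval f t\<bar>) ` unit_cube)"
  using eval[of f] cadlag_bounded[of "eval f"] by (auto simp: bdd_above_def)

instantiation skorokhod :: (finite) real_normed_vector
begin

definition norm_skorokhod :: "'a skorokhod \<Rightarrow> real" where
  "norm_skorokhod f = (SUP t\<in>unit_cube. \<bar>eval f t\<bar>)"

definition dist_skorokhod :: "'a skorokhod \<Rightarrow> 'a skorokhod \<Rightarrow> real" where
  "dist_skorokhod f g = norm (f - g)"

definition sgn_skorokhod :: "'a skorokhod \<Rightarrow> 'a skorokhod" where
  "sgn_skorokhod f = f /\<^sub>R norm f"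

definition uniformity_skorokhod :: "('a skorokhod \<times> 'a skorokhod) filter" where
  "uniformity_skorokhod = (INF e\<in>{0<..}. principal {(f, g). dist f g < e})"

definition open_skorokhod :: "'a skorokhod set \<Rightarrow> bool" where
  "open_skorokhod U = (\<forall>f\<in>U. \<forall>\<^sub>F (f', g) in uniformity. f' = f \<longrightarrow> g \<in> U)"

instance
proof
  fix f g :: "'a skorokhod" and r :: real
  have le: "\<bar>eval h t\<bar> \<le> norm h" if "t \<in> unit_cube" for h :: "'a skorokhod" and t
    unfolding norm_skorokhod_def using that by (intro cSUP_upper bdd_above_eval)
  have least: "norm h \<le> B" if "\<And>t. t \<in> unit_cube \<Longrightarrow> \<bar>eval h t\<bar> \<le> B"
    for h :: "'a skorokhod" and B
    unfolding norm_skorokhod_def by (intro cSUP_least unit_cube_nonempty that)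
  have nonneg: "0 \<le> norm h" for h :: "'a skorokhod"
    using le[of _ h] unit_cube_nonempty by (metis abs_ge_zero all_not_in_conv order_trans)
  show "dist f g = norm (f - g)" by (rule dist_skorokhod_def)
  show "sgn f = f /\<^sub>R norm f" by (rule sgn_skorokhod_def)
  show "uniformity = (INF e\<in>{0<..}. principal {(f, g :: 'a skorokhod). dist f g < e})"
    by (rule uniformity_skorokhod_def)
  show "open U = (\<forall>f\<in>U. \<forall>\<^sub>F (f', g) in uniformity. f' = f \<longrightarrow> g \<in> U)" for U :: "'a skorokhod set"
    by (rule open_skorokhod_def)
  show "norm f = 0 \<longleftrightarrow> f = 0"
  proof
    assume "norm f = 0"
    then have "eval f t = eval 0 t" for t
      using le[of t f] eval_outside[of t f] by (cases "t \<in> unit_cube") (auto simp: eval_simps)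
    then show "f = 0" by (simp add: eval_inject[symmetric] fun_eq_iff)
  next
    assume "f = 0"
    then show "norm f = 0" using least[of f 0] nonneg[of f] by (simp add: eval_simps)
  qed
  show "norm (f + g) \<le> norm f + norm g"
  proof (rule least)
    fix t :: "real ^ 'a" assume "t \<in> unit_cube"
    from le[OF this, of f] le[OF this, of g] show "\<bar>eval (f + g) t\<bar> \<le> norm f + norm g"
      by (simp add: eval_simps)
  qed
  have scale: "norm (r *\<^sub>R h) \<le> \<bar>r\<bar> * norm h" for r and h :: "'a skorokhod"
    by (rule least) (auto simp: eval_simps abs_mult intro!: mult_left_mono le)
  show "norm (r *\<^sub>R f) = \<bar>r\<bar> * norm f"
  proof (cases "r = 0")
    case True
    then show ?thesis using scale[of 0 f] nonneg[of "0 *\<^sub>R f"] by simp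
  next
    case False
    have "\<bar>r\<bar> * norm f = \<bar>r\<bar> * norm (inverse r *\<^sub>R (r *\<^sub>R f))" using False by simp
    also have "\<dots> \<le> \<bar>r\<bar> * (\<bar>inverse r\<bar> * norm (r *\<^sub>R f))"
      by (intro mult_left_mono scale) simp
    also have "\<dots> = norm (r *\<^sub>R f)" using False by simp
    finally show ?thesis using scale[of r f] by simp
  qed
qed

end

lemma abs_eval_le_norm: "\<bar>eval f t\<bar> \<le> norm f"
proof (cases "t \<in> unit_cube")
  case True
  then show ?thesis
    unfolding norm_skorokhod_def by (intro cSUP_upper bdd_above_eval)
qed (simp add: eval_outside)

lemma norm_skorokhod_least:
  fixes f :: "'m::finite skorokhod"
  assumes "\<And>t. t \<in> unit_cube \<Longrightarrow> \<bar>eval f t\<bar> \<le> B"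
  shows "norm f \<le> B"
  unfolding norm_skorokhod_def by (intro cSUP_least unit_cube_nonempty assms)

instance skorokhod :: (finite) banach
proof
  fix X :: "nat \<Rightarrow> 'a skorokhod"
  assume X: "Cauchy X"
  have diff: "\<bar>eval (X p) t - eval (X q) t\<bar> \<le> norm (X p - X q)" for p q t
    using abs_eval_le_norm[of "X p - X q" t] by (simp add: eval_simps)
  have "Cauchy (\<lambda>n. eval (X n) t)" for t
    using X unfolding Cauchy_def dist_norm real_norm_def by (meson diff le_less_trans)
  then have "\<exists>y. (\<lambda>n. eval (X n) t) \<longlonglongrightarrow> y" for t
    by (simp add: Cauchy_convergent_iff convergent_def)
  then obtain g where g: "\<And>t. (\<lambda>n. eval (X n) t) \<longlonglongrightarrow> g t" by metis
  have uni: "\<exists>N. \<forall>n\<ge>N. \<forall>t. \<bar>eval (X n) t - g t\<bar> \<le> e" if e: "e > 0" for e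
  proof -
    obtain N where N: "\<And>p q. p \<ge> N \<Longrightarrow> q \<ge> N \<Longrightarrow> norm (X p - X q) < e"
      using X e unfolding Cauchy_def dist_norm by blast
    have "\<bar>eval (X n) t - g t\<bar> \<le> e" if n: "n \<ge> N" for n t
    proof (rule LIMSEQ_le_const2)
      show "(\<lambda>k. \<bar>eval (X n) t - eval (X k) t\<bar>) \<longlonglongrightarrow> \<bar>eval (X n) t - g t\<bar>"
        by (intro tendsto_intros g)
      show "\<exists>N. \<forall>k\<ge>N. \<bar>eval (X n) t - eval (X k) t\<bar> \<le> e"
        using N[OF n] diff[of n t] by (meson less_imp_le order_trans)
    qed
    then show ?thesis by blast
  qed
  have ul: "uniform_limit UNIV (\<lambda>n. eval (X n)) g sequentially"
  proof (rule uniform_limitI)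
    fix e :: real assume "e > 0"
    then obtain N where N: "\<And>n t. n \<ge> N \<Longrightarrow> \<bar>eval (X n) t - g t\<bar> \<le> e / 2"
      using uni[of "e / 2"] by auto
    have "\<bar>eval (X n) t - g t\<bar> < e" if "n \<ge> N" for n t
      using N[OF that, of t] \<open>e > 0\<close> by simp
    then show "\<forall>\<^sub>F n in sequentially. \<forall>t\<in>UNIV. dist (eval (X n) t) (g t) < e"
      unfolding eventually_sequentially dist_real_def
      by blast
  qed
  have "cadlag_on_cube g"
    unfolding cadlag_on_cube_def
  proof (intro ballI allI impI)
    fix t :: "real ^ 'a" and L
    assume t: "t \<in> unit_cube" and L: "L \<subseteq> {i. 0 < t $ i}"
    define F where "F = inf (nhds t) (principal (cube_orthant t L))"
    have "\<exists>y. (eval (X n) \<longlongrightarrow> y) F" for n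
      using eval[of "X n"] t L unfolding F_def cadlag_on_cube_def by blast
    then obtain y where y: "\<And>n. (eval (X n) \<longlongrightarrow> y n) F" by metis
    show "\<exists>z. (g \<longlongrightarrow> z) F"
    proof (cases "F = bot")
      case False
      have "\<bar>y p - y q\<bar> \<le> norm (X p - X q)" for p q
      proof (rule tendsto_upperbound)
        show "((\<lambda>s. \<bar>eval (X p) s - eval (X q) s\<bar>) \<longlongrightarrow> \<bar>y p - y q\<bar>) F"
          by (intro tendsto_intros y)
      qed (use False diff in auto)
      then have "Cauchy y"
        using X unfolding Cauchy_def dist_norm real_norm_def by (meson le_less_trans)
      then obtain z where z: "y \<longlonglongrightarrow> z" by (auto simp: Cauchy_convergent_iff convergent_def)
      have "(g \<longlongrightarrow> z) F"
        by (rule swap_uniform_limit'[OF _ z ul]) (auto simp: y)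
      then show ?thesis by blast
    qed simp
  qed
  moreover have "g t = 0" if "t \<notin> unit_cube" for t
    using g[of t] that by (simp add: eval_outside LIMSEQ_const_iff)
  ultimately have ev: "eval (Abs_skorokhod g) = g"
    by (intro Abs_skorokhod_inverse) auto
  have "X \<longlonglongrightarrow> Abs_skorokhod g"
  proof (rule LIMSEQ_I)
    fix e :: real assume "e > 0"
    then obtain N where N: "\<And>n t. n \<ge> N \<Longrightarrow> \<bar>eval (X n) t - g t\<bar> \<le> e / 2"
      using uni[of "e / 2"] by auto
    have "norm (X n - Abs_skorokhod g) \<le> e / 2" if "n \<ge> N" for n
      by (rule norm_skorokhod_least) (use N that in \<open>auto simp: eval_simps ev\<close>)
    then show "\<exists>N. \<forall>n\<ge>N. norm (X n - Abs_skorokhod g) < e"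
      using \<open>e > 0\<close> by (intro exI[of _ N]) force
  qed
  then show "convergent X" by (rule convergentI)
qed

definition skorokhod_algebra :: "'m::finite skorokhod measure" where
  "skorokhod_algebra =
     sigma UNIV {(\<lambda>f. eval f t) -` S | t S. t \<in> unit_cube \<and> S \<in> sets borel}"

lemma measurable_skorokhod_algebra:
  fixes X :: "'w \<Rightarrow> 'm::finite skorokhod"
  shows "X \<in> measurable M skorokhod_algebra \<longleftrightarrow>
    (\<forall>t\<in>unit_cube. (\<lambda>w. eval (X w) t) \<in> borel_measurable M)"
proof
  assume X: "X \<in> measurable M skorokhod_algebra"
  show "\<forall>t\<in>unit_cube. (\<lambda>w. eval (X w) t) \<in> borel_measurable M"
  proof
    fix t :: "real ^ 'm" assume t: "t \<in> unit_cube"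
    have "(\<lambda>f. eval f t) \<in> borel_measurable skorokhod_algebra"
      by (rule measurableI)
        (use t in \<open>auto simp: skorokhod_algebra_def intro!: sigma_sets.Basic\<close>)
    from measurable_compose[OF X this] show "(\<lambda>w. eval (X w) t) \<in> borel_measurable M" .
  qed
next
  assume *: "\<forall>t\<in>unit_cube. (\<lambda>w. eval (X w) t) \<in> borel_measurable M"
  show "X \<in> measurable M skorokhod_algebra"
    unfolding skorokhod_algebra_def
  proof (rule measurable_measure_of)
    fix A assume "A \<in> {(\<lambda>f :: 'm skorokhod. eval f t) -` S | t S. t \<in> unit_cube \<and> S \<in> sets borel}"
    then obtain t S where A: "A = (\<lambda>f. eval f t) -` S" "t \<in> unit_cube" "S \<in> sets borel" by auto
    have "X -` A \<inter> space M = (\<lambda>w. eval (X w) t) -` S \<inter> space M" by (auto simp: A)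
    also have "\<dots> \<in> sets M" using * A by (auto intro: measurable_sets)
    finally show "X -` A \<inter> space M \<in> sets M" .
  qed auto
qed


section \<open>Algebraic tensor powers\<close>

text \<open>
  \<open>('l \<Rightarrow> 'b) \<Rightarrow>\<^sub>0 real\<close> is the free real vector space on the families \<open>(x\<^sub>i)\<close>, \<open>i :: 'l\<close>. The
  number of tensor factors is the number of elements of the index type \<open>'l\<close>.
\<close>

definition multilinear_relations :: "(('l \<Rightarrow> 'b::real_vector) \<Rightarrow>\<^sub>0 real) set" where
  "multilinear_relations =
     {Poly_Mapping.single (x(i := a + b)) 1
        - (Poly_Mapping.single (x(i := a)) 1 + Poly_Mapping.single (x(i := b)) 1) | x i a b. True} \<union>
     {Poly_Mapping.single (x(i := r *\<^sub>R a)) 1 - r *\<^sub>R Poly_Mapping.single (x(i := a)) 1 | x i r a. True}"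

definition tensor_eq :: "(('l \<Rightarrow> 'b::real_vector) \<Rightarrow>\<^sub>0 real) \<Rightarrow> (('l \<Rightarrow> 'b) \<Rightarrow>\<^sub>0 real) \<Rightarrow> bool" where
  "tensor_eq u v \<longleftrightarrow> u - v \<in> span multilinear_relations"

lemma tensor_eq_refl: "tensor_eq u u"
  by (simp add: tensor_eq_def span_zero)

lemma tensor_eq_sym: "tensor_eq u v \<Longrightarrow> tensor_eq v u"
  using span_neg[of "u - v" multilinear_relations] by (simp add: tensor_eq_def)

lemma tensor_eq_add: "tensor_eq u u' \<Longrightarrow> tensor_eq v v' \<Longrightarrow> tensor_eq (u + v) (u' + v')"
  using span_add[of "u - u'" multilinear_relations "v - v'"]
  by (simp add: tensor_eq_def add_diff_add)

lemma tensor_eq_trans: "tensor_eq u v \<Longrightarrow> tensor_eq v w \<Longrightarrow> tensor_eq u w"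
  using span_add[of "u - v" multilinear_relations "v - w"] by (simp add: tensor_eq_def)

lemma tensor_eq_scaleR: "tensor_eq u v \<Longrightarrow> tensor_eq (r *\<^sub>R u) (r *\<^sub>R v)"
  using span_scale[of "u - v" multilinear_relations r]
  by (simp add: tensor_eq_def scaleR_right_diff_distrib)

lemma tensor_eq_uminus: "tensor_eq u v \<Longrightarrow> tensor_eq (- u) (- v)"
  using tensor_eq_scaleR[of u v "-1"] by simp

lemma tensor_eq_diff: "tensor_eq u u' \<Longrightarrow> tensor_eq v v' \<Longrightarrow> tensor_eq (u - v) (u' - v')"
  using tensor_eq_add[OF _ tensor_eq_uminus, of u u' v v'] by simp

quotient_type (overloaded) ('b, 'l) tensor_power =
  "('l \<Rightarrow> 'b::real_vector) \<Rightarrow>\<^sub>0 real" / tensor_eq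
  by (intro equivpI reflpI sympI transpI)
    (blast intro: tensor_eq_refl tensor_eq_sym tensor_eq_trans)+

instantiation tensor_power :: (real_vector, type) real_vector
begin

lift_definition zero_tensor_power :: "('a, 'b) tensor_power" is 0 .

lift_definition plus_tensor_power ::
  "('a, 'b) tensor_power \<Rightarrow> ('a, 'b) tensor_power \<Rightarrow> ('a, 'b) tensor_power" is "(+)"
  by (rule tensor_eq_add)

lift_definition uminus_tensor_power :: "('a, 'b) tensor_power \<Rightarrow> ('a, 'b) tensor_power" is uminus
  by (rule tensor_eq_uminus)

lift_definition minus_tensor_power ::
  "('a, 'b) tensor_power \<Rightarrow> ('a, 'b) tensor_power \<Rightarrow> ('a, 'b) tensor_power" is "(-)"
  by (rule tensor_eq_diff)

lift_definition scaleR_tensor_power :: "real \<Rightarrow> ('a, 'b) tensor_power \<Rightarrow> ('a, 'b) tensor_power"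
  is "(*\<^sub>R)"
  by (rule tensor_eq_scaleR)

instance
proof
  fix u v w :: "('a, 'b) tensor_power" and r s :: real
  show "u + v + w = u + (v + w)" by transfer (simp add: tensor_eq_refl add.assoc)
  show "u + v = v + u" by transfer (simp add: tensor_eq_refl add.commute)
  show "0 + u = u" by transfer (simp add: tensor_eq_refl)
  show "- u + u = 0" by transfer (simp add: tensor_eq_refl)
  show "u - v = u + - v" by transfer (simp add: tensor_eq_refl)
  show "r *\<^sub>R (u + v) = r *\<^sub>R u + r *\<^sub>R v"
    by transfer (simp add: tensor_eq_refl scaleR_add_right)
  show "(r + s) *\<^sub>R u = r *\<^sub>R u + s *\<^sub>R u"
    by transfer (simp add: tensor_eq_refl scaleR_add_left)
  show "r *\<^sub>R s *\<^sub>R u = (r * s) *\<^sub>R u" by transfer (simp add: tensor_eq_refl)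
  show "1 *\<^sub>R u = u" by transfer (simp add: tensor_eq_refl)
qed

end

lift_definition pure_tensor :: "('l \<Rightarrow> 'b::real_vector) \<Rightarrow> ('b, 'l) tensor_power"
  is "\<lambda>x. Poly_Mapping.single x 1" .

lemma pure_tensor_add:
  "pure_tensor (x(i := a + b)) = pure_tensor (x(i := a)) + pure_tensor (x(i := b))"
  apply transfer
  unfolding tensor_eq_def multilinear_relations_def
  by (rule span_base, rule UnI1) blast

lemma pure_tensor_scaleR: "pure_tensor (x(i := r *\<^sub>R a)) = r *\<^sub>R pure_tensor (x(i := a))"
  apply transfer
  unfolding tensor_eq_def multilinear_relations_def
  by (rule span_base, rule UnI2) blast

lemma poly_mapping_sum_single:
  fixes u :: "'a \<Rightarrow>\<^sub>0 real"
  shows "u = (\<Sum>x\<in>Poly_Mapping.keys u. Poly_Mapping.lookup u x *\<^sub>R Poly_Mapping.single x 1)"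
proof -
  have lookup: "Poly_Mapping.lookup (c *\<^sub>R Poly_Mapping.single x 1) y = (if x = y then c else 0)"
    for c :: real and x y :: 'a
    by (subst scaleR_poly_mapping_def, subst lookup_Abs_poly_mapping)
      (auto simp: lookup_single when_def)
  show ?thesis
    by (rule poly_mapping_eqI) (simp add: lookup_sum lookup in_keys_iff)
qed

lemma scaleR_sum_pure_tensor:
  fixes xs :: "('l \<Rightarrow> 'b::real_vector) list"
  shows "r *\<^sub>R (\<Sum>x\<leftarrow>xs. pure_tensor x) = (\<Sum>x\<leftarrow>map (\<lambda>x. x(i := r *\<^sub>R x i)) xs. pure_tensor x)"
  by (induction xs)
    (simp_all add: scaleR_add_right pure_tensor_scaleR[where a = "x i" and x = x for x, simplified]
      del: fun_upd_apply)

lemma tensor_power_eq_sum_pure: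
  fixes u :: "('b::real_vector, 'l) tensor_power"
  obtains xs where "u = (\<Sum>x\<leftarrow>xs. pure_tensor x)"
proof -
  define S :: "('b, 'l) tensor_power set" where "S = {\<Sum>x\<leftarrow>xs. pure_tensor x | xs. True}"
  have zero: "0 \<in> S" unfolding S_def by (force intro: exI[of _ "[]"])
  have add: "v + w \<in> S" if "v \<in> S" "w \<in> S" for v w :: "('b, 'l) tensor_power"
  proof -
    obtain xs ys where "v = (\<Sum>x\<leftarrow>xs. pure_tensor x)" "w = (\<Sum>x\<leftarrow>ys. pure_tensor x)"
      using \<open>v \<in> S\<close> \<open>w \<in> S\<close> unfolding S_def by auto
    then have "v + w = (\<Sum>x\<leftarrow>xs @ ys. pure_tensor x)" by simp
    then show ?thesis unfolding S_def by blast
  qed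
  have scale: "r *\<^sub>R pure_tensor x \<in> S" for r and x :: "'l \<Rightarrow> 'b"
  proof -
    have "r *\<^sub>R pure_tensor x
        = (\<Sum>x\<leftarrow>map (\<lambda>x. x(undefined := r *\<^sub>R x undefined)) [x]. pure_tensor x)"
      using scaleR_sum_pure_tensor[of r "[x]" undefined] by simp
    then show ?thesis unfolding S_def by blast
  qed
  have "abs_tensor_power (\<Sum>x\<in>K. c x *\<^sub>R Poly_Mapping.single x 1) \<in> S" if "finite K"
    for K :: "('l \<Rightarrow> 'b) set" and c
    using that
  proof induction
    case empty
    then show ?case using zero by (simp add: zero_tensor_power_def)
  next
    case (insert x K)
    then show ?case
      using add[OF scale[of "c x" x]]
      by (simp add: plus_tensor_power.abs_eq[symmetric] scaleR_tensor_power.abs_eq[symmetric]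
          pure_tensor.abs_eq[symmetric])
  qed
  then have "abs_tensor_power U \<in> S" for U :: "('l \<Rightarrow> 'b) \<Rightarrow>\<^sub>0 real"
    by (subst poly_mapping_sum_single) simp
  then have "u \<in> S" by (metis Quotient_abs_rep[OF Quotient_tensor_power])
  then show ?thesis using that unfolding S_def by blast
qed

definition free_extension :: "('a \<Rightarrow> real) \<Rightarrow> ('a \<Rightarrow>\<^sub>0 real) \<Rightarrow> real" where
  "free_extension g u = (\<Sum>x\<in>Poly_Mapping.keys u. Poly_Mapping.lookup u x * g x)"

lemma free_extension_superset:
  assumes "finite K" "Poly_Mapping.keys u \<subseteq> K"
  shows "free_extension g u = (\<Sum>x\<in>K. Poly_Mapping.lookup u x * g x)"
  unfolding free_extension_def
  by (rule sum.mono_neutral_left) (use assms in \<open>auto simp: in_keys_iff\<close>)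

lemma free_extension_single: "free_extension g (Poly_Mapping.single x c) = c * g x"
  using free_extension_superset[of "{x}" "Poly_Mapping.single x c" g] by simp

lemma linear_free_extension: "linear (free_extension g)"
proof
  fix u v :: "'a \<Rightarrow>\<^sub>0 real" and r :: real
  let ?K = "Poly_Mapping.keys u \<union> Poly_Mapping.keys v"
  have "free_extension g (u + v) = (\<Sum>x\<in>?K. Poly_Mapping.lookup (u + v) x * g x)"
    by (rule free_extension_superset) (simp_all add: Poly_Mapping.keys_add)
  also have "\<dots> = (\<Sum>x\<in>?K. Poly_Mapping.lookup u x * g x) + (\<Sum>x\<in>?K. Poly_Mapping.lookup v x * g x)"
    by (simp add: lookup_add distrib_right sum.distrib)
  also have "\<dots> = free_extension g u + free_extension g v"
    by (simp add: free_extension_superset[of ?K])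
  finally show "free_extension g (u + v) = free_extension g u + free_extension g v" .
  have lookup: "Poly_Mapping.lookup (r *\<^sub>R u) x = r * Poly_Mapping.lookup u x" for x
  proof -
    have "finite {x. r *\<^sub>R Poly_Mapping.lookup u x \<noteq> 0}"
      by (rule finite_subset[of _ "Poly_Mapping.keys u"]) (auto simp: in_keys_iff)
    then show ?thesis by (simp add: scaleR_poly_mapping_def)
  qed
  have "free_extension g (r *\<^sub>R u)
      = (\<Sum>x\<in>Poly_Mapping.keys u. Poly_Mapping.lookup (r *\<^sub>R u) x * g x)"
    by (rule free_extension_superset) (auto simp: in_keys_iff lookup)
  then show "free_extension g (r *\<^sub>R u) = r *\<^sub>R free_extension g u"
    by (simp add: lookup free_extension_def sum_distrib_left mult.assoc)
qed

text \<open>The linear functional \<open>\<phi>\<^sub>1 \<otimes> \<dots> \<otimes> \<phi>\<^sub>l\<close>.\<close>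
lift_definition tensor_functional ::
  "('l::finite \<Rightarrow> 'b::real_normed_vector \<Rightarrow>\<^sub>L real) \<Rightarrow> ('b, 'l) tensor_power \<Rightarrow> real"
  is "\<lambda>\<phi>. free_extension (\<lambda>x. \<Prod>i\<in>UNIV. blinfun_apply (\<phi> i) (x i))"
proof -
  fix \<phi> :: "'l \<Rightarrow> 'b \<Rightarrow>\<^sub>L real" and u v :: "('l \<Rightarrow> 'b) \<Rightarrow>\<^sub>0 real"
  define g where "g = (\<lambda>x. \<Prod>i\<in>UNIV. blinfun_apply (\<phi> i) (x i))"
  define f where "f = free_extension g"
  interpret linear f unfolding f_def by (rule linear_free_extension)
  have g: "g (x(i := a)) = blinfun_apply (\<phi> i) a * (\<Prod>j\<in>UNIV - {i}. blinfun_apply (\<phi> j) (x j))"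
    for x i a
    unfolding g_def by (subst prod.remove[of _ i]) auto
  have f_single: "f (Poly_Mapping.single x c) = c * g x" for x c
    by (simp add: f_def free_extension_single)
  have "f w = 0" if "w \<in> multilinear_relations" for w
    using that unfolding multilinear_relations_def
  proof (elim UnE CollectE exE conjE)
    fix x i a b
    assume w: "w = Poly_Mapping.single (x(i := a + b)) 1
      - (Poly_Mapping.single (x(i := a)) 1 + Poly_Mapping.single (x(i := b)) 1)"
    show "f w = 0"
      unfolding w diff add f_single g by (simp add: blinfun.add_right algebra_simps)
  next
    fix x i r a
    assume w: "w = Poly_Mapping.single (x(i := r *\<^sub>R a)) 1
      - r *\<^sub>R Poly_Mapping.single (x(i := a)) 1"
    show "f w = 0"
      unfolding w diff scale f_single g by (simp add: blinfun.scaleR_right)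
  qed
  then have "f (u - v) = 0" if "tensor_eq u v"
    using that linear_eq_0_on_span[of f multilinear_relations "u - v"]
    by (simp add: tensor_eq_def linear_axioms)
  then show "tensor_eq u v \<Longrightarrow> free_extension g u = free_extension g v"
    unfolding f_def[symmetric] by (simp add: diff)
qed

lemma linear_tensor_functional: "linear (tensor_functional \<phi>)"
proof
  show "tensor_functional \<phi> (u + v) = tensor_functional \<phi> u + tensor_functional \<phi> v" for u v
    by transfer (rule linear_add[OF linear_free_extension])
  show "tensor_functional \<phi> (r *\<^sub>R u) = r *\<^sub>R tensor_functional \<phi> u" for r u
    by transfer (rule linear_scale[OF linear_free_extension])
qed

lemma tensor_functional_pure:
  "tensor_functional \<phi> (pure_tensor x) = (\<Prod>i\<in>UNIV. blinfun_apply (\<phi> i) (x i))"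
  by transfer (simp add: free_extension_single)


section \<open>The projective and the injective norm\<close>

definition projective_norm :: "('b::real_normed_vector, 'l::finite) tensor_power \<Rightarrow> real" where
  "projective_norm u =
     Inf {\<Sum>x\<leftarrow>xs. \<Prod>i\<in>UNIV. norm (x i) | xs. u = (\<Sum>x\<leftarrow>xs. pure_tensor x)}"

definition injective_norm :: "('b::real_normed_vector, 'l::finite) tensor_power \<Rightarrow> real" where
  "injective_norm u =
     (SUP \<phi>\<in>{\<phi> :: 'l \<Rightarrow> 'b \<Rightarrow>\<^sub>L real. \<forall>i. norm (\<phi> i) \<le> 1}. \<bar>tensor_functional \<phi> u\<bar>)"

lemma seminormI:
  fixes p :: "'a::real_vector \<Rightarrow> real"
  assumes "\<And>r x. p (r *\<^sub>R x) \<le> \<bar>r\<bar> * p x" and "0 \<le> p 0"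
  shows "p (r *\<^sub>R x) = \<bar>r\<bar> * p x"
proof (cases "r = 0")
  case True
  then show ?thesis using assms(1)[of 0 x] assms(2) by simp
next
  case False
  have "\<bar>r\<bar> * p x = \<bar>r\<bar> * p (inverse r *\<^sub>R (r *\<^sub>R x))" using False by simp
  also have "\<dots> \<le> \<bar>r\<bar> * (\<bar>inverse r\<bar> * p (r *\<^sub>R x))"
    by (intro mult_left_mono assms(1)) simp
  also have "\<dots> = p (r *\<^sub>R x)" using False by simp
  finally show ?thesis using assms(1)[of r x] by simp
qed

lemma projective_norm_le:
  fixes xs :: "('l::finite \<Rightarrow> 'b::real_normed_vector) list"
  shows "projective_norm (\<Sum>x\<leftarrow>xs. pure_tensor x) \<le> (\<Sum>x\<leftarrow>xs. \<Prod>i\<in>UNIV. norm (x i))"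
  unfolding projective_norm_def
proof (rule cInf_lower)
  show "bdd_below {\<Sum>x\<leftarrow>ys. \<Prod>i\<in>UNIV. norm (x i) | ys.
      (\<Sum>x\<leftarrow>xs. pure_tensor x) = (\<Sum>x\<leftarrow>ys. pure_tensor x)}"
    by (rule bdd_belowI[of _ 0]) (auto intro!: sum_list_nonneg prod_nonneg)
qed blast

lemma projective_norm_greatest:
  fixes u :: "('b::real_normed_vector, 'l::finite) tensor_power"
  assumes "\<And>xs. u = (\<Sum>x\<leftarrow>xs. pure_tensor x) \<Longrightarrow> B \<le> (\<Sum>x\<leftarrow>xs. \<Prod>i\<in>UNIV. norm (x i))"
  shows "B \<le> projective_norm u"
  unfolding projective_norm_def
proof (rule cInf_greatest)
  obtain xs where "u = (\<Sum>x\<leftarrow>xs. pure_tensor x)" by (rule tensor_power_eq_sum_pure)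
  then show "{\<Sum>x\<leftarrow>xs. \<Prod>i\<in>UNIV. norm (x i) | xs. u = (\<Sum>x\<leftarrow>xs. pure_tensor x)} \<noteq> {}" by blast
qed (use assms in blast)

lemma projective_norm_triangle: "projective_norm (u + v) \<le> projective_norm u + projective_norm v"
proof -
  have "projective_norm (u + v) - projective_norm v \<le> projective_norm u"
  proof (rule projective_norm_greatest)
    fix xs assume u: "u = (\<Sum>x\<leftarrow>xs. pure_tensor x)"
    have "projective_norm (u + v) - (\<Sum>x\<leftarrow>xs. \<Prod>i\<in>UNIV. norm (x i)) \<le> projective_norm v"
    proof (rule projective_norm_greatest)
      fix ys assume v: "v = (\<Sum>x\<leftarrow>ys. pure_tensor x)"
      show "projective_norm (u + v) - (\<Sum>x\<leftarrow>xs. \<Prod>i\<in>UNIV. norm (x i))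
          \<le> (\<Sum>x\<leftarrow>ys. \<Prod>i\<in>UNIV. norm (x i))"
        using projective_norm_le[of "xs @ ys"] by (simp add: u v)
    qed
    then show "projective_norm (u + v) - projective_norm v \<le> (\<Sum>x\<leftarrow>xs. \<Prod>i\<in>UNIV. norm (x i))"
      by simp
  qed
  then show ?thesis by simp
qed

lemma projective_norm_scaleR:
  fixes u :: "('b::real_normed_vector, 'l::finite) tensor_power"
  shows "projective_norm (r *\<^sub>R u) = \<bar>r\<bar> * projective_norm u"
proof (rule seminormI)
  show "0 \<le> projective_norm (0 :: ('b, 'l) tensor_power)"
    by (rule projective_norm_greatest) (auto intro!: sum_list_nonneg prod_nonneg)
  have zero: "projective_norm (0 :: ('b, 'l) tensor_power) \<le> 0"
    using projective_norm_le[of "[]"] by simp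
  fix r and u :: "('b, 'l) tensor_power"
  show "projective_norm (r *\<^sub>R u) \<le> \<bar>r\<bar> * projective_norm u"
  proof (cases "r = 0")
    case True
    then show ?thesis using zero by simp
  next
    case False
    have "projective_norm (r *\<^sub>R u) / \<bar>r\<bar> \<le> projective_norm u"
    proof (rule projective_norm_greatest)
      fix xs assume u: "u = (\<Sum>x\<leftarrow>xs. pure_tensor x)"
      define i where "i = (undefined :: 'l)"
      have prod: "(\<Prod>j\<in>UNIV. norm ((x(i := r *\<^sub>R x i)) j)) = \<bar>r\<bar> * (\<Prod>j\<in>UNIV. norm (x j))"
        for x :: "'l \<Rightarrow> 'b"
        by (subst (1 2) prod.remove[of _ i]) auto
      have "projective_norm (r *\<^sub>R u)
          \<le> (\<Sum>x\<leftarrow>map (\<lambda>x. x(i := r *\<^sub>R x i)) xs. \<Prod>j\<in>UNIV. norm (x j))"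
        unfolding u scaleR_sum_pure_tensor[of r xs i] by (rule projective_norm_le)
      also have "\<dots> = (\<Sum>x\<leftarrow>xs. \<bar>r\<bar> * (\<Prod>j\<in>UNIV. norm (x j)))"
        by (simp only: map_map o_def prod)
      also have "\<dots> = \<bar>r\<bar> * (\<Sum>x\<leftarrow>xs. \<Prod>j\<in>UNIV. norm (x j))"
        by (rule sum_list_const_mult)
      finally show "projective_norm (r *\<^sub>R u) / \<bar>r\<bar> \<le> (\<Sum>x\<leftarrow>xs. \<Prod>j\<in>UNIV. norm (x j))"
        using False by (simp add: field_simps)
    qed
    then show ?thesis using False by (simp add: field_simps)
  qed
qed

lemma bdd_above_tensor_functional:
  fixes u :: "('b::real_normed_vector, 'l::finite) tensor_power"
  shows "bdd_above ((\<lambda>\<phi>. \<bar>tensor_functional \<phi> u\<bar>) ` {\<phi>. \<forall>i. norm (\<phi> i) \<le> 1})"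
proof -
  obtain xs where u: "u = (\<Sum>x\<leftarrow>xs. pure_tensor x)" by (rule tensor_power_eq_sum_pure)
  have pure: "\<bar>tensor_functional \<phi> (pure_tensor x)\<bar> \<le> (\<Prod>i\<in>UNIV. norm (x i))"
    if "\<forall>i. norm (\<phi> i) \<le> 1" for \<phi> :: "'l \<Rightarrow> 'b \<Rightarrow>\<^sub>L real" and x
    unfolding tensor_functional_pure abs_prod
  proof (rule prod_mono)
    fix i
    have "\<bar>blinfun_apply (\<phi> i) (x i)\<bar> \<le> norm (\<phi> i) * norm (x i)"
      using norm_blinfun[of "\<phi> i" "x i"] by simp
    also have "\<dots> \<le> norm (x i)" using that by (simp add: mult_left_le_one_le)
    finally show "0 \<le> \<bar>blinfun_apply (\<phi> i) (x i)\<bar> \<and> \<bar>blinfun_apply (\<phi> i) (x i)\<bar> \<le> norm (x i)"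
      by simp
  qed
  have "\<bar>tensor_functional \<phi> (\<Sum>x\<leftarrow>xs. pure_tensor x)\<bar> \<le> (\<Sum>x\<leftarrow>xs. \<Prod>i\<in>UNIV. norm (x i))"
    if "\<forall>i. norm (\<phi> i) \<le> 1" for \<phi> :: "'l \<Rightarrow> 'b \<Rightarrow>\<^sub>L real"
  proof (induction xs)
    case Nil
    then show ?case by (simp add: linear_0[OF linear_tensor_functional])
  next
    case (Cons x xs)
    then show ?case
      using pure[OF that, of x] by (simp add: linear_add[OF linear_tensor_functional])
  qed
  then show ?thesis unfolding u by (auto simp: bdd_above_def)
qed

lemma tensor_functional_le_injective_norm:
  "(\<And>i. norm (\<phi> i) \<le> 1) \<Longrightarrow> \<bar>tensor_functional \<phi> u\<bar> \<le> injective_norm u"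
  unfolding injective_norm_def by (intro cSUP_upper bdd_above_tensor_functional) simp

lemma injective_norm_least:
  fixes u :: "('b::real_normed_vector, 'l::finite) tensor_power"
  assumes "\<And>\<phi>. (\<And>i. norm (\<phi> i) \<le> 1) \<Longrightarrow> \<bar>tensor_functional \<phi> u\<bar> \<le> B"
  shows "injective_norm u \<le> B"
  unfolding injective_norm_def
proof (rule cSUP_least)
  show "{\<phi> :: 'l \<Rightarrow> 'b \<Rightarrow>\<^sub>L real. \<forall>i. norm (\<phi> i) \<le> 1} \<noteq> {}"
    unfolding ex_in_conv[symmetric] by (rule exI[of _ "\<lambda>_. 0"]) simp
qed (use assms in blast)

lemma injective_norm_triangle:
  fixes u v :: "('b::real_normed_vector, 'l::finite) tensor_power"
  shows "injective_norm (u + v) \<le> injective_norm u + injective_norm v"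
proof (rule injective_norm_least)
  fix \<phi> :: "'l \<Rightarrow> 'b \<Rightarrow>\<^sub>L real"
  assume "\<And>i. norm (\<phi> i) \<le> 1"
  from tensor_functional_le_injective_norm[of \<phi> u, OF this]
    tensor_functional_le_injective_norm[of \<phi> v, OF this]
  show "\<bar>tensor_functional \<phi> (u + v)\<bar> \<le> injective_norm u + injective_norm v"
    by (simp add: linear_add[OF linear_tensor_functional])
qed

lemma injective_norm_scaleR:
  fixes u :: "('b::real_normed_vector, 'l::finite) tensor_power"
  shows "injective_norm (r *\<^sub>R u) = \<bar>r\<bar> * injective_norm u"
proof (rule seminormI)
  show "0 \<le> injective_norm (0 :: ('b, 'l) tensor_power)"
    by (rule order_trans[OF abs_ge_zero tensor_functional_le_injective_norm[of "\<lambda>_. 0"]]) simp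
  show "injective_norm (r *\<^sub>R u) \<le> \<bar>r\<bar> * injective_norm u" for r and u :: "('b, 'l) tensor_power"
    by (rule injective_norm_least)
      (auto simp: linear_scale[OF linear_tensor_functional] abs_mult
        intro!: mult_left_mono tensor_functional_le_injective_norm)
qed


section \<open>Completion\<close>

class real_seminormed_vector = real_vector +
  fixes seminorm :: "'a \<Rightarrow> real"
  assumes seminorm_triangle: "seminorm (x + y) \<le> seminorm x + seminorm y"
    and seminorm_scaleR: "seminorm (r *\<^sub>R x) = \<bar>r\<bar> * seminorm x"

lemma seminorm_zero: "seminorm (0 :: 'a::real_seminormed_vector) = 0"
  using seminorm_scaleR[of 0 "0 :: 'a"] by simp

lemma seminorm_uminus: "seminorm (- x) = seminorm x"
  using seminorm_scaleR[of "-1" x] by simp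

lemma seminorm_minus_commute: "seminorm (x - y) = seminorm (y - x)"
  using seminorm_uminus[of "x - y"] by simp

lemma seminorm_nonneg: "0 \<le> seminorm x"
  using seminorm_triangle[of x "- x"] by (simp add: seminorm_zero seminorm_uminus)

lemma seminorm_triangle_diff: "seminorm (x - z) \<le> seminorm (x - y) + seminorm (y - z)"
  using seminorm_triangle[of "x - y" "y - z"] by simp

lemma abs_seminorm_diff_le: "\<bar>seminorm x - seminorm y\<bar> \<le> seminorm (x - y)"
  using seminorm_triangle[of "x - y" y] seminorm_triangle[of "y - x" x]
    seminorm_minus_commute[of x y] by simp

definition seminorm_Cauchy :: "(nat \<Rightarrow> 'a::real_seminormed_vector) \<Rightarrow> bool" where
  "seminorm_Cauchy X \<longleftrightarrow> (\<forall>e>0. \<exists>N. \<forall>m\<ge>N. \<forall>n\<ge>N. seminorm (X m - X n) < e)"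

text \<open>Two Cauchy sequences define the same point if their difference is a null sequence.\<close>
definition completion_rel :: "(nat \<Rightarrow> 'a::real_seminormed_vector) \<Rightarrow> (nat \<Rightarrow> 'a) \<Rightarrow> bool" where
  "completion_rel X Y \<longleftrightarrow>
     seminorm_Cauchy X \<and> seminorm_Cauchy Y \<and> (\<lambda>n. seminorm (X n - Y n)) \<longlonglongrightarrow> 0"

lemma seminorm_Cauchy_combine:
  assumes "seminorm_Cauchy X" "seminorm_Cauchy Y"
    and "\<And>m n. seminorm (Z m - Z n) \<le> C * seminorm (X m - X n) + seminorm (Y m - Y n)"
  shows "seminorm_Cauchy Z"
  unfolding seminorm_Cauchy_def
proof (intro allI impI)
  fix e :: real assume e: "e > 0"
  define d where "d = e / 2 / (\<bar>C\<bar> + 1)"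
  have d: "d > 0" using e by (simp add: d_def)
  obtain N1 where N1: "\<And>m n. m \<ge> N1 \<Longrightarrow> n \<ge> N1 \<Longrightarrow> seminorm (X m - X n) < d"
    using assms(1) d unfolding seminorm_Cauchy_def by blast
  obtain N2 where N2: "\<And>m n. m \<ge> N2 \<Longrightarrow> n \<ge> N2 \<Longrightarrow> seminorm (Y m - Y n) < e / 2"
    using assms(2) e unfolding seminorm_Cauchy_def by (meson half_gt_zero)
  have "seminorm (Z m - Z n) < e" if "m \<ge> max N1 N2" "n \<ge> max N1 N2" for m n
  proof -
    have "C * seminorm (X m - X n) \<le> (\<bar>C\<bar> + 1) * seminorm (X m - X n)"
      by (intro mult_right_mono seminorm_nonneg) auto
    also have "\<dots> \<le> (\<bar>C\<bar> + 1) * d"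
      using N1[of m n] that by (intro mult_left_mono) auto
    also have "(\<bar>C\<bar> + 1) * d = e / 2"
      using abs_ge_zero[of C] unfolding d_def by (subst nonzero_mult_div_cancel_left[symmetric, of "\<bar>C\<bar> + 1"]) auto
    finally show ?thesis using assms(3)[of m n] N2[of m n] that by simp
  qed
  then show "\<exists>N. \<forall>m\<ge>N. \<forall>n\<ge>N. seminorm (Z m - Z n) < e" by blast
qed

lemma seminorm_null_combine:
  assumes "(\<lambda>n. seminorm (X n)) \<longlonglongrightarrow> 0" "(\<lambda>n. seminorm (Y n)) \<longlonglongrightarrow> 0"
    and "\<And>n. seminorm (Z n) \<le> C * seminorm (X n) + seminorm (Y n)"
  shows "(\<lambda>n. seminorm (Z n)) \<longlonglongrightarrow> 0"
proof (rule Lim_null_comparison)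
  have "(\<lambda>n. C * seminorm (X n) + seminorm (Y n)) \<longlonglongrightarrow> C * 0 + 0"
    by (intro tendsto_intros assms)
  then show "(\<lambda>n. C * seminorm (X n) + seminorm (Y n)) \<longlonglongrightarrow> 0" by simp
qed (simp add: seminorm_nonneg assms(3))

lemma seminorm_Cauchy_const: "seminorm_Cauchy (\<lambda>_. x)"
  by (simp add: seminorm_Cauchy_def seminorm_zero)

lemma completion_rel_refl: "seminorm_Cauchy X \<Longrightarrow> completion_rel X X"
  by (simp add: completion_rel_def seminorm_zero)

lemma completion_rel_sym: "completion_rel X Y \<Longrightarrow> completion_rel Y X"
  unfolding completion_rel_def by (simp add: seminorm_minus_commute)

lemma completion_rel_trans: "completion_rel X Y \<Longrightarrow> completion_rel Y Z \<Longrightarrow> completion_rel X Z"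
  unfolding completion_rel_def
  using seminorm_null_combine[of "\<lambda>n. X n - Y n" "\<lambda>n. Y n - Z n" "\<lambda>n. X n - Z n" 1]
  by (simp add: seminorm_triangle_diff)

lemma completion_rel_combine:
  assumes "completion_rel X X'" "completion_rel Y Y'"
    and "\<And>x x' y y'. seminorm (f x y - f x' y') \<le> C * seminorm (x - x') + seminorm (y - y')"
  shows "completion_rel (\<lambda>n. f (X n) (Y n)) (\<lambda>n. f (X' n) (Y' n))"
  using assms(1,2) unfolding completion_rel_def
  by (auto intro: seminorm_null_combine[OF _ _ assms(3)] seminorm_Cauchy_combine[OF _ _ assms(3)])

lemma convergent_seminorm: "seminorm_Cauchy X \<Longrightarrow> convergent (\<lambda>n. seminorm (X n))"
  unfolding seminorm_Cauchy_def Cauchy_convergent_iff[symmetric] Cauchy_def dist_real_def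
  by (meson abs_seminorm_diff_le le_less_trans)

quotient_type (overloaded) 'a completion =
  "nat \<Rightarrow> 'a::real_seminormed_vector" / partial: completion_rel
proof (rule part_equivpI)
  show "\<exists>X :: nat \<Rightarrow> 'a. completion_rel X X"
    using completion_rel_refl[OF seminorm_Cauchy_const] by blast
qed (blast intro: sympI transpI completion_rel_sym completion_rel_trans)+

instantiation completion :: (real_seminormed_vector) real_vector
begin

lift_definition zero_completion :: "'a completion" is "\<lambda>_. 0"
  by (rule completion_rel_refl[OF seminorm_Cauchy_const])

lift_definition plus_completion :: "'a completion \<Rightarrow> 'a completion \<Rightarrow> 'a completion"
  is "\<lambda>X Y n. X n + Y n"
proof (rule completion_rel_combine[where f = "(+)" and C = 1])
  show "seminorm (x + y - (x' + y')) \<le> 1 * seminorm (x - x') + seminorm (y - y')" for x x' y y' :: 'a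
    using seminorm_triangle[of "x - x'" "y - y'"] by (simp add: add_diff_add)
qed

lift_definition uminus_completion :: "'a completion \<Rightarrow> 'a completion" is "\<lambda>X n. - X n"
proof (rule completion_rel_combine[where f = "\<lambda>x y. - x" and C = 1])
  show "seminorm (- x - - x') \<le> 1 * seminorm (x - x') + seminorm (y - y')" for x x' y y' :: 'a
    using seminorm_nonneg[of "y - y'"] by (simp add: seminorm_minus_commute)
qed

lift_definition minus_completion :: "'a completion \<Rightarrow> 'a completion \<Rightarrow> 'a completion"
  is "\<lambda>X Y n. X n - Y n"
proof (rule completion_rel_combine[where f = "(-)" and C = 1])
  show "seminorm (x - y - (x' - y')) \<le> 1 * seminorm (x - x') + seminorm (y - y')" for x x' y y' :: 'a
    using seminorm_triangle[of "x - x'" "y' - y"]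
    by (simp add: seminorm_minus_commute[of y'] algebra_simps)
qed

lift_definition scaleR_completion :: "real \<Rightarrow> 'a completion \<Rightarrow> 'a completion" is "\<lambda>r X n. r *\<^sub>R X n"
proof -
  fix r and X Y :: "nat \<Rightarrow> 'a" assume *: "completion_rel X Y"
  show "completion_rel (\<lambda>n. r *\<^sub>R X n) (\<lambda>n. r *\<^sub>R Y n)"
  proof (rule completion_rel_combine[OF * *, where f = "\<lambda>x y. r *\<^sub>R x" and C = "\<bar>r\<bar>"])
    show "seminorm (r *\<^sub>R x - r *\<^sub>R x') \<le> \<bar>r\<bar> * seminorm (x - x') + seminorm (y - y')"
      for x x' y y' :: 'a
      using seminorm_nonneg[of "y - y'"]
      by (simp add: seminorm_scaleR scaleR_right_diff_distrib[symmetric])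
  qed
qed

instance
proof
  fix x y z :: "'a completion" and r s :: real
  show "x + y + z = x + (y + z)"
    by transfer (use plus_completion.rsp in \<open>auto simp: add.assoc rel_fun_def\<close>)
  show "x + y = y + x"
    by transfer (use plus_completion.rsp in \<open>auto simp: add.commute rel_fun_def\<close>)
  show "0 + x = x" by transfer simp
  show "- x + x = 0" by transfer (simp add: completion_rel_refl seminorm_Cauchy_const)
  show "x - y = x + - y"
    by transfer (use minus_completion.rsp in \<open>auto simp: rel_fun_def\<close>)
  show "r *\<^sub>R (x + y) = r *\<^sub>R x + r *\<^sub>R y"
    by transfer (use plus_completion.rsp scaleR_completion.rsp
        in \<open>simp add: scaleR_add_right[symmetric] rel_fun_def\<close>)
  show "(r + s) *\<^sub>R x = r *\<^sub>R x + s *\<^sub>R x"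
    by transfer (use scaleR_completion.rsp in \<open>simp add: scaleR_add_left[symmetric] rel_fun_def\<close>)
  show "r *\<^sub>R s *\<^sub>R x = (r * s) *\<^sub>R x"
    by transfer (use scaleR_completion.rsp in \<open>simp add: rel_fun_def\<close>)
  show "1 *\<^sub>R x = x" by transfer simp
qed

end

instantiation completion :: (real_seminormed_vector) real_normed_vector
begin

lift_definition norm_completion :: "'a completion \<Rightarrow> real" is "\<lambda>X. lim (\<lambda>n. seminorm (X n))"
proof -
  fix X Y :: "nat \<Rightarrow> 'a" assume XY: "completion_rel X Y"
  then have X: "(\<lambda>n. seminorm (X n)) \<longlonglongrightarrow> lim (\<lambda>n. seminorm (X n))"
    by (simp add: completion_rel_def convergent_seminorm convergent_LIMSEQ_iff[symmetric])
  have "(\<lambda>n. seminorm (X n) - seminorm (Y n)) \<longlonglongrightarrow> 0"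
  proof (rule Lim_null_comparison)
    show "(\<lambda>n. seminorm (X n - Y n)) \<longlonglongrightarrow> 0" using XY by (simp add: completion_rel_def)
    show "\<forall>\<^sub>F n in sequentially. norm (seminorm (X n) - seminorm (Y n)) \<le> seminorm (X n - Y n)"
      by (simp add: abs_seminorm_diff_le)
  qed
  from tendsto_diff[OF X this] show "lim (\<lambda>n. seminorm (X n)) = lim (\<lambda>n. seminorm (Y n))"
    by (simp add: limI)
qed

definition dist_completion :: "'a completion \<Rightarrow> 'a completion \<Rightarrow> real" where
  "dist_completion x y = norm (x - y)"

definition sgn_completion :: "'a completion \<Rightarrow> 'a completion" where
  "sgn_completion x = x /\<^sub>R norm x"

definition uniformity_completion :: "('a completion \<times> 'a completion) filter" where
  "uniformity_completion = (INF e\<in>{0<..}. principal {(x, y). dist x y < e})"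

definition open_completion :: "'a completion set \<Rightarrow> bool" where
  "open_completion U = (\<forall>x\<in>U. \<forall>\<^sub>F (x', y) in uniformity. x' = x \<longrightarrow> y \<in> U)"

instance
proof
  have lim: "(\<lambda>n. seminorm (X n)) \<longlonglongrightarrow> lim (\<lambda>n. seminorm (X n))" if "completion_rel X X"
    for X :: "nat \<Rightarrow> 'a"
    using that by (simp add: completion_rel_def convergent_seminorm convergent_LIMSEQ_iff[symmetric])
  fix x y :: "'a completion" and r :: real
  show "dist x y = norm (x - y)" by (rule dist_completion_def)
  show "sgn x = x /\<^sub>R norm x" by (rule sgn_completion_def)
  show "uniformity = (INF e\<in>{0<..}. principal {(x, y :: 'a completion). dist x y < e})"
    by (rule uniformity_completion_def)
  show "open U = (\<forall>x\<in>U. \<forall>\<^sub>F (x', y) in uniformity. x' = x \<longrightarrow> y \<in> U)" for U :: "'a completion set"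
    by (rule open_completion_def)
  show "norm x = 0 \<longleftrightarrow> x = 0"
  proof transfer
    fix X :: "nat \<Rightarrow> 'a" assume X: "completion_rel X X"
    have *: "completion_rel X (\<lambda>_. 0) \<longleftrightarrow> (\<lambda>n. seminorm (X n)) \<longlonglongrightarrow> 0"
      using X by (simp add: completion_rel_def seminorm_Cauchy_const)
    show "lim (\<lambda>n. seminorm (X n)) = 0 \<longleftrightarrow> completion_rel X (\<lambda>_. 0)"
      unfolding * using lim[OF X] limI by metis
  qed
  show "norm (x + y) \<le> norm x + norm y"
  proof transfer
    fix X Y :: "nat \<Rightarrow> 'a" assume X: "completion_rel X X" and Y: "completion_rel Y Y"
    have XY: "completion_rel (\<lambda>n. X n + Y n) (\<lambda>n. X n + Y n)"
      using X Y plus_completion.rsp by (auto simp: rel_fun_def)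
    show "lim (\<lambda>n. seminorm (X n + Y n)) \<le> lim (\<lambda>n. seminorm (X n)) + lim (\<lambda>n. seminorm (Y n))"
      by (rule LIMSEQ_le[OF lim[OF XY] tendsto_add[OF lim[OF X] lim[OF Y]]])
        (auto intro: seminorm_triangle)
  qed
  show "norm (r *\<^sub>R x) = \<bar>r\<bar> * norm x"
  proof transfer
    fix r and X :: "nat \<Rightarrow> 'a" assume X: "completion_rel X X"
    show "lim (\<lambda>n. seminorm (r *\<^sub>R X n)) = \<bar>r\<bar> * lim (\<lambda>n. seminorm (X n))"
      unfolding seminorm_scaleR by (intro limI tendsto_mult_left lim X)
  qed
qed

end

lift_definition to_completion :: "'a::real_seminormed_vector \<Rightarrow> 'a completion" is "\<lambda>x _. x"
  by (rule completion_rel_refl[OF seminorm_Cauchy_const])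

lemma linear_to_completion: "linear to_completion"
proof
  show "to_completion (x + y) = to_completion x + to_completion y" for x y :: 'a
    by transfer (rule completion_rel_refl[OF seminorm_Cauchy_const])
  show "to_completion (r *\<^sub>R x) = r *\<^sub>R to_completion x" for r and x :: 'a
    by transfer (rule completion_rel_refl[OF seminorm_Cauchy_const])
qed

lemma norm_to_completion: "norm (to_completion x) = seminorm x"
  by transfer (simp add: limI)

lemma to_completion_tendsto:
  assumes X: "seminorm_Cauchy X"
  shows "(\<lambda>n. to_completion (X n)) \<longlonglongrightarrow> abs_completion X"
proof (rule LIMSEQ_I)
  fix e :: real assume e: "e > 0"
  then obtain N where N: "\<And>m n. m \<ge> N \<Longrightarrow> n \<ge> N \<Longrightarrow> seminorm (X m - X n) < e / 2"
    using X unfolding seminorm_Cauchy_def by (meson half_gt_zero)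
  have "norm (to_completion (X n) - abs_completion X) < e" if n: "n \<ge> N" for n
  proof -
    have Xn: "seminorm_Cauchy (\<lambda>k. X n - X k)"
      by (rule seminorm_Cauchy_combine[OF X X, where C = 0])
        (simp add: seminorm_minus_commute)
    have "to_completion (X n) - abs_completion X = abs_completion (\<lambda>k. X n - X k)"
      unfolding to_completion.abs_eq
      by (simp add: minus_completion.abs_eq completion_rel_refl seminorm_Cauchy_const X)
    then have "norm (to_completion (X n) - abs_completion X) = lim (\<lambda>k. seminorm (X n - X k))"
      by (simp add: norm_completion.abs_eq completion_rel_refl Xn)
    also have "\<dots> \<le> e / 2"
    proof (rule LIMSEQ_le_const2)
      show "(\<lambda>k. seminorm (X n - X k)) \<longlonglongrightarrow> lim (\<lambda>k. seminorm (X n - X k))"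
        using convergent_seminorm[OF Xn] by (simp add: convergent_LIMSEQ_iff)
      show "\<exists>N. \<forall>k\<ge>N. seminorm (X n - X k) \<le> e / 2"
        using N[OF n] by (intro exI[of _ N]) (auto intro: less_imp_le)
    qed
    finally show ?thesis using e by simp
  qed
  then show "\<exists>N. \<forall>n\<ge>N. norm (to_completion (X n) - abs_completion X) < e" by blast
qed

lemma to_completion_dense:
  assumes "e > 0"
  obtains x where "norm (z - to_completion x) < e"
proof -
  define X where "X = rep_completion z"
  have "completion_rel X X" "z = abs_completion X"
    unfolding X_def
    by (rule Quotient_rep_reflp[OF Quotient_completion],
        rule Quotient_abs_rep[OF Quotient_completion, symmetric])
  then have "(\<lambda>n. to_completion (X n)) \<longlonglongrightarrow> z"
    by (simp add: to_completion_tendsto completion_rel_def)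
  from LIMSEQ_D[OF this assms] obtain n where "norm (to_completion (X n) - z) < e" by blast
  then have "norm (z - to_completion (X n)) < e"
    unfolding norm_minus_commute[of z "to_completion (X n)"] .
  then show ?thesis by (rule that)
qed

instance completion :: (real_seminormed_vector) banach
proof
  fix Z :: "nat \<Rightarrow> 'a completion"
  assume Z: "Cauchy Z"
  have "\<exists>x. norm (Z n - to_completion x) < inverse (real (Suc n))" for n
  proof -
    have "0 < inverse (real (Suc n))" by simp
    then show ?thesis by (rule to_completion_dense[of _ "Z n"]) (rule exI)
  qed
  then obtain X where "\<forall>n. norm (Z n - to_completion (X n)) < inverse (real (Suc n))"
    using choice[of "\<lambda>n x. norm (Z n - to_completion x) < inverse (real (Suc n))"] by blast
  then have X: "\<forall>n. norm (Z n - to_completion (X n)) \<le> inverse (real (Suc n))"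
    by (simp only: less_imp_le simp_thms)
  have null: "(\<lambda>n. Z n - to_completion (X n)) \<longlonglongrightarrow> 0"
    by (rule Lim_null_comparison[OF always_eventually[OF X] LIMSEQ_inverse_real_of_nat])
  have "Cauchy (\<lambda>n. to_completion (X n))"
  proof (rule CauchyI)
    fix e :: real assume "e > 0"
    then have e: "e / 3 > 0" by simp
    obtain M where M: "\<And>m n. m \<ge> M \<Longrightarrow> n \<ge> M \<Longrightarrow> norm (Z m - Z n) < e / 3"
      using CauchyD[OF Z e] by blast
    obtain N where N: "\<And>n. n \<ge> N \<Longrightarrow> norm (Z n - to_completion (X n)) < e / 3"
      using LIMSEQ_D[OF null e] by auto
    have "norm (to_completion (X m) - to_completion (X n)) < e" if "m \<ge> max M N" "n \<ge> max M N" for m n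
    proof -
      define a where "a = Z m - Z n"
      define b where "b = Z m - to_completion (X m)"
      define c where "c = Z n - to_completion (X n)"
      have "norm (to_completion (X m) - to_completion (X n)) = norm (a - b + c)"
        by (simp add: a_def b_def c_def)
      also have "\<dots> \<le> norm (a - b) + norm c"
        by (rule norm_triangle_ineq)
      also have "\<dots> \<le> norm a + norm b + norm c"
        by (intro add_right_mono norm_triangle_ineq4)
      also have "\<dots> < e"
      proof -
        have "norm a < e / 3" "norm b < e / 3" "norm c < e / 3"
          unfolding a_def b_def c_def using M[of m n] N[of m] N[of n] that by simp_all
        then show ?thesis by linarith
      qed
      finally show ?thesis .
    qed
    then show "\<exists>K. \<forall>m\<ge>K. \<forall>n\<ge>K. norm (to_completion (X m) - to_completion (X n)) < e" by blast
  qed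
  then have "seminorm_Cauchy X"
    unfolding Cauchy_def seminorm_Cauchy_def dist_norm
      linear_diff[OF linear_to_completion, symmetric] norm_to_completion .
  from tendsto_add[OF null to_completion_tendsto[OF this]]
  have "Z \<longlonglongrightarrow> 0 + abs_completion X" by simp
  then show "convergent Z" by (rule convergentI)
qed


section \<open>Projective and injective tensor powers\<close>

text \<open>
  Two copies of the algebraic tensor power, carrying the projective and the injective norm. By the
  Hahn--Banach theorem both are norms and not just seminorms; this is not needed for the
  construction of their completions, which identifies points at distance zero.
\<close>

typedef (overloaded) ('b, 'l) pre_projective =
  "UNIV :: ('b::real_normed_vector, 'l::finite) tensor_power set" ..

setup_lifting type_definition_pre_projective

instantiation pre_projective :: (real_normed_vector, finite) real_seminormed_vector
begin

lift_definition zero_pre_projective :: "('a, 'b) pre_projective" is 0 .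
lift_definition plus_pre_projective ::
  "('a, 'b) pre_projective \<Rightarrow> ('a, 'b) pre_projective \<Rightarrow> ('a, 'b) pre_projective" is "(+)" .
lift_definition uminus_pre_projective ::
  "('a, 'b) pre_projective \<Rightarrow> ('a, 'b) pre_projective" is uminus .
lift_definition minus_pre_projective ::
  "('a, 'b) pre_projective \<Rightarrow> ('a, 'b) pre_projective \<Rightarrow> ('a, 'b) pre_projective" is "(-)" .
lift_definition scaleR_pre_projective ::
  "real \<Rightarrow> ('a, 'b) pre_projective \<Rightarrow> ('a, 'b) pre_projective" is "(*\<^sub>R)" .
lift_definition seminorm_pre_projective :: "('a, 'b) pre_projective \<Rightarrow> real" is projective_norm .

instance
proof
  fix u v w :: "('a, 'b) pre_projective" and r s :: real
  show "u + v + w = u + (v + w)" by transfer (rule add.assoc)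
  show "u + v = v + u" by transfer (rule add.commute)
  show "0 + u = u" by transfer (rule add_0_left)
  show "- u + u = 0" by transfer (rule left_minus)
  show "u - v = u + - v" by transfer (rule diff_conv_add_uminus)
  show "r *\<^sub>R (u + v) = r *\<^sub>R u + r *\<^sub>R v" by transfer (rule scaleR_add_right)
  show "(r + s) *\<^sub>R u = r *\<^sub>R u + s *\<^sub>R u" by transfer (rule scaleR_add_left)
  show "r *\<^sub>R s *\<^sub>R u = (r * s) *\<^sub>R u" by transfer (rule scaleR_scaleR)
  show "1 *\<^sub>R u = u" by transfer (rule scaleR_one)
  show "seminorm (u + v) \<le> seminorm u + seminorm v" by transfer (rule projective_norm_triangle)
  show "seminorm (r *\<^sub>R u) = \<bar>r\<bar> * seminorm u" by transfer (rule projective_norm_scaleR)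
qed

end

typedef (overloaded) ('b, 'l) pre_injective =
  "UNIV :: ('b::real_normed_vector, 'l::finite) tensor_power set" ..

setup_lifting type_definition_pre_injective

instantiation pre_injective :: (real_normed_vector, finite) real_seminormed_vector
begin

lift_definition zero_pre_injective :: "('a, 'b) pre_injective" is 0 .
lift_definition plus_pre_injective ::
  "('a, 'b) pre_injective \<Rightarrow> ('a, 'b) pre_injective \<Rightarrow> ('a, 'b) pre_injective" is "(+)" .
lift_definition uminus_pre_injective ::
  "('a, 'b) pre_injective \<Rightarrow> ('a, 'b) pre_injective" is uminus .
lift_definition minus_pre_injective ::
  "('a, 'b) pre_injective \<Rightarrow> ('a, 'b) pre_injective \<Rightarrow> ('a, 'b) pre_injective" is "(-)" .
lift_definition scaleR_pre_injective ::
  "real \<Rightarrow> ('a, 'b) pre_injective \<Rightarrow> ('a, 'b) pre_injective" is "(*\<^sub>R)" .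
lift_definition seminorm_pre_injective :: "('a, 'b) pre_injective \<Rightarrow> real" is injective_norm .

instance
proof
  fix u v w :: "('a, 'b) pre_injective" and r s :: real
  show "u + v + w = u + (v + w)" by transfer (rule add.assoc)
  show "u + v = v + u" by transfer (rule add.commute)
  show "0 + u = u" by transfer (rule add_0_left)
  show "- u + u = 0" by transfer (rule left_minus)
  show "u - v = u + - v" by transfer (rule diff_conv_add_uminus)
  show "r *\<^sub>R (u + v) = r *\<^sub>R u + r *\<^sub>R v" by transfer (rule scaleR_add_right)
  show "(r + s) *\<^sub>R u = r *\<^sub>R u + s *\<^sub>R u" by transfer (rule scaleR_add_left)
  show "r *\<^sub>R s *\<^sub>R u = (r * s) *\<^sub>R u" by transfer (rule scaleR_scaleR)
  show "1 *\<^sub>R u = u" by transfer (rule scaleR_one)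
  show "seminorm (u + v) \<le> seminorm u + seminorm v" by transfer (rule injective_norm_triangle)
  show "seminorm (r *\<^sub>R u) = \<bar>r\<bar> * seminorm u" by transfer (rule injective_norm_scaleR)
qed

end

type_synonym ('b, 'l) projective_tensor_power = "('b, 'l) pre_projective completion"
type_synonym ('b, 'l) injective_tensor_power = "('b, 'l) pre_injective completion"

definition projective_power :: "'b::real_normed_vector \<Rightarrow> ('b, 'l::finite) projective_tensor_power" where
  "projective_power x = to_completion (Abs_pre_projective (pure_tensor (\<lambda>_. x)))"

definition injective_power :: "'b::real_normed_vector \<Rightarrow> ('b, 'l::finite) injective_tensor_power" where
  "injective_power x = to_completion (Abs_pre_injective (pure_tensor (\<lambda>_. x)))"


section \<open>Dunford and Pettis integrals\<close>

definition dunford_integrable :: "'w measure \<Rightarrow> ('w \<Rightarrow> 'e::banach) \<Rightarrow> bool" where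
  "dunford_integrable M F \<longleftrightarrow>
     (\<forall>\<phi> :: 'e \<Rightarrow>\<^sub>L real. integrable M (\<lambda>w. blinfun_apply \<phi> (F w)))"

text \<open>
  The integral over a measurable set \<open>A\<close>. Existence, for Dunford integrable functions, is the
  closed graph theorem.
\<close>
definition dunford_integral ::
  "'w measure \<Rightarrow> 'w set \<Rightarrow> ('w \<Rightarrow> 'e::banach) \<Rightarrow> ('e \<Rightarrow>\<^sub>L real) \<Rightarrow>\<^sub>L real" where
  "dunford_integral M A F =
     (THE T. \<forall>\<phi>. blinfun_apply T \<phi> = set_lebesgue_integral M A (\<lambda>w. blinfun_apply \<phi> (F w)))"

lemma dunford_integral_eqI:
  assumes "\<And>\<phi>. blinfun_apply T \<phi> = set_lebesgue_integral M A (\<lambda>w. blinfun_apply \<phi> (F w))"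
  shows "dunford_integral M A F = T"
  unfolding dunford_integral_def
  by (rule the_equality) (use assms in \<open>auto intro!: blinfun_eqI\<close>)

text \<open>The canonical embedding of a Banach space into its bidual.\<close>
lift_definition bidual_embedding :: "'e::banach \<Rightarrow> ('e \<Rightarrow>\<^sub>L real) \<Rightarrow>\<^sub>L real"
  is "\<lambda>x \<phi>. blinfun_apply \<phi> x"
  by (rule blinfun.bounded_linear_left)

definition pettis_integrable :: "'w measure \<Rightarrow> ('w \<Rightarrow> 'e::banach) \<Rightarrow> bool" where
  "pettis_integrable M F \<longleftrightarrow>
     dunford_integrable M F \<and> (\<forall>A\<in>sets M. dunford_integral M A F \<in> range bidual_embedding)"

end

theory Submission
  imports Defs
begin

text \<open>
  Let \<open>\<tau>\<close> be any bounded \<open>l\<close>-linear map from \<open>D([0,1]\<^sup>m)\<close> to a Banach space \<open>E\<close>; both tensor powers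
  are of this kind, and \<open>\<tau>(X, \<dots>, X)\<close> is shown to be Pettis integrable. Up to a small error in the
  norm, \<open>X\<close> is a finite sum of random multiples of indicators of random orthants
  \<open>{t. U\<^sub>j \<le> t\<^sub>j for all j}\<close>, so it suffices to treat \<open>V *\<^sub>R \<tau>(1\<^bsub>[U\<^sub>1,1]\<^esub>, \<dots>, 1\<^bsub>[U\<^sub>N,1]\<^esub>)\<close> for a
  multilinear map on \<open>D([0,1])\<close>. Round each \<open>U\<^sub>i\<close> up to quantile grids, each refining the previous one by
  splitting every cell in two. The increments at one level are then random elements of a family
  \<open>(e\<^sub>k)\<close> of indicators of disjoint intervals, and a suitable choice of signs gives
  \<open>\<Sum> \<beta>(e\<^sub>k\<^sub>1, \<dots>, e\<^sub>k\<^sub>N)\<^sup>2 \<le> C\<^sup>2\<close> for every form \<open>\<beta>\<close> bounded by \<open>C\<close>. By the Cauchy--Schwarz inequality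
  the expansion of the discretised integrand converges absolutely in mean, uniformly over the unit
  ball of \<open>E\<^sup>*\<close>, which makes the discretised integrals a Cauchy sequence. The same bound shows that
  \<open>\<beta>\<close> charges only countably many tuples of jump positions; this gives measurability and
  identifies the limit.
\<close>

section \<open>Functionals and multilinear maps\<close>

text \<open>Indicators of [u,1] for different u in [0,1] are at distance 1 in norm, so
  \<open>X\<close> need not have separable range, even almost surely, and the discretised integrand
  need not converge in norm anywhere. What converges is the mean of |\<beta>(error)|, at a rate
  depending only on the bound of \<beta>, and this suffices because norms in E are suprema over
  functionals. Quantile cells are used because Cauchy--Schwarz leaves the square root of the largest
  cell probability. The U_i may be arbitrarily dependent, so a cell of the product grid is only
  bounded by the least of its marginal probabilities. Replacing the least by the geometric mean
  makes the bound a product over the slots, and the sum over all tuples of levels becomes the N-th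
  power of one geometric series. Even weakly the grid paths need not converge to the right object:
  if s_n decreases strictly to u, the indicators of [s_n,1] tend pointwise to that of (u,1], and
  evaluation at u sees the difference. An atom u of U is therefore made a point of all late grids,
  while any other single u is hit with probability 0.\<close>

lemma norming_functional:
  fixes v :: "'e::real_normed_vector"
  obtains \<phi> :: "'e \<Rightarrow>\<^sub>L real" where "norm \<phi> \<le> 1" "blinfun_apply \<phi> v = norm v"
proof -
  \<comment> \<open>Functionals are represented by their graphs; the norm bound already makes the graphs single-valued.\<close>
  define P where "P = {G :: ('e \<times> real) set. subspace G \<and> (\<forall>p\<in>G. snd p \<le> norm (fst p)) \<and> (v, norm v) \<in> G}"
  have "c * norm v \<le> norm (c *\<^sub>R v)" for c
    by (simp add: mult_right_mono)
  then have "span {(v, norm v)} \<in> P"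
    by (auto simp: P_def span_base) (auto simp: span_singleton)
  moreover have "\<Union>\<C> \<in> P" if "\<C> \<noteq> {}" and chain: "subset.chain P \<C>" for \<C>
  proof -
    have CP: "\<C> \<subseteq> P" and lin: "\<And>G H. G \<in> \<C> \<Longrightarrow> H \<in> \<C> \<Longrightarrow> G \<subseteq> H \<or> H \<subseteq> G"
      using chain by (auto simp: subset_chain_def)
    have "subspace (\<Union>\<C>)"
      unfolding subspace_def
    proof (intro conjI ballI allI)
      show "0 \<in> \<Union>\<C>" using that(1) CP subspace_0 by (fastforce simp: P_def)
      fix x assume x: "x \<in> \<Union>\<C>"
      show "c *\<^sub>R x \<in> \<Union>\<C>" for c using x CP by (auto simp: P_def intro: subspace_scale)
      fix y assume y: "y \<in> \<Union>\<C>"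
      from x y obtain G H where GH: "G \<in> \<C>" "H \<in> \<C>" "x \<in> G" "y \<in> H" by blast
      with lin[of G H] obtain K where "K \<in> \<C>" "x \<in> K" "y \<in> K" by blast
      then show "x + y \<in> \<Union>\<C>" using CP by (auto simp: P_def intro: subspace_add)
    qed
    then show ?thesis using that(1) CP by (auto simp: P_def)
  qed
  ultimately obtain G where G: "G \<in> P" and max: "\<And>H. H \<in> P \<Longrightarrow> G \<subseteq> H \<Longrightarrow> H = G"
    using subset_Zorn_nonempty[of P] by blast
  from G have sub: "subspace G" and le: "\<And>x y. (x, y) \<in> G \<Longrightarrow> y \<le> norm x" and vG: "(v, norm v) \<in> G"
    by (auto simp: P_def)
  have total: "\<exists>y. (x, y) \<in> G" for x
  proof (rule ccontr)
    assume not: "\<nexists>y. (x, y) \<in> G"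
    \<comment> \<open>A value c at x extends the functional within the norm bound exactly when it
      lies between all y - |z - x| and all |z' + x| - y'. By \<open>cross\<close> the former never
      exceed the latter, so their supremum is admissible. Dividing by t, for either sign of t,
      reduces the bound on z + t x to these two inequalities.\<close>
    define L where "L = {y - norm (z - x) | z y. (z, y) \<in> G}"
    have cross: "y - norm (z - x) \<le> norm (z' + x) - y'" if "(z, y) \<in> G" "(z', y') \<in> G" for z y z' y'
    proof -
      have "(z + z', y + y') \<in> G" using subspace_add[OF sub that] by simp
      from le[OF this] norm_triangle_ineq[of "z - x" "z' + x"] show ?thesis by simp
    qed
    have Lne: "L \<noteq> {}" unfolding L_def using vG by blast
    have Lbdd: "bdd_above L" unfolding L_def using cross[OF _ vG] by (auto simp: bdd_above_def)
    define c where "c = Sup L"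
    have c1: "y - norm (z - x) \<le> c" if "(z, y) \<in> G" for z y
      unfolding c_def by (rule cSup_upper[OF _ Lbdd]) (use that in \<open>auto simp: L_def\<close>)
    have c2: "c \<le> norm (z + x) - y" if "(z, y) \<in> G" for z y
      unfolding c_def by (rule cSup_least[OF Lne]) (use that cross in \<open>auto simp: L_def\<close>)
    define H where "H = {p + q | p q. p \<in> G \<and> q \<in> span {(x, c)}}"
    have subH: "subspace H" unfolding H_def by (rule subspace_sums[OF sub subspace_span])
    have "y + t * c \<le> norm (z + t *\<^sub>R x)" if zy: "(z, y) \<in> G" for z y t
    proof -
      consider "t = 0" | "t > 0" | "t < 0" by linarith
      then show ?thesis
      proof cases
        case 1 then show ?thesis using le[OF zy] by simp
      next
        case 2
        have "((1/t) *\<^sub>R z, (1/t) * y) \<in> G" using subspace_scale[OF sub zy, of "1/t"] by simp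
        from c2[OF this] have "t * c \<le> t * (norm ((1/t) *\<^sub>R z + x) - (1/t) * y)"
          using 2 by (intro mult_left_mono) auto
        also have "\<dots> = norm (t *\<^sub>R ((1/t) *\<^sub>R z + x)) - y"
          using 2 by (simp add: right_diff_distrib)
        finally show ?thesis using 2 by (simp add: scaleR_add_right)
      next
        case 3
        have "((-1/t) *\<^sub>R z, (-1/t) * y) \<in> G" using subspace_scale[OF sub zy, of "-1/t"] by simp
        from c1[OF this] have "(-t) * ((-1/t) * y - norm ((-1/t) *\<^sub>R z - x)) \<le> (-t) * c"
          using 3 by (intro mult_left_mono) auto
        moreover have "(-t) * ((-1/t) * y - norm ((-1/t) *\<^sub>R z - x)) = y - norm ((-t) *\<^sub>R ((-1/t) *\<^sub>R z - x))"
          using 3 by (simp add: right_diff_distrib)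
        moreover have "(-t) *\<^sub>R ((-1/t) *\<^sub>R z - x) = z + t *\<^sub>R x"
          using 3 by (simp add: scaleR_diff_right)
        ultimately have "y - norm (z + t *\<^sub>R x) \<le> (-t) * c" by (simp only:)
        then show ?thesis by simp
      qed
    qed
    moreover have "G \<subseteq> H"
    proof
      fix p assume "p \<in> G"
      then have "p = p + 0 \<and> p \<in> G \<and> 0 \<in> span {(x, c)}" by (simp add: span_zero)
      then show "p \<in> H" unfolding H_def by blast
    qed
    moreover from this have "(v, norm v) \<in> H" using vG by blast
    ultimately have "H \<in> P"
      using subH unfolding P_def by (auto simp: H_def span_singleton)
    with max \<open>G \<subseteq> H\<close> have "H = G" by blast
    moreover have "(x, c) \<in> H"
    proof -
      have "(x, c) = 0 + (x, c) \<and> 0 \<in> G \<and> (x, c) \<in> span {(x, c)}"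
        using subspace_0[OF sub] by (simp add: span_base)
      then show ?thesis unfolding H_def by blast
    qed
    ultimately show False using not by blast
  qed
  have uniq: "y = y'" if "(x, y) \<in> G" "(x, y') \<in> G" for x y y'
    using le[of 0 "y - y'"] le[of 0 "y' - y"] subspace_diff[OF sub that] subspace_diff[OF sub that(2,1)] by simp
  define f where "f x = (THE y. (x, y) \<in> G)" for x
  have f: "f x = y \<longleftrightarrow> (x, y) \<in> G" for x y
    unfolding f_def using total[of x] uniq by (metis the_equality)
  have lin: "linear f"
  proof
    show "f (x + y) = f x + f y" for x y
      using subspace_add[OF sub, of "(x, f x)" "(y, f y)"] f by auto
    show "f (r *\<^sub>R x) = r *\<^sub>R f x" for r x
      using subspace_scale[OF sub, of "(x, f x)" r] f by auto
  qed
  have bound: "norm (f x) \<le> norm x * 1" for x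
    using le[of x "f x"] le[of "- x" "f (- x)"] f linear_neg[OF lin, of x] by (auto simp: abs_le_iff)
  have bl: "bounded_linear f"
    using lin bound by (intro bounded_linear.intro bounded_linear_axioms.intro) blast+
  show ?thesis
  proof
    show "norm (Blinfun f) \<le> 1"
      by (rule norm_blinfun_bound) (use bound in \<open>simp_all add: bounded_linear_Blinfun_apply[OF bl]\<close>)
    show "blinfun_apply (Blinfun f) v = norm v"
      using f vG by (simp add: bounded_linear_Blinfun_apply[OF bl])
  qed
qed

lemma norm_le_of_functionals:
  fixes v :: "'e::real_normed_vector"
  assumes "\<And>\<phi> :: 'e \<Rightarrow>\<^sub>L real. norm \<phi> \<le> 1 \<Longrightarrow> \<bar>blinfun_apply \<phi> v\<bar> \<le> B"
  shows "norm v \<le> B"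
  using norming_functional[of v] assms by (metis abs_norm_cancel)

text \<open>S is the set of slots in which the map is still linear. The bound has no factor for the
  other slots: this is the form taken by \<open>jump\<close>, which uses up one slot after the
  other.\<close>

definition multilinear_on ::
  "'n set \<Rightarrow> real \<Rightarrow> (('n::finite \<Rightarrow> 'a::real_normed_vector) \<Rightarrow> 'b::real_normed_vector) \<Rightarrow> bool" where
  "multilinear_on S C \<tau> \<longleftrightarrow>
     0 \<le> C \<and> (\<forall>i\<in>S. \<forall>x. linear (\<lambda>a. \<tau> (x(i := a)))) \<and>
     (\<forall>x. norm (\<tau> x) \<le> C * (\<Prod>i\<in>S. norm (x i)))"

lemma multilinear_on_linear: "multilinear_on S C \<tau> \<Longrightarrow> i \<in> S \<Longrightarrow> linear (\<lambda>a. \<tau> (x(i := a)))"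
  by (simp add: multilinear_on_def)

lemma multilinear_on_nonneg: "multilinear_on S C \<tau> \<Longrightarrow> 0 \<le> C"
  by (simp add: multilinear_on_def)

lemma multilinear_on_norm_le: "multilinear_on S C \<tau> \<Longrightarrow> norm (\<tau> x) \<le> C * (\<Prod>i\<in>S. norm (x i))"
  by (simp add: multilinear_on_def)

lemma multilinear_on_bound:
  assumes "multilinear_on S C \<tau>" "\<And>i. norm (x i) \<le> 1"
  shows "norm (\<tau> x) \<le> C"
proof -
  have "C * (\<Prod>i\<in>S. norm (x i)) \<le> C * 1"
    by (intro mult_left_mono prod_le_1 multilinear_on_nonneg[OF assms(1)]) (simp add: assms(2))
  with multilinear_on_norm_le[OF assms(1), of x] show ?thesis by linarith
qed

lemma multilinear_on_compose:
  assumes "multilinear_on S C \<tau>"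
  shows "multilinear_on S (norm \<phi> * C) (\<lambda>x. blinfun_apply \<phi> (\<tau> x))"
  unfolding multilinear_on_def
proof (intro conjI ballI allI)
  show "0 \<le> norm \<phi> * C" using multilinear_on_nonneg[OF assms] by simp
next
  fix i x assume "i \<in> S"
  then show "linear (\<lambda>a. blinfun_apply \<phi> (\<tau> (x(i := a))))"
    using linear_compose[OF multilinear_on_linear[OF assms] bounded_linear.linear[OF blinfun.bounded_linear_right, of \<phi>]]
    by (simp add: o_def)
next
  fix x :: "'a \<Rightarrow> 'b"
  have "norm (blinfun_apply \<phi> (\<tau> x)) \<le> norm \<phi> * norm (\<tau> x)" by (rule norm_blinfun)
  also have "\<dots> \<le> norm \<phi> * (C * (\<Prod>i\<in>S. norm (x i)))"
    by (intro mult_left_mono multilinear_on_norm_le[OF assms]) simp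
  finally show "norm (blinfun_apply \<phi> (\<tau> x)) \<le> norm \<phi> * C * (\<Prod>i\<in>S. norm (x i))"
    by (simp add: mult.assoc)
qed

lemma multilinear_on_expand:
  fixes \<tau> :: "('n::finite \<Rightarrow> 'a::real_normed_vector) \<Rightarrow> 'b::real_normed_vector" and T :: "'n set"
  assumes ml: "multilinear_on S C \<tau>" and "T \<subseteq> S" and K: "\<And>i. finite (K i)"
  shows "\<tau> (\<lambda>i. if i \<in> T then \<Sum>k\<in>K i. y i k else x i)
       = (\<Sum>k\<in>PiE T K. \<tau> (\<lambda>i. if i \<in> T then y i (k i) else x i))"
proof -
  have "finite T" by simp
  then show ?thesis using \<open>T \<subseteq> S\<close>
  proof (induction T arbitrary: x)
    case (insert j T)
    have lin: "linear (\<lambda>a. \<tau> (x(j := a)))" for x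
      by (rule multilinear_on_linear[OF ml]) (use insert in auto)
    define x' where "x' = (\<lambda>i. if i \<in> T then \<Sum>k\<in>K i. y i k else x i)"
    have "\<tau> (\<lambda>i. if i \<in> insert j T then \<Sum>k\<in>K i. y i k else x i) = \<tau> (x'(j := \<Sum>k\<in>K j. y j k))"
      by (rule arg_cong[where f = \<tau>]) (use insert in \<open>auto simp: x'_def\<close>)
    also have "\<dots> = (\<Sum>k\<in>K j. \<tau> (x'(j := y j k)))" by (rule linear_sum[OF lin])
    also have "\<dots> = (\<Sum>k\<in>K j. \<Sum>l\<in>PiE T K. \<tau> (\<lambda>i. if i \<in> T then y i (l i) else (x(j := y j k)) i))"
    proof (rule sum.cong)
      fix k
      have "x'(j := y j k) = (\<lambda>i. if i \<in> T then \<Sum>k\<in>K i. y i k else (x(j := y j k)) i)"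
        using insert by (auto simp: x'_def)
      then show "\<tau> (x'(j := y j k)) = (\<Sum>l\<in>PiE T K. \<tau> (\<lambda>i. if i \<in> T then y i (l i) else (x(j := y j k)) i))"
        using insert.IH[of "x(j := y j k)"] insert.prems by simp
    qed simp
    also have "\<dots> = (\<Sum>(k, l)\<in>K j \<times> PiE T K. \<tau> (\<lambda>i. if i \<in> T then y i (l i) else (x(j := y j k)) i))"
      using K by (simp add: sum.cartesian_product)
    also have "\<dots> = (\<Sum>k\<in>PiE (insert j T) K. \<tau> (\<lambda>i. if i \<in> insert j T then y i (k i) else x i))"
      unfolding PiE_insert_eq using insert
      by (subst sum.reindex[OF inj_combinator]) (auto intro!: sum.cong arg_cong[where f = \<tau>] simp: fun_eq_iff)
    finally show ?case .
  qed simp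
qed

lemma multilinear_on_scale:
  fixes \<tau> :: "('n::finite \<Rightarrow> 'a::real_normed_vector) \<Rightarrow> 'b::real_normed_vector" and T :: "'n set"
  assumes ml: "multilinear_on S C \<tau>" and "T \<subseteq> S"
  shows "\<tau> (\<lambda>i. if i \<in> T then c i *\<^sub>R x i else x i) = (\<Prod>i\<in>T. c i) *\<^sub>R \<tau> x"
proof -
  have "finite T" by simp
  then show ?thesis using \<open>T \<subseteq> S\<close>
  proof (induction T)
    case (insert j T)
    define x' where "x' = (\<lambda>i. if i \<in> T then c i *\<^sub>R x i else x i)"
    have lin: "linear (\<lambda>a. \<tau> (x'(j := a)))"
      by (rule multilinear_on_linear[OF ml]) (use insert in auto)
    have "\<tau> (\<lambda>i. if i \<in> insert j T then c i *\<^sub>R x i else x i) = \<tau> (x'(j := c j *\<^sub>R x j))"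
      by (rule arg_cong[where f = \<tau>]) (use insert in \<open>auto simp: x'_def\<close>)
    also have "\<dots> = c j *\<^sub>R \<tau> (x'(j := x j))" by (rule linear_scale[OF lin])
    also have "x'(j := x j) = x'" using insert by (auto simp: x'_def)
    finally show ?case using insert by (simp add: x'_def)
  qed simp
qed

text \<open>Over independent random signs the right-hand side has the left-hand side as its mean.
  The induction fixes one sign at a time: by the parallelogram identity the two choices average to
  the required value, so one of them reaches it.\<close>

lemma signs_square_sum:
  fixes a :: "'k \<Rightarrow> 'y \<Rightarrow> real"
  assumes "finite K"
  obtains \<epsilon> :: "'k \<Rightarrow> real" where "\<And>k. \<bar>\<epsilon> k\<bar> = 1"
    "(\<Sum>k\<in>K. \<Sum>y\<in>Y. (a k y)\<^sup>2) \<le> (\<Sum>y\<in>Y. (\<Sum>k\<in>K. \<epsilon> k * a k y)\<^sup>2)"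
proof -
  have "\<exists>\<epsilon> :: 'k \<Rightarrow> real. (\<forall>k. \<bar>\<epsilon> k\<bar> = 1) \<and>
    (\<Sum>k\<in>K. \<Sum>y\<in>Y. (a k y)\<^sup>2) \<le> (\<Sum>y\<in>Y. (\<Sum>k\<in>K. \<epsilon> k * a k y)\<^sup>2)"
    using assms
  proof induction
    case empty
    then show ?case by (intro exI[of _ "\<lambda>_. 1"]) simp
  next
    case (insert j K)
    then obtain \<epsilon> where \<epsilon>: "\<And>k. \<bar>\<epsilon> k\<bar> = 1"
      "(\<Sum>k\<in>K. \<Sum>y\<in>Y. (a k y)\<^sup>2) \<le> (\<Sum>y\<in>Y. (\<Sum>k\<in>K. \<epsilon> k * a k y)\<^sup>2)" by blast
    define s where "s y = (\<Sum>k\<in>K. \<epsilon> k * a k y)" for y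
    have upd: "(\<Sum>k\<in>insert j K. (\<epsilon>(j := c)) k * a k y) = c * a j y + s y" for c y
      using insert by (simp add: s_def) (intro sum.cong, auto)
    have sgn: "(\<Sum>y\<in>Y. (1 * a j y + s y)\<^sup>2) + (\<Sum>y\<in>Y. ((- 1) * a j y + s y)\<^sup>2)
        = 2 * ((\<Sum>y\<in>Y. (a j y)\<^sup>2) + (\<Sum>y\<in>Y. (s y)\<^sup>2))"
      by (simp add: sum.distrib[symmetric] sum_distrib_left power2_eq_square algebra_simps)
    obtain c where c: "c = 1 \<or> c = -1"
      "(\<Sum>y\<in>Y. (a j y)\<^sup>2) + (\<Sum>y\<in>Y. (s y)\<^sup>2) \<le> (\<Sum>y\<in>Y. (c * a j y + s y)\<^sup>2)"
    proof (cases "(\<Sum>y\<in>Y. (a j y)\<^sup>2) + (\<Sum>y\<in>Y. (s y)\<^sup>2) \<le> (\<Sum>y\<in>Y. (1 * a j y + s y)\<^sup>2)")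
      case False
      have half: "q \<le> c" if "b + c = 2 * q" "\<not> q \<le> b" for b c q :: real
        using that by linarith
      have "(\<Sum>y\<in>Y. (a j y)\<^sup>2) + (\<Sum>y\<in>Y. (s y)\<^sup>2) \<le> (\<Sum>y\<in>Y. ((- 1) * a j y + s y)\<^sup>2)"
        by (rule half[OF sgn False])
      then show ?thesis using that by blast
    qed (use that in blast)
    then show ?case
      using insert(1,2) \<epsilon> by (intro exI[of _ "\<epsilon>(j := c)"] conjI)
        (simp_all only: upd s_def[symmetric] sum.insert, auto)
  qed
  then show ?thesis using that by blast
qed

text \<open>One slot at a time, \<open>signs_square_sum\<close> replaces the whole family in that
  slot by a single signed sum z, of norm at most 1, without decreasing the sum of squares. At the
  end one value of \<beta> at vectors of norm at most 1 remains.\<close>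

lemma multilinear_square_sum:
  fixes \<beta> :: "('n::finite \<Rightarrow> 'a::real_normed_vector) \<Rightarrow> real"
  assumes ml: "multilinear_on S C \<beta>" and "T \<subseteq> S" and K: "\<And>i. finite (K i)"
    and e: "\<And>i \<epsilon>. i \<in> T \<Longrightarrow> (\<And>k. \<bar>\<epsilon> k\<bar> = 1) \<Longrightarrow> norm (\<Sum>k\<in>K i. \<epsilon> k *\<^sub>R e i k) \<le> 1"
    and x: "\<And>i. norm (x i) \<le> 1"
  shows "(\<Sum>k\<in>PiE T K. (\<beta> (\<lambda>i. if i \<in> T then e i (k i) else x i))\<^sup>2) \<le> C\<^sup>2"
proof -
  have "finite T" by simp
  then show ?thesis using \<open>T \<subseteq> S\<close> e x
  proof (induction T arbitrary: x)
    case empty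
    then show ?case using multilinear_on_bound[OF ml empty(3)] abs_le_square_iff multilinear_on_nonneg[OF ml] by (auto simp: abs_le_square_iff[symmetric])
  next
    case (insert j T)
    define a where "a k l = \<beta> (\<lambda>i. if i \<in> T then e i (l i) else (x(j := e j k)) i)" for k l
    obtain \<epsilon> where \<epsilon>: "\<And>k. \<bar>\<epsilon> k\<bar> = 1"
      "(\<Sum>k\<in>K j. \<Sum>l\<in>PiE T K. (a k l)\<^sup>2) \<le> (\<Sum>l\<in>PiE T K. (\<Sum>k\<in>K j. \<epsilon> k * a k l)\<^sup>2)"
      using signs_square_sum[OF K, where a = a] by blast
    have lin: "linear (\<lambda>a. \<beta> (x(j := a)))" for x
      by (rule multilinear_on_linear[OF ml]) (use insert in auto)
    define z where "z = (\<Sum>k\<in>K j. \<epsilon> k *\<^sub>R e j k)"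
    have "(\<Sum>k\<in>PiE (insert j T) K. (\<beta> (\<lambda>i. if i \<in> insert j T then e i (k i) else x i))\<^sup>2)
        = (\<Sum>(k, l)\<in>K j \<times> PiE T K. (a k l)\<^sup>2)"
      unfolding PiE_insert_eq a_def using insert
      by (subst sum.reindex[OF inj_combinator])
        (auto intro!: sum.cong arg_cong[where f = "\<lambda>x. (\<beta> x)\<^sup>2"] simp: fun_eq_iff)
    also have "\<dots> = (\<Sum>k\<in>K j. \<Sum>l\<in>PiE T K. (a k l)\<^sup>2)"
      using K by (simp add: sum.cartesian_product)
    also have "\<dots> \<le> (\<Sum>l\<in>PiE T K. (\<Sum>k\<in>K j. \<epsilon> k * a k l)\<^sup>2)" by (rule \<epsilon>)
    also have "\<dots> = (\<Sum>l\<in>PiE T K. (\<beta> (\<lambda>i. if i \<in> T then e i (l i) else (x(j := z)) i))\<^sup>2)"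
    proof (intro sum.cong refl arg_cong[where f = "\<lambda>r. r\<^sup>2"])
      fix l
      define x' where "x' = (\<lambda>i. if i \<in> T then e i (l i) else x i)"
      have *: "(\<lambda>i. if i \<in> T then e i (l i) else (x(j := w)) i) = x'(j := w)" for w
        using insert by (auto simp: x'_def)
      show "(\<Sum>k\<in>K j. \<epsilon> k * a k l) = \<beta> (\<lambda>i. if i \<in> T then e i (l i) else (x(j := z)) i)"
        unfolding a_def * z_def by (simp add: linear_sum[OF lin] linear_scale[OF lin])
    qed
    also have "\<dots> \<le> C\<^sup>2"
    proof (rule insert.IH)
      show "norm ((x(j := z)) i) \<le> 1" for i
        using insert.prems(2)[of j \<epsilon>] insert.prems(3) \<epsilon>(1) by (simp add: z_def)
    qed (use insert.prems in auto)
    finally show ?case .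
  qed
qed

section \<open>Indicator paths and their products\<close>

definition indicator_path :: "real \<Rightarrow> 1 skorokhod" where
  "indicator_path u = Abs_skorokhod (\<lambda>t. if t \<in> unit_cube \<and> u \<le> t $ 1 then 1 else 0)"

lemma eval_indicator_path:
  "eval (indicator_path u) t = (if t \<in> unit_cube \<and> u \<le> t $ 1 then 1 else 0)"
proof -
  have "cadlag_on_cube (\<lambda>t :: real ^ 1. if t \<in> unit_cube \<and> u \<le> t $ 1 then 1 else 0)"
    unfolding cadlag_on_cube_def
  proof (intro ballI allI impI)
    fix t :: "real ^ 1" and L :: "1 set"
    assume t: "t \<in> unit_cube"
    \<comment> \<open>The left limit replaces u \<le> t by u < t. The two differ only at t = u;
      elsewhere the indicator is locally constant on the cube.\<close>
    define y :: real where "y = (if 1 \<in> L then (if u < t $ 1 then 1 else 0) else (if u \<le> t $ 1 then 1 else 0))"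
    have o: "open {s :: real ^ 1. u < s $ 1}" "open {s :: real ^ 1. s $ 1 < u}"
      by (auto intro!: open_Collect_less continuous_intros)
    have "\<forall>\<^sub>F s in nhds t. s \<in> cube_orthant t L \<longrightarrow> (if s \<in> unit_cube \<and> u \<le> s $ 1 then 1 else 0) = y"
    proof (cases "u < t $ 1")
      case True
      then have "\<forall>\<^sub>F s in nhds t. u < s $ 1" using o(1) by (auto simp: eventually_nhds)
      then show ?thesis by eventually_elim (use True in \<open>auto simp: y_def cube_orthant_def\<close>)
    next
      case False
      then consider "t $ 1 < u" | "t $ 1 = u" by linarith
      then show ?thesis
      proof cases
        case 1
        then have "\<forall>\<^sub>F s in nhds t. s $ 1 < u" using o(2) by (auto simp: eventually_nhds)
        then show ?thesis by eventually_elim (use 1 in \<open>auto simp: y_def cube_orthant_def\<close>)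
      next
        case 2
        then show ?thesis
          by (intro always_eventually) (auto simp: y_def cube_orthant_def dest: spec[of _ 1])
      qed
    qed
    then show "\<exists>y. ((\<lambda>t. if t \<in> unit_cube \<and> u \<le> t $ 1 then 1 else 0 :: real) \<longlongrightarrow> y)
        (inf (nhds t) (principal (cube_orthant t L)))"
      by (intro exI[of _ y] tendsto_eventually) (simp add: eventually_inf_principal)
  qed
  then show ?thesis unfolding indicator_path_def by (subst Abs_skorokhod_inverse) auto
qed

lemma norm_indicator_path_le: "norm (indicator_path u) \<le> 1"
  by (rule norm_skorokhod_least) (simp add: eval_indicator_path)

lemma eval_sum: "eval (\<Sum>k\<in>K. f k) t = (\<Sum>k\<in>K. eval (f k) t)"
  by (induction K rule: infinite_finite_induct) (simp_all add: eval_simps)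

text \<open>The differences are indicators of the half-open intervals [a k, b k), restricted to the
  unit interval. These are disjoint, so at each t at most one term is non-zero.\<close>

lemma norm_indicator_path_sum_le:
  fixes a b :: "'k \<Rightarrow> real"
  assumes ab: "\<And>k. k \<in> K \<Longrightarrow> a k \<le> b k"
    and disj: "\<And>j k. j \<in> K \<Longrightarrow> k \<in> K \<Longrightarrow> j \<noteq> k \<Longrightarrow> b j \<le> a k \<or> b k \<le> a j"
    and c: "\<And>k. k \<in> K \<Longrightarrow> \<bar>c k\<bar> \<le> 1"
  shows "norm (\<Sum>k\<in>K. c k *\<^sub>R (indicator_path (a k) - indicator_path (b k))) \<le> 1"
proof (rule norm_skorokhod_least)
  fix t :: "real ^ 1" assume t: "t \<in> unit_cube"
  define J where "J = {k\<in>K. a k \<le> t $ 1 \<and> t $ 1 < b k}"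
  have one: "j = k" if "j \<in> J" "k \<in> J" for j k
    using that disj[of j k] by (auto simp: J_def)
  have ev: "eval (\<Sum>k\<in>K. c k *\<^sub>R (indicator_path (a k) - indicator_path (b k))) t = (\<Sum>k\<in>K. if k \<in> J then c k else 0)"
    unfolding eval_sum using t ab
    by (intro sum.cong) (fastforce simp: eval_simps eval_indicator_path J_def)+
  show "\<bar>eval (\<Sum>k\<in>K. c k *\<^sub>R (indicator_path (a k) - indicator_path (b k))) t\<bar> \<le> 1"
  proof (cases "J = {} \<or> infinite K")
    case True
    then show ?thesis unfolding ev by (auto simp: sum.infinite)
  next
    case False
    then obtain k where k: "k \<in> J" by blast
    with one have "J = {k}" by blast
    then have "(\<Sum>k\<in>K. if k \<in> J then c k else 0) = c k"
      using False k by (auto simp: J_def)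
    then show ?thesis unfolding ev using c k by (auto simp: J_def)
  qed
qed

text \<open>The indicator of an orthant is a product of one-dimensional indicators. An l-linear map
  on functions of m variables thereby becomes an l*m-linear map on paths, and grids on the line are
  enough.\<close>

definition product_path :: "('m::finite \<Rightarrow> 1 skorokhod) \<Rightarrow> 'm skorokhod" where
  "product_path f = Abs_skorokhod (\<lambda>t. \<Prod>j\<in>UNIV. eval (f j) (vec (t $ j)))"

lemma eval_product_path:
  fixes f :: "'m::finite \<Rightarrow> 1 skorokhod"
  shows "eval (product_path f) t = (\<Prod>j\<in>UNIV. eval (f j) (vec (t $ j)))"
proof -
  have "cadlag_on_cube (\<lambda>t :: real ^ 'm. \<Prod>j\<in>UNIV. eval (f j) (vec (t $ j)))"
    unfolding cadlag_on_cube_def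
  proof (intro ballI allI impI)
    fix t :: "real ^ 'm" and L :: "'m set"
    assume t: "t \<in> unit_cube" and L: "L \<subseteq> {i. 0 < t $ i}"
    have "\<exists>y. ((\<lambda>t. eval (f j) (vec (t $ j))) \<longlongrightarrow> y) (inf (nhds t) (principal (cube_orthant t L)))" for j
    proof -
      \<comment> \<open>The projection to coordinate j sends an orthant at t to the left or the
        right half-line at t_j, according to whether j belongs to L.\<close>
      define L' :: "1 set" where "L' = (if j \<in> L then UNIV else {})"
      have "(vec (t $ j) :: real ^ 1) \<in> unit_cube" "L' \<subseteq> {i. 0 < (vec (t $ j) :: real ^ 1) $ i}"
        using t L by (auto simp: L'_def unit_cube_def)
      then obtain y where y: "(eval (f j) \<longlongrightarrow> y) (inf (nhds (vec (t $ j))) (principal (cube_orthant (vec (t $ j)) L')))"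
        using eval[of "f j"] unfolding cadlag_on_cube_def by blast
      have "filterlim (\<lambda>s. vec (s $ j) :: real ^ 1) (inf (nhds (vec (t $ j))) (principal (cube_orthant (vec (t $ j)) L')))
         (inf (nhds t) (principal (cube_orthant t L)))"
        unfolding filterlim_inf filterlim_principal
      proof
        have "((\<lambda>s. s $ j) \<longlongrightarrow> t $ j) (nhds t)"
          by (intro tendsto_vec_nth filterlim_ident)
        then have "((\<lambda>s. vec (s $ j) :: real ^ 1) \<longlongrightarrow> vec (t $ j)) (nhds t)"
          by (intro vec_tendstoI) simp
        then show "((\<lambda>s. vec (s $ j) :: real ^ 1) \<longlongrightarrow> vec (t $ j)) (inf (nhds t) (principal (cube_orthant t L)))"
          by (rule filterlim_mono) auto
        show "\<forall>\<^sub>F s in inf (nhds t) (principal (cube_orthant t L)). (vec (s $ j) :: real ^ 1) \<in> cube_orthant (vec (t $ j)) L'"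
          unfolding eventually_inf_principal
          by (intro always_eventually) (auto simp: cube_orthant_def unit_cube_def L'_def split: if_splits)
      qed
      from filterlim_compose[OF y this] show ?thesis by blast
    qed
    then obtain y where "\<And>j. ((\<lambda>t. eval (f j) (vec (t $ j))) \<longlongrightarrow> y j) (inf (nhds t) (principal (cube_orthant t L)))"
      by metis
    then show "\<exists>y. ((\<lambda>t. \<Prod>j\<in>UNIV. eval (f j) (vec (t $ j))) \<longlongrightarrow> y) (inf (nhds t) (principal (cube_orthant t L)))"
      by (intro exI[of _ "\<Prod>j\<in>UNIV. y j"] tendsto_prod)
  qed
  moreover have "(\<Prod>j\<in>UNIV. eval (f j) (vec (t $ j))) = 0" if "t \<notin> unit_cube" for t :: "real ^ 'm"
  proof -
    from that obtain j where "\<not> (0 \<le> t $ j \<and> t $ j \<le> 1)" by (auto simp: unit_cube_def)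
    then have "eval (f j) (vec (t $ j)) = 0" by (intro eval_outside) (auto simp: unit_cube_def)
    then show ?thesis by (auto simp: prod_zero_iff)
  qed
  ultimately show ?thesis
    unfolding product_path_def by (subst Abs_skorokhod_inverse) auto
qed

lemma norm_product_path_le: "norm (product_path f) \<le> (\<Prod>j\<in>UNIV. norm (f j))"
  by (rule norm_skorokhod_least)
    (auto simp: eval_product_path abs_prod intro!: prod_mono abs_eval_le_norm)

lemma linear_product_path: "linear (\<lambda>a. product_path (f(j := a)))"
proof -
  have *: "eval (product_path (f(j := a))) t = eval a (vec (t $ j)) * (\<Prod>i\<in>UNIV - {j}. eval (f i) (vec (t $ i)))" for a t
    unfolding eval_product_path by (subst prod.remove[of _ j]) auto
  show ?thesis
    by standard (simp_all add: eval_inject[symmetric] fun_eq_iff eval_simps * distrib_right)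
qed

section \<open>Quantile grids\<close>

text \<open>
  \<open>\<sigma> n\<close> rounds up to the \<open>n\<close>-th grid, \<open>\<kappa> q u\<close> is the index of the cell of \<open>u\<close> in the grid \<open>q + 1\<close>,
  and \<open>e q k\<close> is the increment from grid \<open>q\<close> to grid \<open>q + 1\<close> on the cell \<open>k\<close>. Points range over
  \<open>[0, 2]\<close> because \<open>indicator_path 2 = 0\<close>.
\<close>
definition slot_grid ::
  "'w measure \<Rightarrow> ('w \<Rightarrow> real) \<Rightarrow> (nat \<Rightarrow> real \<Rightarrow> real) \<Rightarrow> (nat \<Rightarrow> real \<Rightarrow> nat) \<Rightarrow>
    (nat \<Rightarrow> nat \<Rightarrow> 1 skorokhod) \<Rightarrow> bool" where
  "slot_grid M U \<sigma> \<kappa> e \<longleftrightarrow>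
     (\<forall>n. \<sigma> n \<in> borel_measurable borel \<and> finite (range (\<sigma> n))) \<and>
     (\<forall>q u. \<kappa> q \<in> measurable borel (count_space UNIV) \<and> \<kappa> q u \<le> 2 ^ Suc q) \<and>
     (\<forall>u\<in>{0..2}. (\<forall>n. u \<le> \<sigma> n u) \<and> decseq (\<lambda>n. \<sigma> n u) \<and> (\<lambda>n. \<sigma> n u) \<longlonglongrightarrow> u) \<and>
     (\<forall>u\<in>{0..2}. 0 < measure M {w\<in>space M. U w = u} \<longrightarrow> (\<forall>\<^sub>F n in sequentially. \<sigma> n u = u)) \<and>
     (\<forall>n u. indicator_path (\<sigma> n u) = (\<Sum>q<n. e q (\<kappa> q u))) \<and>
     (\<forall>q \<epsilon>. (\<forall>k. \<bar>\<epsilon> k\<bar> = 1) \<longrightarrow> norm (\<Sum>k\<le>2 ^ Suc q. \<epsilon> k *\<^sub>R e q k) \<le> 1) \<and>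
     (\<forall>q k. e q k \<noteq> 0 \<longrightarrow> measure M {w\<in>space M. \<kappa> q (U w) = k} \<le> 4 / 2 ^ q)"

text \<open>The grids are read off from the generalised inverse \<open>a\<close> of \<theta>.
  Counting U < u strictly makes \<theta> left-continuous on [0,2], so the supremum in
  \<open>a\<close> is attained and \<open>a_iff\<close> is a Galois connection. The slope of
  \<theta> on [0,2] is at least 1/4, so the mesh is at most 4/2^n. To the right of an atom of mass
  p, \<theta> is larger by at least p/4, so every fine enough grid contains the atom.\<close>

lemma slot_grid_exists:
  fixes M :: "'w measure" and U :: "'w \<Rightarrow> real"
  assumes "prob_space M" and U[measurable]: "U \<in> borel_measurable M"
    and U02: "\<And>w. w \<in> space M \<Longrightarrow> U w \<in> {0..2}"
  obtains \<sigma> \<kappa> e where "slot_grid M U \<sigma> \<kappa> e"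
proof -
  interpret prob_space M by fact
  define P where "P u = measure M {w\<in>space M. U w < u}" for u
  \<comment> \<open>The grid points are the dyadic quantiles of \<open>\<theta>\<close>. The linear term makes the grids dense, and
    the constant forces the coarsest grid to round everything up to 2.\<close>
  define \<theta> where "\<theta> u = (P u + min 2 (max 0 u) + 1) / 4" for u
  define a where "a c = Sup (insert 0 {u\<in>{0..2}. \<theta> u \<le> c})" for c
  define N where "N n u = nat \<lceil>2 ^ n * \<theta> u\<rceil>" for n :: nat and u
  have P01: "0 \<le> P u" "P u \<le> 1" for u by (auto simp: P_def)
  have Pmono: "P u \<le> P v" if "u \<le> v" for u v
    unfolding P_def using that by (intro finite_measure_mono) auto
  have \<theta>_bounds: "1 / 4 \<le> \<theta> u" "\<theta> u \<le> 1" for u using P01[of u] by (auto simp: \<theta>_def)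
  have \<theta>_mono: "\<theta> u \<le> \<theta> v" if "u \<le> v" for u v
    using Pmono[OF that] that by (auto simp: \<theta>_def)
  have \<theta>_eq: "4 * \<theta> u = P u + u + 1" if "u \<in> {0..2}" for u using that by (auto simp: \<theta>_def)
  have bdd: "bdd_above (insert 0 {u\<in>{0..2}. \<theta> u \<le> c})" for c by (auto intro!: bdd_aboveI[of _ 2])
  have a_mono: "a c \<le> a d" if "c \<le> d" for c d
    unfolding a_def by (rule cSup_subset_mono[OF _ bdd]) (use that in auto)
  have a02: "a c \<in> {0..2}" for c
    unfolding a_def using cSup_upper[OF _ bdd[of c], of 0]
    by (auto intro!: cSup_least)
  have a_iff: "u \<le> a c \<longleftrightarrow> \<theta> u \<le> c" if u: "u \<in> {0..2}" and c: "1 / 4 \<le> c" for u c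
  proof
    assume "\<theta> u \<le> c"
    then show "u \<le> a c" unfolding a_def using u by (intro cSup_upper bdd) auto
  next
    assume ua: "u \<le> a c"
    have less: "\<theta> v \<le> c" if v: "0 \<le> v" "v < a c" for v
    proof -
      from v obtain v' where "v < v'" "v' \<in> insert 0 {u\<in>{0..2}. \<theta> u \<le> c}"
        unfolding a_def using less_cSup_iff[OF _ bdd[of c]] by blast
      then show ?thesis using v \<theta>_mono[of v v'] by auto
    qed
    show "\<theta> u \<le> c"
    proof (cases "u = 0 \<or> u < a c")
      case True
      \<comment> \<open>Since U is never negative, \<theta> 0 is exactly 1/4. This is where the
        lower bound on c enters: the inserted 0 in \<open>a\<close> then satisfies \<theta> 0 \<le>
        c like the other elements.\<close>
      have "P 0 = 0"
      proof -
        have "{w\<in>space M. U w < 0} = {}" using U02 by force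
        then show ?thesis unfolding P_def by (simp only: measure_empty)
      qed
      then have "\<theta> 0 \<le> c" using c by (simp add: \<theta>_def)
      then show ?thesis using True less[of u] u by auto
    next
      case False
      with ua u have u': "u = a c" "0 < u" by auto
      \<comment> \<open>Left-continuity of P at u = a c. The points u - u/(n+1) stay in [0, u),
        where \<open>less\<close> applies.\<close>
      have "(\<lambda>n. measure M {w\<in>space M. U w < u - u / real (Suc n)}) \<longlonglongrightarrow>
          measure M (\<Union>n. {w\<in>space M. U w < u - u / real (Suc n)})"
      proof (rule finite_Lim_measure_incseq)
        show "incseq (\<lambda>n. {w\<in>space M. U w < u - u / real (Suc n)})"
        proof (rule incseq_SucI)
          fix n
          have "u / real (Suc (Suc n)) \<le> u / real (Suc n)"
            using u' by (intro divide_left_mono) auto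
          then show "{w\<in>space M. U w < u - u / real (Suc n)} \<subseteq> {w\<in>space M. U w < u - u / real (Suc (Suc n))}"
            by auto
        qed
      qed auto
      moreover have "(\<Union>n. {w\<in>space M. U w < u - u / real (Suc n)}) = {w\<in>space M. U w < u}"
      proof (intro set_eqI iffI)
        fix w assume w: "w \<in> {w\<in>space M. U w < u}"
        have "(\<lambda>n. u - u / real (Suc n)) \<longlonglongrightarrow> u - 0"
          by (intro tendsto_diff tendsto_const LIMSEQ_Suc lim_const_over_n)
        then have "\<forall>\<^sub>F n in sequentially. U w < u - u / real (Suc n)"
          using w by (intro order_tendstoD) auto
        then show "w \<in> (\<Union>n. {w\<in>space M. U w < u - u / real (Suc n)})"
          using w eventually_happens'[OF sequentially_bot] by fastforce
      qed (use u' in \<open>auto intro: less_le_trans\<close>)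
      ultimately have lim: "(\<lambda>n. P (u - u / real (Suc n))) \<longlonglongrightarrow> P u" by (simp add: P_def)
      have "(\<lambda>n. (P (u - u / real (Suc n)) + (u - u / real (Suc n)) + 1) / 4) \<longlonglongrightarrow> (P u + (u - 0) + 1) / 4"
        by (intro tendsto_intros lim LIMSEQ_Suc[OF lim_const_over_n]) simp
      moreover have "(P (u - u / real (Suc n)) + (u - u / real (Suc n)) + 1) / 4 \<le> c" for n
      proof -
        have "u / real (Suc n) \<le> u / 1" using u' by (intro divide_left_mono) auto
        moreover have "0 < u / real (Suc n)" using u' by simp
        ultimately have "0 \<le> u - u / real (Suc n)" "u - u / real (Suc n) < a c" using u' by auto
        with less[of "u - u / real (Suc n)"] \<theta>_eq[of "u - u / real (Suc n)"] a02[of c] show ?thesis by auto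
      qed
      ultimately have "(P u + (u - 0) + 1) / 4 \<le> c" by (intro LIMSEQ_le_const2) auto
      then show ?thesis using \<theta>_eq[OF u] by simp
    qed
  qed
  have N: "real (N n u) - 1 < 2 ^ n * \<theta> u" "2 ^ n * \<theta> u \<le> real (N n u)" for n u
  proof -
    have "0 < 2 ^ n * \<theta> u" using \<theta>_bounds(1)[of u] by simp
    then have "0 < \<lceil>2 ^ n * \<theta> u\<rceil>" by simp
    then have eq: "real (N n u) = of_int \<lceil>2 ^ n * \<theta> u\<rceil>" unfolding N_def by simp
    show "real (N n u) - 1 < 2 ^ n * \<theta> u" "2 ^ n * \<theta> u \<le> real (N n u)"
      unfolding eq by linarith+
  qed
  have N_le: "N n u \<le> 2 ^ n" for n u
  proof -
    have "2 ^ n * \<theta> u \<le> 2 ^ n * 1" using \<theta>_bounds[of u] by (intro mult_left_mono) auto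
    with N(1)[of n u] have "real (N n u) < 2 ^ n + 1" by linarith
    then have "real (N n u) < real (2 ^ n + 1)" by simp
    then show ?thesis unfolding of_nat_less_iff by linarith
  qed
  have N_div: "\<theta> u \<le> real (N n u) / 2 ^ n" "real (N n u) / 2 ^ n < \<theta> u + 1 / 2 ^ n" for n u
    using N[of n u] by (simp_all add: field_simps)
  \<comment> \<open>Cells are numbered by their upper end points, so cell k splits into 2k - 1 and
    2k.\<close>
  have N_Suc: "N (Suc n) u = 2 * N n u \<or> Suc (N (Suc n) u) = 2 * N n u" for n u
  proof -
    have "real (N (Suc n) u) < real (2 * N n u + 1)" "real (2 * N n u) < real (N (Suc n) u + 2)"
      using N[of n u] N[of "Suc n" u] by auto
    then have "N (Suc n) u < 2 * N n u + 1" "2 * N n u < N (Suc n) u + 2" unfolding of_nat_less_iff .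
    then show ?thesis by linarith
  qed
  define \<sigma> where "\<sigma> n u = a (real (N n u) / 2 ^ n)" for n u
  define \<kappa> where "\<kappa> q u = N (Suc q) u" for q u
  define A where "A q k = a (real k / 2 ^ Suc q)" for q k :: nat
  \<comment> \<open>An even child has the same upper end point as its parent, so nothing changes
    there. Only an odd child k moves the rounded value, from the parent's end point, of index k + 1
    in the finer grid, down to its own.\<close>
  define B where "B q k = (if odd k then a (real (Suc k) / 2 ^ Suc q) else A q k)" for q k :: nat
  define e where "e q k = indicator_path (A q k) - indicator_path (B q k)" for q k
  have [measurable]: "\<theta> \<in> borel_measurable borel"
    by (rule borel_measurable_mono) (auto simp: mono_def \<theta>_mono)
  have N_meas[measurable]: "N n \<in> measurable borel (count_space UNIV)" for n
    unfolding N_def by measurable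
  have quarter: "1 / 4 \<le> real (N n u) / 2 ^ n" for n u
    using N_div(1)[of u n] \<theta>_bounds(1)[of u] by linarith
  have \<sigma>_ge: "u \<le> \<sigma> n u" if "u \<in> {0..2}" for u n
    unfolding \<sigma>_def using a_iff[OF that quarter] N_div(1) by blast
  have \<theta>_\<sigma>: "\<theta> (\<sigma> n u) < \<theta> u + 1 / 2 ^ n" for u n
    using a_iff[OF a02 quarter, of "real (N n u) / 2 ^ n" n u] N_div(2)[of n u] unfolding \<sigma>_def by simp
  have "slot_grid M U \<sigma> \<kappa> e"
    unfolding slot_grid_def
  proof (intro conjI allI ballI impI)
    fix n
    show "\<sigma> n \<in> borel_measurable borel"
    proof -
      have "(\<lambda>k. a (real k / 2 ^ n)) \<in> measurable (count_space UNIV) borel" by simp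
      then show ?thesis unfolding \<sigma>_def[abs_def] by measurable
    qed
    have "range (\<sigma> n) \<subseteq> (\<lambda>k. a (real k / 2 ^ n)) ` {..2 ^ n}" unfolding \<sigma>_def using N_le by auto
    then show "finite (range (\<sigma> n))" by (rule finite_subset) simp
  next
    fix q show "\<kappa> q \<in> measurable borel (count_space UNIV)" unfolding \<kappa>_def[abs_def] by measurable
    show "\<kappa> q u \<le> 2 ^ Suc q" for u unfolding \<kappa>_def by (rule N_le)
  next
    fix u :: real assume u: "u \<in> {0..2}"
    show "u \<le> \<sigma> n u" for n by (rule \<sigma>_ge[OF u])
    show "decseq (\<lambda>n. \<sigma> n u)"
    proof (rule decseq_SucI)
      fix n
      have "N (Suc n) u \<le> 2 * N n u" using N_Suc[of n u] by linarith
      then have "real (N (Suc n) u) \<le> real (2 * N n u)" by (simp only: of_nat_le_iff)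
      then show "\<sigma> (Suc n) u \<le> \<sigma> n u" unfolding \<sigma>_def by (intro a_mono) (simp add: field_simps)
    qed
    show "(\<lambda>n. \<sigma> n u) \<longlonglongrightarrow> u"
    proof (rule tendsto_sandwich)
      show "\<forall>\<^sub>F n in sequentially. u \<le> \<sigma> n u" using \<sigma>_ge[OF u] by simp
      have "\<sigma> n u \<le> u + 4 * (1 / 2) ^ n" for n
        using \<theta>_\<sigma>[of n u] \<theta>_eq[OF u] \<theta>_eq[of "\<sigma> n u"] a02 Pmono[OF \<sigma>_ge[OF u, of n]]
        by (auto simp: \<sigma>_def power_one_over)
      then show "\<forall>\<^sub>F n in sequentially. \<sigma> n u \<le> u + 4 * (1 / 2) ^ n" by simp
      have "(\<lambda>n. u + 4 * (1 / 2) ^ n) \<longlonglongrightarrow> u + 4 * 0"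
        by (intro tendsto_intros LIMSEQ_realpow_zero) auto
      then show "(\<lambda>n. u + 4 * (1 / 2) ^ n) \<longlonglongrightarrow> u" by simp
    qed simp
    assume atom: "0 < measure M {w\<in>space M. U w = u}"
    define p where "p = measure M {w\<in>space M. U w = u}"
    have "\<forall>\<^sub>F n in sequentially. (1 / 2) ^ n < p / 4"
      using atom by (intro order_tendstoD[OF LIMSEQ_realpow_zero]) (auto simp: p_def)
    then show "\<forall>\<^sub>F n in sequentially. \<sigma> n u = u"
    proof eventually_elim
      case (elim n)
      show "\<sigma> n u = u"
      proof (rule ccontr)
        assume "\<sigma> n u \<noteq> u"
        with \<sigma>_ge[OF u, of n] have lt: "u < \<sigma> n u" by simp
        have "P u + p = measure M ({w\<in>space M. U w < u} \<union> {w\<in>space M. U w = u})"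
          unfolding P_def p_def by (subst finite_measure_Union) auto
        also have "\<dots> \<le> P (\<sigma> n u)"
          unfolding P_def using lt by (intro finite_measure_mono) auto
        finally have "P u + p \<le> P (\<sigma> n u)" .
        then show False
          using \<theta>_\<sigma>[of n u] \<theta>_eq[OF u] \<theta>_eq[of "\<sigma> n u"] a02 lt elim
          by (auto simp: \<sigma>_def power_one_over)
      qed
    qed
  next
    fix n u
    show "indicator_path (\<sigma> n u) = (\<Sum>q<n. e q (\<kappa> q u))"
    proof (induction n)
      case 0
      have "real (N 0 u) - 1 < 1" "0 < real (N 0 u)" using N[of 0 u] \<theta>_bounds[of u] by auto
      then have "N 0 u = 1" by simp
      moreover have "a 1 = 2" using a_iff[of 2 1] \<theta>_bounds(2)[of 2] a02[of 1] by auto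
      ultimately have "\<sigma> 0 u = 2" by (simp add: \<sigma>_def)
      moreover have "indicator_path 2 = 0"
        by (auto simp: eval_inject[symmetric] fun_eq_iff eval_indicator_path eval_simps unit_cube_def)
      ultimately show ?case by simp
    next
      case (Suc n)
      have "B n (\<kappa> n u) = \<sigma> n u" "A n (\<kappa> n u) = \<sigma> (Suc n) u"
      proof -
        consider "N (Suc n) u = 2 * N n u" | "Suc (N (Suc n) u) = 2 * N n u" using N_Suc by blast
        then show "B n (\<kappa> n u) = \<sigma> n u"
        proof cases
          case 1 then show ?thesis by (simp add: B_def A_def \<kappa>_def \<sigma>_def)
        next
          case 2
          then have "odd (N (Suc n) u)" by presburger
          then show ?thesis using 2 by (simp only: B_def \<kappa>_def \<sigma>_def if_True) simp
        qed
        show "A n (\<kappa> n u) = \<sigma> (Suc n) u" by (simp add: A_def \<kappa>_def \<sigma>_def)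
      qed
      then show ?case using Suc by (simp add: e_def)
    qed
  next
    fix q and \<epsilon> :: "nat \<Rightarrow> real" assume \<epsilon>: "\<forall>k. \<bar>\<epsilon> k\<bar> = 1"
    have BA: "B q j \<le> A q k" if "j < k" for j k
      unfolding B_def A_def using that by (auto intro!: a_mono divide_right_mono)
    show "norm (\<Sum>k\<le>2 ^ Suc q. \<epsilon> k *\<^sub>R e q k) \<le> 1"
      unfolding e_def
    proof (rule norm_indicator_path_sum_le)
      show "A q k \<le> B q k" for k
        unfolding B_def A_def by (auto intro!: a_mono divide_right_mono)
      show "B q j \<le> A q k \<or> B q k \<le> A q j" if "j \<noteq> k" for j k
        using BA[of j k] BA[of k j] that by linarith
    qed (use \<epsilon> in auto)
  next
    fix q k assume "e q k \<noteq> 0"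
    then have ne: "A q k \<noteq> B q k" by (auto simp: e_def)
    then have odd: "odd k" by (auto simp: B_def split: if_splits)
    \<comment> \<open>The cell is c(-1) < \<theta> \<le> c 0. An atom at a (c 0) would belong to it
      without being counted by P at this point. As the increment is non-zero, the next quantile v =
      a (c 1) lies strictly above, so that {U < v} contains the cell. The price is a \<theta>-width
      of two cells, 2/2^(q+1), and undoing the division by 4 in \<theta> gives 4/2^q.\<close>
    define c where "c j = (real k + j) / 2 ^ Suc q" for j :: real
    have lt: "a (c 0) < a (c 1)"
    proof -
      have "a (c 0) \<le> a (c 1)" by (intro a_mono) (simp add: c_def divide_right_mono)
      then show ?thesis using ne odd by (auto simp: A_def B_def c_def add.commute)
    qed
    have cdiff: "c 1 - c (-1) = 1 / 2 ^ q" by (simp add: c_def diff_divide_distrib[symmetric])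
    show "measure M {w\<in>space M. \<kappa> q (U w) = k} \<le> 4 / 2 ^ q"
    proof (cases "1 / 4 \<le> c 0")
      case False
      have "{w\<in>space M. \<kappa> q (U w) = k} = {}"
        using quarter[of "Suc q"] False by (auto simp: \<kappa>_def c_def)
      then show ?thesis by (simp only: measure_empty) simp
    next
      case c0: True
      define v where "v = a (c 1)"
      have v: "v \<in> {0..2}" unfolding v_def by (rule a02)
      have c1: "1 / 4 \<le> c 1" using c0 by (rule order_trans) (simp add: c_def divide_right_mono)
      have \<theta>v: "\<theta> v \<le> c 1" using a_iff[OF v c1] by (simp add: v_def)
      have ev: "c (-1) < \<theta> (U w) \<and> U w < v" if w: "w \<in> space M" "\<kappa> q (U w) = k" for w
      proof -
        have "\<theta> (U w) \<le> c 0" "c (-1) < \<theta> (U w)"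
          using w(2) N_div(1)[of "U w" "Suc q"] N_div(2)[of "Suc q" "U w"] by (auto simp: \<kappa>_def c_def field_simps)
        then show ?thesis using a_iff[OF U02[OF w(1)] c0] lt by (auto simp: v_def)
      qed
      have bound: "measure M {w\<in>space M. x \<le> U w \<and> U w < v} \<le> 4 / 2 ^ q"
        if x: "x \<in> {0..2}" "x \<le> v" "c (-1) < \<theta> x" for x
      proof -
        have "measure M {w\<in>space M. U w < v} =
           measure M ({w\<in>space M. U w < x} \<union> {w\<in>space M. x \<le> U w \<and> U w < v})"
          using x by (intro arg_cong[where f = "measure M"]) auto
        also have "\<dots> = P x + measure M {w\<in>space M. x \<le> U w \<and> U w < v}"
          unfolding P_def by (subst finite_measure_Union) auto
        finally have "measure M {w\<in>space M. x \<le> U w \<and> U w < v} = P v - P x" by (simp add: P_def)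
        also have "\<dots> \<le> 4 * \<theta> v - 4 * \<theta> x" using \<theta>_eq[OF v] \<theta>_eq[OF x(1)] x(2) by simp
        also have "\<dots> \<le> 4 * (c 1 - c (-1))" using x(3) \<theta>v by simp
        finally show ?thesis by (simp add: cdiff)
      qed
      \<comment> \<open>The condition c(-1) < \<theta>(U) means U > a (c(-1)). This open half-line
        is exhausted by the closed ones from x n, to which \<open>bound\<close> applies. If c(-1) <
        1/4, the condition always holds and the half-line from 0 serves.\<close>
      define x where "x n = (if c (-1) < 1 / 4 then 0 else a (c (-1)) + 1 / real (Suc n))" for n
      define S where "S n = {w\<in>space M. x n \<le> U w \<and> U w < v}" for n
      have S_bound: "measure M (S n) \<le> 4 / 2 ^ q" for n
      proof (cases "x n \<le> v")
        case True
        have "0 \<le> x n" using a02[of "c (-1)"] by (auto simp: x_def)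
        then have xn: "x n \<in> {0..2}" using True v by auto
        have "c (-1) < \<theta> (x n)"
        proof (cases "c (-1) < 1 / 4")
          case True then show ?thesis using \<theta>_bounds(1)[of "x n"] by simp
        next
          case False
          then have "a (c (-1)) < x n" by (simp add: x_def)
          then show ?thesis using a_iff[OF xn, of "c (-1)"] False by auto
        qed
        then show ?thesis unfolding S_def by (intro bound xn True)
      next
        case False
        then have "S n = {}" by (auto simp: S_def)
        then show ?thesis by simp
      qed
      have "incseq S"
      proof (rule incseq_SucI)
        fix n
        have "1 / real (Suc (Suc n)) \<le> 1 / real (Suc n)" by (intro divide_left_mono) auto
        then have "x (Suc n) \<le> x n" by (auto simp: x_def)
        then show "S n \<subseteq> S (Suc n)" by (auto simp: S_def)
      qed
      moreover have "range S \<subseteq> sets M" by (auto simp: S_def)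
      ultimately have "(\<lambda>n. measure M (S n)) \<longlonglongrightarrow> measure M (\<Union>n. S n)"
        by (intro finite_Lim_measure_incseq)
      then have "measure M (\<Union>n. S n) \<le> 4 / 2 ^ q"
        using S_bound by (intro LIMSEQ_le_const2) auto
      moreover have "{w\<in>space M. \<kappa> q (U w) = k} \<subseteq> (\<Union>n. S n)"
      proof
        fix w assume "w \<in> {w\<in>space M. \<kappa> q (U w) = k}"
        then have w: "w \<in> space M" "c (-1) < \<theta> (U w)" "U w < v" using ev by auto
        have "\<exists>n. x n \<le> U w"
        proof (cases "c (-1) < 1 / 4")
          case True
          then show ?thesis using U02[OF w(1)] by (simp add: x_def)
        next
          case False
          then have "a (c (-1)) < U w" using a_iff[OF U02[OF w(1)], of "c (-1)"] w(2) by auto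
          then obtain n where "1 / real (Suc n) < U w - a (c (-1))"
            using reals_Archimedean[of "U w - a (c (-1))"] by (auto simp: inverse_eq_divide)
          then show ?thesis using False by (intro exI[of _ n]) (simp add: x_def)
        qed
        then show "w \<in> (\<Union>n. S n)" using w by (auto simp: S_def)
      qed
      moreover have "(\<Union>n. S n) \<in> sets M" by (auto simp: S_def)
      ultimately show ?thesis by (meson finite_measure_mono order_trans)
    qed
  qed
  then show ?thesis by (rule that)
qed

section \<open>Mean size of multilinear forms on grid increments\<close>

locale slots = prob_space M for M :: "'w measure" +
  fixes U :: "'n::finite \<Rightarrow> 'w \<Rightarrow> real"
    and \<sigma> :: "'n \<Rightarrow> nat \<Rightarrow> real \<Rightarrow> real"
    and \<kappa> :: "'n \<Rightarrow> nat \<Rightarrow> real \<Rightarrow> nat"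
    and e :: "'n \<Rightarrow> nat \<Rightarrow> nat \<Rightarrow> 1 skorokhod"
  assumes U_measurable[measurable]: "\<And>i. U i \<in> borel_measurable M"
    and U_range: "\<And>i w. w \<in> space M \<Longrightarrow> U i w \<in> {0..2}"
    and grid: "\<And>i. slot_grid M (U i) (\<sigma> i) (\<kappa> i) (e i)"
begin

lemma \<sigma>_measurable[measurable]: "\<sigma> i n \<in> borel_measurable borel"
  and finite_range_\<sigma>: "finite (range (\<sigma> i n))"
  and \<kappa>_measurable[measurable]: "\<kappa> i q \<in> measurable borel (count_space UNIV)"
  and \<kappa>_le: "\<kappa> i q u \<le> 2 ^ Suc q"
  and \<sigma>_ge: "u \<in> {0..2} \<Longrightarrow> u \<le> \<sigma> i n u"
  and \<sigma>_decseq: "u \<in> {0..2} \<Longrightarrow> decseq (\<lambda>n. \<sigma> i n u)"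
  and \<sigma>_tendsto: "u \<in> {0..2} \<Longrightarrow> (\<lambda>n. \<sigma> i n u) \<longlonglongrightarrow> u"
  and \<sigma>_atom: "u \<in> {0..2} \<Longrightarrow> 0 < prob {w\<in>space M. U i w = u} \<Longrightarrow> \<forall>\<^sub>F n in sequentially. \<sigma> i n u = u"
  and path_\<sigma>: "indicator_path (\<sigma> i n u) = (\<Sum>q<n. e i q (\<kappa> i q u))"
  and norm_signed_sum_e: "(\<And>k. \<bar>\<epsilon> k\<bar> = 1) \<Longrightarrow> norm (\<Sum>k\<le>2 ^ Suc q. \<epsilon> k *\<^sub>R e i q k) \<le> 1"
  and prob_\<kappa>_le: "e i q k \<noteq> 0 \<Longrightarrow> prob {w\<in>space M. \<kappa> i q (U i w) = k} \<le> 4 / 2 ^ q"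
  using grid[of i] unfolding slot_grid_def by blast+

text \<open>The root of order \<open>CARD('n)\<close> comes from the geometric mean over the slots
  and the square root from Cauchy--Schwarz; 4/2^q bounds the probability of a cell with non-zero
  increment.\<close>

definition level_weight :: "nat \<Rightarrow> real" where
  "level_weight q = sqrt (root CARD('n) (4 / 2 ^ q))"

lemma level_weight_nonneg: "0 \<le> level_weight q"
  by (simp add: level_weight_def)

lemma summable_level_weight: "summable level_weight"
proof -
  have "level_weight q = sqrt (root CARD('n) 4) * sqrt (root CARD('n) (1 / 2)) ^ q" for q
    by (simp add: level_weight_def real_root_divide real_root_power real_sqrt_power real_sqrt_divide real_root_divide power_divide)
  moreover have "summable (\<lambda>q. sqrt (root CARD('n) 4) * sqrt (root CARD('n) (1 / 2)) ^ q)"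
    by (intro summable_mult summable_geometric) simp
  ultimately show ?thesis by presburger
qed

text \<open>Expanding both powers shows that this is the total weight of the tuples of levels that
  are not entirely below n.\<close>

definition grid_error :: "nat \<Rightarrow> real" where
  "grid_error n = suminf level_weight ^ CARD('n) - (\<Sum>q<n. level_weight q) ^ CARD('n)"

lemma grid_error_tendsto: "grid_error \<longlonglongrightarrow> 0"
proof -
  have "grid_error \<longlonglongrightarrow> suminf level_weight ^ CARD('n) - suminf level_weight ^ CARD('n)"
    unfolding grid_error_def[abs_def]
    by (intro tendsto_intros summable_LIMSEQ summable_level_weight)
  then show ?thesis by simp
qed

text \<open>The mean is a sum of |b k| p k over the cells k. By Cauchy--Schwarz it is at most C
  times the root of the sum of the p k squared. As the p k add up to at most 1, that sum is at most
  the largest p k, hence at most R squared.\<close>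

lemma expectation_increment:
  fixes \<beta> :: "('n \<Rightarrow> 1 skorokhod) \<Rightarrow> real"
  assumes ml: "multilinear_on UNIV C \<beta>"
  shows "integrable M (\<lambda>w. \<beta> (\<lambda>i. e i (q i) (\<kappa> i (q i) (U i w))))"
    and "expectation (\<lambda>w. \<bar>\<beta> (\<lambda>i. e i (q i) (\<kappa> i (q i) (U i w)))\<bar>) \<le> C * (\<Prod>i\<in>UNIV. level_weight (q i))"
proof -
  define K where "K = PiE (UNIV :: 'n set) (\<lambda>i. {..2 ^ Suc (q i)} :: nat set)"
  define E where "E k = {w\<in>space M. \<forall>i. \<kappa> i (q i) (U i w) = k i}" for k :: "'n \<Rightarrow> nat"
  define b where "b k = \<beta> (\<lambda>i. e i (q i) (k i))" for k
  \<comment> \<open>A cell whose increment vanishes in some slot may carry a large atom, so its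
    probability has no useful bound. There b k = 0, and the weight can be set to 0.\<close>
  define p where "p k = (if \<exists>i. e i (q i) (k i) = 0 then 0 else prob (E k))" for k
  define R where "R = (\<Prod>i\<in>(UNIV :: 'n set). level_weight (q i))"
  have finK: "finite K" unfolding K_def by (intro finite_PiE) auto
  have E_meas[measurable]: "E k \<in> sets M" for k unfolding E_def by measurable
  have disj: "disjoint_family_on E K"
    unfolding disjoint_family_on_def E_def by (auto simp: fun_eq_iff)
  have rep: "f (\<lambda>i. \<kappa> i (q i) (U i w)) = (\<Sum>k\<in>K. f k * indicator (E k) w)"
    if "w \<in> space M" for f :: "('n \<Rightarrow> nat) \<Rightarrow> real" and w
  proof -
    have "(\<Sum>k\<in>K. f k * indicator (E k) w) = (\<Sum>k\<in>K. if (\<lambda>i. \<kappa> i (q i) (U i w)) = k then f k else 0)"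
      by (intro sum.cong) (auto simp: E_def that indicator_def fun_eq_iff)
    also have "\<dots> = f (\<lambda>i. \<kappa> i (q i) (U i w))"
      using finK \<kappa>_le by (subst sum.delta') (auto simp: K_def PiE_def)
    finally show ?thesis by simp
  qed
  have b0: "b k = 0" if "e i (q i) (k i) = 0" for i k
    using linear_0[OF multilinear_on_linear[OF ml UNIV_I, where i = i and x = "\<lambda>i. e i (q i) (k i)"]] that
    by (simp add: b_def fun_upd_idem)
  have int: "integrable M (\<lambda>w. \<Sum>k\<in>K. f k * indicator (E k) w)" for f :: "('n \<Rightarrow> nat) \<Rightarrow> real"
    by (intro Bochner_Integration.integrable_sum integrable_mult_right integrable_real_indicator) (auto simp: emeasure_eq_measure)
  have "integrable M (\<lambda>w. \<Sum>k\<in>K. b k * indicator (E k) w)" by (rule int)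
  then show "integrable M (\<lambda>w. \<beta> (\<lambda>i. e i (q i) (\<kappa> i (q i) (U i w))))"
    by (subst Bochner_Integration.integrable_cong[OF refl]) (use rep[of _ b] in \<open>auto simp: b_def\<close>)
  have p0: "0 \<le> p k" for k by (simp add: p_def)
  have R0: "0 \<le> R" unfolding R_def by (intro prod_nonneg) (simp add: level_weight_nonneg)
  have pR: "p k \<le> R\<^sup>2" for k
  proof (cases "\<exists>i. e i (q i) (k i) = 0")
    case False
    \<comment> \<open>p k is at most each marginal probability; multiplying these bounds over the
      slots yields the geometric mean.\<close>
    have "p k ^ CARD('n) = (\<Prod>i\<in>(UNIV :: 'n set). p k)" by simp
    also have "\<dots> \<le> (\<Prod>i\<in>(UNIV :: 'n set). 4 / 2 ^ q i)"
    proof (intro prod_mono conjI p0)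
      fix i :: 'n
      have "p k \<le> prob {w\<in>space M. \<kappa> i (q i) (U i w) = k i}"
        using False unfolding p_def E_def by (simp, intro finite_measure_mono) auto
      also have "\<dots> \<le> 4 / 2 ^ q i" using prob_\<kappa>_le False by blast
      finally show "p k \<le> 4 / 2 ^ q i" .
    qed
    finally have "root CARD('n) (p k ^ CARD('n)) \<le> root CARD('n) (\<Prod>i\<in>(UNIV :: 'n set). 4 / 2 ^ q i)"
      by simp
    moreover have "root n (\<Prod>i\<in>A. x i) = (\<Prod>i\<in>A. root n (x i))" if "n > 0" for n A and x :: "'n \<Rightarrow> real"
      using that by (induction A rule: infinite_finite_induct) (simp_all add: real_root_mult)
    ultimately have "p k \<le> (\<Prod>i\<in>(UNIV :: 'n set). root CARD('n) (4 / 2 ^ q i))"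
      using p0[of k] by (simp add: real_root_power_cancel)
    also have "\<dots> = R\<^sup>2"
      unfolding R_def power2_eq_square prod.distrib[symmetric]
      by (intro prod.cong) (auto simp: level_weight_def)
    finally show ?thesis .
  qed (simp add: p_def)
  have "(\<Sum>k\<in>K. p k) \<le> (\<Sum>k\<in>K. prob (E k))" by (intro sum_mono) (simp add: p_def)
  also have "\<dots> = prob (\<Union>k\<in>K. E k)"
    using disj finK by (subst finite_measure_finite_Union) auto
  also have "\<dots> \<le> 1" by (rule prob_le_1)
  finally have psum: "(\<Sum>k\<in>K. p k) \<le> 1" .
  have C0: "0 \<le> C" by (rule multilinear_on_nonneg[OF ml])
  have bsum: "(\<Sum>k\<in>K. (b k)\<^sup>2) \<le> C\<^sup>2"
    using multilinear_square_sum[OF ml, of UNIV "\<lambda>i. {..2 ^ Suc (q i)}" "\<lambda>i. e i (q i)" "\<lambda>_. 0"] norm_signed_sum_e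
    by (simp add: K_def b_def)
  have "expectation (\<lambda>w. \<bar>\<beta> (\<lambda>i. e i (q i) (\<kappa> i (q i) (U i w)))\<bar>) = expectation (\<lambda>w. \<Sum>k\<in>K. \<bar>b k\<bar> * indicator (E k) w)"
    by (intro Bochner_Integration.integral_cong refl) (use rep[of _ "\<lambda>k. \<bar>b k\<bar>"] in \<open>auto simp: b_def\<close>)
  also have "\<dots> = (\<Sum>k\<in>K. \<bar>b k\<bar> * prob (E k))"
    by (subst Bochner_Integration.integral_sum) (auto simp: emeasure_eq_measure)
  also have "\<dots> = (\<Sum>k\<in>K. \<bar>b k\<bar> * p k)"
    by (intro sum.cong) (auto simp: p_def b0)
  also have "\<dots> \<le> C * R"
  proof (rule power2_le_imp_le)
    have "(\<Sum>k\<in>K. \<bar>b k\<bar> * p k)\<^sup>2 \<le> (\<Sum>k\<in>K. \<bar>b k\<bar>\<^sup>2) * (\<Sum>k\<in>K. (p k)\<^sup>2)"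
      by (rule Cauchy_Schwarz_ineq_sum)
    also have "\<dots> \<le> C\<^sup>2 * R\<^sup>2"
    proof (intro mult_mono)
      have "(\<Sum>k\<in>K. (p k)\<^sup>2) \<le> (\<Sum>k\<in>K. R\<^sup>2 * p k)"
        unfolding power2_eq_square[of "p _"] by (intro sum_mono mult_right_mono pR p0)
      also have "\<dots> \<le> R\<^sup>2 * 1" unfolding sum_distrib_left[symmetric] by (intro mult_left_mono psum) simp
      finally show "(\<Sum>k\<in>K. (p k)\<^sup>2) \<le> R\<^sup>2" by simp
    qed (use bsum in \<open>auto intro: sum_nonneg\<close>)
    finally show "(\<Sum>k\<in>K. \<bar>b k\<bar> * p k)\<^sup>2 \<le> (C * R)\<^sup>2" by (simp add: power_mult_distrib)
  qed (use C0 R0 in auto)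
  finally show "expectation (\<lambda>w. \<bar>\<beta> (\<lambda>i. e i (q i) (\<kappa> i (q i) (U i w)))\<bar>) \<le> C * (\<Prod>i\<in>UNIV. level_weight (q i))"
    by (simp add: R_def)
qed

lemma expand_grid:
  fixes \<beta> :: "('n \<Rightarrow> 1 skorokhod) \<Rightarrow> 'b::real_normed_vector"
  assumes ml: "multilinear_on UNIV C \<beta>"
  shows "\<beta> (\<lambda>i. indicator_path (\<sigma> i (n i) (U i w)))
    = (\<Sum>q\<in>PiE UNIV (\<lambda>i. {..<n i}). \<beta> (\<lambda>i. e i (q i) (\<kappa> i (q i) (U i w))))"
  using multilinear_on_expand[OF ml, of UNIV "\<lambda>i. {..<n i}" "\<lambda>i q. e i q (\<kappa> i q (U i w))"]
  by (simp add: path_\<sigma>)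

text \<open>The expansions differ by the tuples of levels that leave {..<m} in some slot, whose
  weights add up to at most \<open>grid_error m\<close>. The levels n i may differ between slots
  because the slots are later refined one at a time.\<close>

lemma expectation_grid_difference:
  fixes \<beta> :: "('n \<Rightarrow> 1 skorokhod) \<Rightarrow> real"
  assumes ml: "multilinear_on UNIV C \<beta>" and n: "\<And>i. m \<le> n i"
  shows "expectation (\<lambda>w. \<bar>\<beta> (\<lambda>i. indicator_path (\<sigma> i (n i) (U i w))) - \<beta> (\<lambda>i. indicator_path (\<sigma> i m (U i w)))\<bar>)
    \<le> C * grid_error m"
proof -
  define A where "A = PiE (UNIV :: 'n set) (\<lambda>i. {..<n i})"
  define B where "B = PiE (UNIV :: 'n set) (\<lambda>i. {..<m})"
  define s where "s q w = \<beta> (\<lambda>i. e i (q i) (\<kappa> i (q i) (U i w)))" for q w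
  have fin: "finite A" unfolding A_def by (intro finite_PiE) auto
  have BA: "B \<subseteq> A" unfolding A_def B_def using n by (intro PiE_mono) (auto intro: less_le_trans)
  have int: "integrable M (s q)" for q
    unfolding s_def by (rule expectation_increment[OF ml])
  have C0: "0 \<le> C" by (rule multilinear_on_nonneg[OF ml])
  have "\<beta> (\<lambda>i. indicator_path (\<sigma> i (n i) (U i w))) - \<beta> (\<lambda>i. indicator_path (\<sigma> i m (U i w))) = (\<Sum>q\<in>A - B. s q w)" for w
    using expand_grid[OF ml, of n w] expand_grid[OF ml, of "\<lambda>_. m" w]
    by (simp add: A_def[symmetric] B_def[symmetric] s_def[symmetric] sum_diff[OF fin BA])
  then have "expectation (\<lambda>w. \<bar>\<beta> (\<lambda>i. indicator_path (\<sigma> i (n i) (U i w))) - \<beta> (\<lambda>i. indicator_path (\<sigma> i m (U i w)))\<bar>)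
      = expectation (\<lambda>w. \<bar>\<Sum>q\<in>A - B. s q w\<bar>)" by simp
  also have "\<dots> \<le> expectation (\<lambda>w. \<Sum>q\<in>A - B. \<bar>s q w\<bar>)"
    by (intro integral_mono sum_abs integrable_abs Bochner_Integration.integrable_sum int)
  also have "\<dots> = (\<Sum>q\<in>A - B. expectation (\<lambda>w. \<bar>s q w\<bar>))"
    by (intro Bochner_Integration.integral_sum integrable_abs int)
  also have "\<dots> \<le> (\<Sum>q\<in>A - B. C * (\<Prod>i\<in>UNIV. level_weight (q i)))"
    unfolding s_def by (intro sum_mono expectation_increment[OF ml])
  also have "\<dots> = C * ((\<Sum>q\<in>A. \<Prod>i\<in>UNIV. level_weight (q i)) - (\<Sum>q\<in>B. \<Prod>i\<in>UNIV. level_weight (q i)))"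
    by (simp add: sum_distrib_left[symmetric] sum_diff[OF fin BA])
  also have "\<dots> = C * ((\<Prod>i\<in>UNIV. \<Sum>q<n i. level_weight q) - (\<Prod>i\<in>(UNIV :: 'n set). \<Sum>q<m. level_weight q))"
    unfolding A_def B_def by (subst (1 2) prod_sum_PiE) auto
  also have "\<dots> \<le> C * grid_error m"
    unfolding grid_error_def
  proof (intro mult_left_mono diff_mono C0)
    have "(\<Prod>i\<in>UNIV. \<Sum>q<n i. level_weight q) \<le> (\<Prod>i\<in>(UNIV :: 'n set). suminf level_weight)"
      by (intro prod_mono conjI sum_nonneg sum_le_suminf summable_level_weight)
        (auto simp: level_weight_nonneg)
    then show "(\<Prod>i\<in>UNIV. \<Sum>q<n i. level_weight q) \<le> suminf level_weight ^ CARD('n)" by simp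
  qed simp
  finally show ?thesis .
qed

end

section \<open>Jumps of multilinear forms\<close>

text \<open>The map from u to \<phi>(indicator of [u,1]) has bounded variation: the increments along
  s belong to disjoint intervals, and with the signs of the d k as coefficients they add up to a
  vector of norm at most 1.\<close>

lemma convergent_functional_path:
  fixes \<phi> :: "1 skorokhod \<Rightarrow> real"
  assumes lin: "linear \<phi>" and bound: "\<And>y. \<bar>\<phi> y\<bar> \<le> D * norm y" and s: "decseq s"
  shows "convergent (\<lambda>n. \<phi> (indicator_path (s n)))"
proof -
  define d where "d n = \<phi> (indicator_path (s (Suc n)) - indicator_path (s n))" for n
  have "(\<Sum>k<n. \<bar>d k\<bar>) \<le> \<bar>D\<bar>" for n
  proof -
    define y where "y = (\<Sum>k<n. sgn (d k) *\<^sub>R (indicator_path (s (Suc k)) - indicator_path (s k)))"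
    have "norm y \<le> 1"
      unfolding y_def
    proof (rule norm_indicator_path_sum_le)
      show "s (Suc k) \<le> s k" for k using s by (simp add: decseq_SucD)
      show "s j \<le> s (Suc k) \<or> s k \<le> s (Suc j)" if "j \<noteq> k" for j k
        using s that by (cases "j < k") (auto intro: decseqD[OF s])
    qed (simp add: sgn_real_def)
    have "(\<Sum>k<n. \<bar>d k\<bar>) = \<phi> y"
      unfolding y_def by (simp add: linear_sum[OF lin] linear_scale[OF lin] d_def[symmetric] abs_sgn mult.commute)
    also have "\<dots> \<le> D * norm y" using bound[of y] by simp
    also have "\<dots> \<le> \<bar>D\<bar> * 1" using \<open>norm y \<le> 1\<close> by (intro mult_mono) auto
    finally show ?thesis by simp
  qed
  then have "summable (\<lambda>k. \<bar>d k\<bar>)" by (intro summableI_nonneg_bounded[of _ "\<bar>D\<bar>"]) auto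
  then have "summable d" by (rule summable_rabs_cancel)
  then have "convergent (\<lambda>n. \<Sum>k<n. d k)" by (simp add: summable_iff_convergent)
  then have "convergent (\<lambda>n. \<phi> (indicator_path (s 0)) + (\<Sum>k<n. d k))" by (intro convergent_add convergent_const)
  moreover have "\<phi> (indicator_path (s 0)) + (\<Sum>k<n. d k) = \<phi> (indicator_path (s n))" for n
    using sum_lessThan_telescope[of "\<lambda>k. \<phi> (indicator_path (s k))" n] by (simp add: d_def linear_diff[OF lin])
  ultimately show ?thesis by simp
qed

context slots
begin

text \<open>The indicator of [v, \<sigma> j n v) on the unit interval, which shrinks to the single
  point v and is zero once v lies on the grid.\<close>

definition increment :: "'n \<Rightarrow> nat \<Rightarrow> real \<Rightarrow> 1 skorokhod" where
  "increment j n v = indicator_path v - indicator_path (\<sigma> j n v)"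

lemma norm_increment: "v \<in> {0..2} \<Longrightarrow> norm (increment j n v) \<le> 1"
  using norm_indicator_path_sum_le[of "{()}" "\<lambda>_. v" "\<lambda>_. \<sigma> j n v" "\<lambda>_. 1"] \<sigma>_ge[of v j n]
  by (simp add: increment_def)

text \<open>The iterated limit extends \<open>\<beta>\<close>, in the slots \<open>js\<close>, to the indicators of the points \<open>u j\<close>.\<close>
primrec jump :: "('n \<Rightarrow> real) \<Rightarrow> 'n list \<Rightarrow> (('n \<Rightarrow> 1 skorokhod) \<Rightarrow> real) \<Rightarrow> ('n \<Rightarrow> 1 skorokhod) \<Rightarrow> real" where
  "jump u [] \<beta> x = \<beta> x"
| "jump u (j # js) \<beta> x = lim (\<lambda>n. jump u js \<beta> (x(j := increment j n (u j))))"

lemma jump_cong: "(\<And>i. i \<in> set js \<Longrightarrow> u i = v i) \<Longrightarrow> jump u js \<beta> x = jump v js \<beta> x"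
  by (induction js arbitrary: x) simp_all

lemma convergent_jump:
  assumes ml: "multilinear_on (- set js) C (jump u js \<beta>)" and j: "j \<notin> set js" and u: "u j \<in> {0..2}"
  shows "convergent (\<lambda>n. jump u js \<beta> (x(j := increment j n (u j))))"
proof -
  define \<phi> where "\<phi> y = jump u js \<beta> (x(j := y))" for y
  have lin: "linear \<phi>" unfolding \<phi>_def using multilinear_on_linear[OF ml] j by simp
  have "\<bar>\<phi> y\<bar> \<le> (C * (\<Prod>i\<in>- set js - {j}. norm (x i))) * norm y" for y
  proof -
    have "\<bar>\<phi> y\<bar> \<le> C * (\<Prod>i\<in>- set js. norm ((x(j := y)) i))"
      unfolding \<phi>_def using multilinear_on_norm_le[OF ml, of "x(j := y)"] by simp
    also have "(\<Prod>i\<in>- set js. norm ((x(j := y)) i)) = norm y * (\<Prod>i\<in>- set js - {j}. norm (x i))"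
      using j by (subst prod.remove[of _ j]) auto
    finally show ?thesis by (simp add: ac_simps)
  qed
  from convergent_functional_path[OF lin this \<sigma>_decseq[OF u, of j]]
  have "convergent (\<lambda>n. \<phi> (indicator_path (u j)) - \<phi> (indicator_path (\<sigma> j n (u j))))"
    by (intro convergent_diff convergent_const)
  then show ?thesis
    unfolding linear_diff[OF lin, symmetric] increment_def[symmetric] by (simp add: \<phi>_def)
qed

text \<open>Increments have norm at most 1, so the constant C survives every limit while the factor
  of the consumed slot disappears.\<close>

lemma multilinear_on_jump:
  assumes ml: "multilinear_on UNIV C \<beta>" and "distinct js" and u: "\<And>i. i \<in> set js \<Longrightarrow> u i \<in> {0..2}"
  shows "multilinear_on (- set js) C (jump u js \<beta>)"
  using assms(2,3)
proof (induction js)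
  case Nil
  have "jump u [] \<beta> = \<beta>" by (simp add: fun_eq_iff)
  then show ?case using ml by simp
next
  case (Cons j js)
  then have IH: "multilinear_on (- set js) C (jump u js \<beta>)" and j: "j \<notin> set js" and uj: "u j \<in> {0..2}" by auto
  have lim: "(\<lambda>n. jump u js \<beta> (x(j := increment j n (u j)))) \<longlonglongrightarrow> jump u (j # js) \<beta> x" for x
    using convergent_jump[where x = x, OF IH j uj] by (simp add: convergent_LIMSEQ_iff)
  show ?case
    unfolding multilinear_on_def
  proof (intro conjI ballI allI)
    show "0 \<le> C" by (rule multilinear_on_nonneg[OF ml])
    fix x
    have "norm (jump u js \<beta> (x(j := increment j n (u j)))) \<le> C * (\<Prod>i\<in>- set (j # js). norm (x i))" for n
    proof -
      have "norm (jump u js \<beta> (x(j := increment j n (u j)))) \<le> C * (\<Prod>i\<in>- set js. norm ((x(j := increment j n (u j))) i))"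
        by (rule multilinear_on_norm_le[OF IH])
      also have "(\<Prod>i\<in>- set js. norm ((x(j := increment j n (u j))) i)) =
          norm (increment j n (u j)) * (\<Prod>i\<in>- set (j # js). norm (x i))"
      proof -
        have "- set js - {j} = - set (j # js)" by auto
        then show ?thesis using j by (subst prod.remove[of _ j]) (auto intro!: prod.cong)
      qed
      also have "\<dots> \<le> 1 * (\<Prod>i\<in>- set (j # js). norm (x i))"
        by (intro mult_right_mono norm_increment uj prod_nonneg) auto
      finally show ?thesis using multilinear_on_nonneg[OF ml] by (simp add: mult_left_mono fun_upd_def)
    qed
    then show "norm (jump u (j # js) \<beta> x) \<le> C * (\<Prod>i\<in>- set (j # js). norm (x i))"
      by (intro LIMSEQ_le_const2[OF tendsto_norm[OF lim]]) auto
    fix i assume i: "i \<in> - set (j # js)"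
    then have ij: "i \<noteq> j" "i \<in> - set js" by auto
    note lini = multilinear_on_linear[OF IH ij(2)]
    have lim': "(\<lambda>n. jump u js \<beta> (x(j := increment j n (u j), i := a))) \<longlonglongrightarrow> jump u (j # js) \<beta> (x(i := a))" for a
      using lim[of "x(i := a)"] by (simp only: fun_upd_twist[OF ij(1)])
    show "linear (\<lambda>a. jump u (j # js) \<beta> (x(i := a)))"
    proof
      fix a b :: "1 skorokhod" and r :: real
      have "(\<lambda>n. jump u js \<beta> (x(j := increment j n (u j), i := a + b))) \<longlonglongrightarrow>
          jump u (j # js) \<beta> (x(i := a)) + jump u (j # js) \<beta> (x(i := b))"
        unfolding linear_add[OF lini] by (intro tendsto_add lim')
      then show "jump u (j # js) \<beta> (x(i := a + b)) = jump u (j # js) \<beta> (x(i := a)) + jump u (j # js) \<beta> (x(i := b))"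
        using LIMSEQ_unique lim' by blast
      have "(\<lambda>n. jump u js \<beta> (x(j := increment j n (u j), i := r *\<^sub>R a))) \<longlonglongrightarrow>
          r *\<^sub>R jump u (j # js) \<beta> (x(i := a))"
        unfolding linear_scale[OF lini] by (intro tendsto_scaleR tendsto_const lim')
      then show "jump u (j # js) \<beta> (x(i := r *\<^sub>R a)) = r *\<^sub>R jump u (j # js) \<beta> (x(i := a))"
        using LIMSEQ_unique lim' by blast
    qed
  qed
qed

lemma jump_tendsto:
  assumes ml: "multilinear_on UNIV C \<beta>" and "distinct (j # js)" and u: "\<And>i. i \<in> set (j # js) \<Longrightarrow> u i \<in> {0..2}"
  shows "(\<lambda>n. jump u js \<beta> (x(j := increment j n (u j)))) \<longlonglongrightarrow> jump u (j # js) \<beta> x"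
proof -
  have "multilinear_on (- set js) C (jump u js \<beta>)"
    using assms by (intro multilinear_on_jump) auto
  from convergent_jump[OF this, of j] show ?thesis
    using assms(2) u by (simp add: convergent_LIMSEQ_iff)
qed

text \<open>Late grids contain the atom, so the increments over which the outermost limit is taken
  are eventually zero.\<close>

lemma jump_atom:
  assumes ml: "multilinear_on UNIV C \<beta>" and d: "distinct (j # js)" and u: "\<And>i. i \<in> set (j # js) \<Longrightarrow> u i \<in> {0..2}"
    and atom: "0 < prob {w\<in>space M. U j w = u j}"
  shows "jump u (j # js) \<beta> x = 0"
proof -
  have ml': "multilinear_on (- set js) C (jump u js \<beta>)"
    using assms by (intro multilinear_on_jump) auto
  have "\<forall>\<^sub>F n in sequentially. \<sigma> j n (u j) = u j"
    by (rule \<sigma>_atom[OF _ atom]) (use u in auto)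
  then have "\<forall>\<^sub>F n in sequentially. jump u js \<beta> (x(j := increment j n (u j))) = 0"
  proof eventually_elim
    case (elim n)
    then show ?case
      using linear_0[OF multilinear_on_linear[OF ml', where i = j and x = x]] d by (simp add: increment_def)
  qed
  then have "(\<lambda>n. jump u js \<beta> (x(j := increment j n (u j)))) \<longlonglongrightarrow> 0"
    by (rule tendsto_eventually)
  from LIMSEQ_unique[OF jump_tendsto[OF ml d u] this] show ?thesis by simp
qed

text \<open>The limits are iterated, so the bound is required for all tuples of levels from m on and
  not only for equal levels. The argument x depends on u because the increments of the slots already
  treated are stored in it.\<close>

lemma jump_square_sum_limit:
  assumes ml: "multilinear_on UNIV C \<beta>" and "distinct js"
    and u: "\<And>u i. u \<in> F \<Longrightarrow> i \<in> set js \<Longrightarrow> u i \<in> {0..2}"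
    and bound: "\<And>n. (\<And>i. m \<le> n i) \<Longrightarrow>
      (\<Sum>u\<in>F. (\<beta> (\<lambda>i. if i \<in> set js then increment i (n i) (u i) else x u i))\<^sup>2) \<le> B"
  shows "(\<Sum>u\<in>F. (jump u js \<beta> (x u))\<^sup>2) \<le> B"
  using assms(2-)
proof (induction js arbitrary: x)
  case Nil
  then show ?case using Nil(3)[of "\<lambda>_. m"] by simp
next
  case (Cons j js)
  have "(\<Sum>u\<in>F. (jump u js \<beta> ((x u)(j := increment j k (u j))))\<^sup>2) \<le> B" if k: "m \<le> k" for k
  proof (rule Cons.IH)
    fix n :: "'n \<Rightarrow> nat" assume n: "\<And>i. m \<le> n i"
    have "(\<lambda>i. if i \<in> set js then increment i (n i) (u i) else ((x u)(j := increment j k (u j))) i) =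
        (\<lambda>i. if i \<in> set (j # js) then increment i ((n(j := k)) i) (u i) else x u i)" for u
      using Cons.prems(1) by auto
    then show "(\<Sum>u\<in>F. (\<beta> (\<lambda>i. if i \<in> set js then increment i (n i) (u i)
        else ((x u)(j := increment j k (u j))) i))\<^sup>2) \<le> B"
      using Cons.prems(3)[of "n(j := k)"] n k by simp
  qed (use Cons.prems in auto)
  then have "\<forall>\<^sub>F k in sequentially. (\<Sum>u\<in>F. (jump u js \<beta> ((x u)(j := increment j k (u j))))\<^sup>2) \<le> B"
    unfolding eventually_sequentially by blast
  moreover have "(\<lambda>k. \<Sum>u\<in>F. (jump u js \<beta> ((x u)(j := increment j k (u j))))\<^sup>2) \<longlonglongrightarrow>
      (\<Sum>u\<in>F. (jump u (j # js) \<beta> (x u))\<^sup>2)"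
    by (intro tendsto_sum tendsto_power jump_tendsto[OF ml Cons.prems(1)]) (use Cons.prems(2) in auto)
  ultimately show ?case by (intro tendsto_upperbound) auto
qed

lemma jump_square_sum:
  assumes ml: "multilinear_on UNIV C \<beta>" and js: "distinct js" and x: "\<And>i. norm (x i) \<le> 1"
    and F: "finite F" "F \<subseteq> PiE (set js) (\<lambda>_. {0..2})"
  shows "(\<Sum>u\<in>F. (jump u js \<beta> x)\<^sup>2) \<le> C\<^sup>2"
proof -
  define K where "K i = (if i \<in> set js then (\<lambda>u. u i) ` F else {})" for i
  have K02: "v \<in> {0..2}" if "v \<in> K i" for v i
    using that F(2) by (auto simp: K_def PiE_def Pi_def split: if_splits)
  have finK: "finite (K i)" for i using F by (auto simp: K_def)
  \<comment> \<open>Only finitely many points occur in each slot. On fine grids their intervals [v,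
    \<sigma> v) are disjoint, which is what the sign condition of
    \<open>multilinear_square_sum\<close> needs.\<close>
  have "\<forall>\<^sub>F n in sequentially. \<forall>i\<in>set js. \<forall>v\<in>K i. \<forall>v'\<in>K i. v < v' \<longrightarrow> \<sigma> i n v < v'"
  proof (intro eventually_ball_finite ballI finK)
    fix i v v' assume "v \<in> K i"
    from \<sigma>_tendsto[OF K02[OF this]] have lim: "(\<lambda>n. \<sigma> i n v) \<longlonglongrightarrow> v" .
    show "\<forall>\<^sub>F n in sequentially. v < v' \<longrightarrow> \<sigma> i n v < v'"
    proof (cases "v < v'")
      case True
      from order_tendstoD(2)[OF lim this] show ?thesis by eventually_elim simp
    qed simp
  qed simp
  then obtain m where m: "\<And>n i v v'. m \<le> n \<Longrightarrow> i \<in> set js \<Longrightarrow> v \<in> K i \<Longrightarrow> v' \<in> K i \<Longrightarrow> v < v' \<Longrightarrow> \<sigma> i n v < v'"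
    unfolding eventually_sequentially by blast
  show ?thesis
  proof (rule jump_square_sum_limit[OF ml js, where m = m])
    show "u i \<in> {0..2}" if "u \<in> F" "i \<in> set js" for u i using that F(2) by (auto simp: PiE_def Pi_def)
    fix n :: "'n \<Rightarrow> nat" assume n: "\<And>i. m \<le> n i"
    have "F \<subseteq> PiE (set js) K" 
    proof
      fix u assume "u \<in> F"
      then have "u \<in> extensional (set js)" "\<And>i. i \<in> set js \<Longrightarrow> u i \<in> K i"
        using F(2) by (auto simp: PiE_def K_def)
      then show "u \<in> PiE (set js) K" by (simp add: PiE_iff)
    qed
    then have "(\<Sum>u\<in>F. (\<beta> (\<lambda>i. if i \<in> set js then increment i (n i) (u i) else x i))\<^sup>2) \<le>
        (\<Sum>u\<in>PiE (set js) K. (\<beta> (\<lambda>i. if i \<in> set js then increment i (n i) (u i) else x i))\<^sup>2)"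
      by (intro sum_mono2 finite_PiE finK) auto
    also have "\<dots> \<le> C\<^sup>2"
    proof (rule multilinear_square_sum[OF ml])
      fix i and \<epsilon> :: "real \<Rightarrow> real" assume i: "i \<in> set js" and \<epsilon>: "\<And>k. \<bar>\<epsilon> k\<bar> = 1"
      show "norm (\<Sum>k\<in>K i. \<epsilon> k *\<^sub>R increment i (n i) k) \<le> 1"
        unfolding increment_def
      proof (rule norm_indicator_path_sum_le)
        show "k \<le> \<sigma> i (n i) k" if "k \<in> K i" for k by (rule \<sigma>_ge[OF K02[OF that]])
        show "\<sigma> i (n i) k \<le> l \<or> \<sigma> i (n i) l \<le> k" if "k \<in> K i" "l \<in> K i" "k \<noteq> l" for k l
          using m[OF n i that(1,2)] m[OF n i that(2,1)] that(3) by (meson less_imp_le linorder_neqE)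
      qed (simp add: \<epsilon>)
    qed (auto simp: finK x)
    finally show "(\<Sum>u\<in>F. (\<beta> (\<lambda>i. if i \<in> set js then increment i (n i) (u i) else x i))\<^sup>2) \<le> C\<^sup>2" .
  qed
qed

lemma countable_jump_support:
  assumes ml: "multilinear_on UNIV C \<beta>" and js: "distinct js" and x: "\<And>i. norm (x i) \<le> 1"
  shows "countable {u \<in> PiE (set js) (\<lambda>_. {0..2}). jump u js \<beta> x \<noteq> 0}"
proof -
  have "(\<lambda>u. (jump u js \<beta> x)\<^sup>2) summable_on PiE (set js) (\<lambda>_. {0..2})"
    by (rule nonneg_bdd_above_summable_on)
      (auto intro!: bdd_aboveI[of _ "C\<^sup>2"] jump_square_sum[OF ml js x])
  from summable_countable_real[OF this] show ?thesis by simp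
qed

text \<open>No regularity in u is available, but \<open>jump\<close> vanishes off a countable set Z
  of tuples. It is therefore a function of the discrete variable T. For u in Z the head coordinate u
  j cannot be an atom, by \<open>jump_atom\<close>, so U j avoids all these values almost
  surely.\<close>

lemma jump_base:
  assumes ml: "multilinear_on UNIV C \<beta>" and js: "distinct js" and x: "\<And>i. norm (x i) \<le> 1"
  shows "(\<lambda>w. jump (\<lambda>i. U i w) js \<beta> x) \<in> borel_measurable M"
    and "js \<noteq> [] \<Longrightarrow> AE w in M. jump (\<lambda>i. U i w) js \<beta> x = 0"
proof -
  define Z where "Z = {u \<in> PiE (set js) (\<lambda>_. {0..2}). jump u js \<beta> x \<noteq> 0}"
  define R where "R w = restrict (\<lambda>i. U i w) (set js)" for w
  define T where "T w = (if R w \<in> Z then Some (R w) else None)" for w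
  define g where "g t = (case t of None \<Rightarrow> 0 | Some u \<Rightarrow> jump u js \<beta> x)" for t
  have Z: "countable Z" unfolding Z_def by (rule countable_jump_support[OF ml js x])
  have jump_R: "jump (\<lambda>i. U i w) js \<beta> x = jump (R w) js \<beta> x" for w
    by (rule jump_cong) (simp add: R_def)
  have R: "R w \<in> PiE (set js) (\<lambda>_. {0..2})" if "w \<in> space M" for w
    using U_range[OF that] by (auto simp: R_def)
  have R_sets: "{w \<in> space M. R w = u} \<in> sets M" if u: "u \<in> Z" for u
  proof -
    have "{w \<in> space M. R w = u} = {w \<in> space M. \<forall>i\<in>set js. U i w = u i}"
      using u by (auto simp: R_def Z_def PiE_def extensional_def restrict_def fun_eq_iff)
    also have "\<dots> \<in> sets M" by measurable
    finally show ?thesis .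
  qed
  have Some: "T -` {Some u} \<inter> space M \<in> sets M" if "u \<in> Z" for u
  proof -
    have "T -` {Some u} \<inter> space M = {w \<in> space M. R w = u}" using that by (auto simp: T_def split: if_splits)
    then show ?thesis using R_sets[OF that] by simp
  qed
  have "T -` {None} \<inter> space M = space M - (\<Union>u\<in>Z. T -` {Some u} \<inter> space M)"
    by (auto simp: T_def split: if_splits)
  also have "\<dots> \<in> sets M" by (intro sets.Diff sets.countable_UN'' Z Some sets.top)
  finally have "T \<in> measurable M (count_space (insert None (Some ` Z)))"
    using Z Some by (subst measurable_count_space_eq_countable) (auto simp: T_def)
  then have "(\<lambda>w. g (T w)) \<in> borel_measurable M" by (rule measurable_compose) simp
  moreover have "jump (\<lambda>i. U i w) js \<beta> x = g (T w)" if "w \<in> space M" for w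
    using R[OF that] unfolding jump_R by (auto simp: g_def T_def Z_def)
  ultimately show "(\<lambda>w. jump (\<lambda>i. U i w) js \<beta> x) \<in> borel_measurable M"
    by (subst measurable_cong) auto
  assume "js \<noteq> []"
  then obtain j js' where j: "js = j # js'" by (cases js) auto
  have "AE w in M. U j w \<noteq> u j" if u: "u \<in> Z" for u
  proof -
    have "\<not> 0 < prob {w\<in>space M. U j w = u j}"
    proof
      assume "0 < prob {w\<in>space M. U j w = u j}"
      then have "jump u (j # js') \<beta> x = 0"
        using u js by (intro jump_atom[OF ml]) (auto simp: Z_def j PiE_def Pi_def)
      then show False using u by (simp add: Z_def j)
    qed
    then have "prob {w\<in>space M. U j w = u j} = 0" using measure_nonneg[of M] by (metis less_eq_real_def)
    then show ?thesis by (subst (asm) prob_eq_0) auto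
  qed
  then have "AE w in M. \<forall>u\<in>Z. U j w \<noteq> u j" by (subst AE_ball_countable[OF Z]) auto
  then show "AE w in M. jump (\<lambda>i. U i w) js \<beta> x = 0"
  proof (rule AE_mp[OF _ AE_I2], intro impI)
    fix w assume w: "w \<in> space M" and *: "\<forall>u\<in>Z. U j w \<noteq> u j"
    have "R w \<notin> Z" using * by (auto simp: R_def j)
    then show "jump (\<lambda>i. U i w) js \<beta> x = 0" using R[OF w] unfolding jump_R by (simp add: Z_def)
  qed
qed

text \<open>The exact path in slot j is the limit of grid paths plus a jump: F = lim H + G. Each H n
  involves finitely many fixed paths in slot j, and G has j moved from js2 to js1. Both are covered
  by the induction hypothesis, which is why js1 and x are general and why vanishing is proved
  together with measurability.\<close>

lemma jump_path:
  assumes ml: "multilinear_on UNIV C \<beta>" and "distinct (js1 @ js2)" and "\<And>i. norm (x i) \<le> 1"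
  shows "(\<lambda>w. jump (\<lambda>i. U i w) js1 \<beta> (\<lambda>i. if i \<in> set js2 then indicator_path (U i w) else x i)) \<in> borel_measurable M
    \<and> (js1 \<noteq> [] \<longrightarrow> (AE w in M. jump (\<lambda>i. U i w) js1 \<beta> (\<lambda>i. if i \<in> set js2 then indicator_path (U i w) else x i) = 0))"
  using assms(2,3)
proof (induction js2 arbitrary: js1 x)
  case Nil
  then show ?case using jump_base[OF ml, of js1 x] by simp
next
  case (Cons j js)
  define X where "X y w = (\<lambda>i. if i \<in> set js then indicator_path (U i w) else (x(j := y)) i)" for y w
  define J where "J y w = jump (\<lambda>i. U i w) js1 \<beta> (X y w)" for y w
  define G where "G w = jump (\<lambda>i. U i w) (j # js1) \<beta> (\<lambda>i. if i \<in> set js then indicator_path (U i w) else x i)" for w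
  have dist: "distinct ((j # js1) @ js)" "distinct (js1 @ js)" "distinct (j # js1)" "distinct js1" "j \<notin> set js1" "j \<notin> set js"
    using Cons.prems(1) by auto
  have G: "G \<in> borel_measurable M" "AE w in M. G w = 0"
    using Cons.IH[OF dist(1) Cons.prems(2)] unfolding G_def[abs_def] by auto
  have J: "J y \<in> borel_measurable M" "js1 \<noteq> [] \<Longrightarrow> AE w in M. J y w = 0" if "norm y \<le> 1" for y
    using Cons.IH[OF dist(2), of "x(j := y)"] Cons.prems(2) that unfolding J_def[abs_def] X_def by auto
  define H where "H n w = J (indicator_path (\<sigma> j n (U j w))) w" for n w
  \<comment> \<open>Measurability of J y is known only for fixed y. Since \<sigma> j n takes
    finitely many values, this is enough.\<close>
  have H_meas: "H n \<in> borel_measurable M" for n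
    unfolding H_def
  proof (rule measurable_compose_countable'[where f = "\<lambda>v. J (indicator_path v)"
        and g = "\<lambda>w. \<sigma> j n (U j w)" and I = "range (\<sigma> j n)"])
    show "(\<lambda>w. \<sigma> j n (U j w)) \<in> measurable M (count_space (range (\<sigma> j n)))"
    proof (subst measurable_count_space_eq_countable[OF countable_finite[OF finite_range_\<sigma>]], intro conjI ballI)
      fix v
      have "(\<lambda>w. \<sigma> j n (U j w)) -` {v} \<inter> space M = {w\<in>space M. \<sigma> j n (U j w) = v}" by auto
      also have "\<dots> \<in> sets M" by measurable
      finally show "(\<lambda>w. \<sigma> j n (U j w)) -` {v} \<inter> space M \<in> sets M" .
    qed auto
  qed (auto intro: J norm_indicator_path_le countable_finite[OF finite_range_\<sigma>])
  have H_AE: "AE w in M. H n w = 0" if "js1 \<noteq> []" for n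
  proof -
    have "AE w in M. \<forall>v\<in>range (\<sigma> j n). J (indicator_path v) w = 0"
      by (subst AE_ball_countable[OF countable_finite[OF finite_range_\<sigma>]])
        (intro ballI J(2)[OF norm_indicator_path_le that])
    then show ?thesis by (rule AE_mp) (auto simp: H_def)
  qed
  define F where "F w = jump (\<lambda>i. U i w) js1 \<beta> (\<lambda>i. if i \<in> set (j # js) then indicator_path (U i w) else x i)" for w
  have lim: "(\<lambda>n. H n w) \<longlonglongrightarrow> F w - G w" if w: "w \<in> space M" for w
  proof -
    have ml': "multilinear_on (- set js1) C (jump (\<lambda>i. U i w) js1 \<beta>)"
      by (rule multilinear_on_jump[OF ml dist(4)]) (rule U_range[OF w])
    have lin: "linear (\<lambda>y. J y w)"
    proof -
      have "X y w = (\<lambda>i. if i \<in> set js then indicator_path (U i w) else x i)(j := y)" for y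
        using dist(6) by (auto simp: X_def)
      then show ?thesis unfolding J_def using multilinear_on_linear[OF ml', of j] dist(5) by simp
    qed
    have F: "F w = J (indicator_path (U j w)) w"
      unfolding F_def J_def X_def by (rule arg_cong[where f = "jump _ _ _"]) auto
    have "H n w = F w - J (increment j n (U j w)) w" for n
      unfolding F H_def linear_diff[OF lin, symmetric] by (simp add: increment_def)
    moreover have "(\<lambda>n. J (increment j n (U j w)) w) \<longlonglongrightarrow> G w"
    proof -
      have "X y w = (\<lambda>i. if i \<in> set js then indicator_path (U i w) else x i)(j := y)" for y
        using dist(6) by (auto simp: X_def)
      then show ?thesis
        unfolding G_def J_def using jump_tendsto[OF ml dist(3), of "\<lambda>i. U i w"] U_range[OF w] by simp
    qed
    ultimately show ?thesis by (simp add: tendsto_diff)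
  qed
  have "(\<lambda>w. F w - G w) \<in> borel_measurable M"
    by (rule borel_measurable_LIMSEQ_real[OF lim H_meas])
  then have "(\<lambda>w. (F w - G w) + G w) \<in> borel_measurable M" using G(1) by (rule borel_measurable_add)
  moreover have "AE w in M. F w = 0" if "js1 \<noteq> []"
  proof -
    have "AE w in M. \<forall>n. H n w = 0" using H_AE[OF that] by (simp add: AE_all_countable)
    with G(2) AE_space show ?thesis
    proof eventually_elim
      case (elim w)
      then show ?case using lim[of w] by (simp add: LIMSEQ_const_iff)
    qed
  qed
  ultimately show ?case by (simp add: F_def)
qed

end

section \<open>Pettis integrals of products of indicator paths\<close>

text \<open>Stated without the definite description hidden in \<open>dunford_integral\<close>.\<close>
definition pettis_witnessed :: "'w measure \<Rightarrow> ('w \<Rightarrow> 'e::banach) \<Rightarrow> bool" where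
  "pettis_witnessed M F \<longleftrightarrow>
     (\<forall>\<phi> :: 'e \<Rightarrow>\<^sub>L real. integrable M (\<lambda>w. blinfun_apply \<phi> (F w))) \<and>
     (\<forall>A\<in>sets M. \<exists>v. \<forall>\<phi> :: 'e \<Rightarrow>\<^sub>L real.
        blinfun_apply \<phi> v = set_lebesgue_integral M A (\<lambda>w. blinfun_apply \<phi> (F w)))"

lemma pettis_witnessed_imp_pettis_integrable:
  fixes F :: "'w \<Rightarrow> 'e::banach"
  assumes "pettis_witnessed M F"
  shows "pettis_integrable M F"
  unfolding pettis_integrable_def dunford_integrable_def
proof (intro conjI allI ballI)
  show "integrable M (\<lambda>w. blinfun_apply \<phi> (F w))" for \<phi> :: "'e \<Rightarrow>\<^sub>L real"
    using assms by (simp add: pettis_witnessed_def)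
  fix A assume "A \<in> sets M"
  then obtain v where "\<And>\<phi> :: 'e \<Rightarrow>\<^sub>L real.
      blinfun_apply \<phi> v = set_lebesgue_integral M A (\<lambda>w. blinfun_apply \<phi> (F w))"
    using assms unfolding pettis_witnessed_def by blast
  then have "dunford_integral M A F = bidual_embedding v"
    by (intro dunford_integral_eqI) (simp add: bidual_embedding.rep_eq)
  then show "dunford_integral M A F \<in> range bidual_embedding" by simp
qed

lemma pettis_witnessed_cong:
  fixes F :: "'w \<Rightarrow> 'e::banach"
  assumes "\<And>w. w \<in> space M \<Longrightarrow> F w = G w" "pettis_witnessed M G"
  shows "pettis_witnessed M F"
proof -
  have *: "integrable M (\<lambda>w. blinfun_apply \<phi> (F w)) \<longleftrightarrow> integrable M (\<lambda>w. blinfun_apply \<phi> (G w))"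
    "set_lebesgue_integral M A (\<lambda>w. blinfun_apply \<phi> (F w)) = set_lebesgue_integral M A (\<lambda>w. blinfun_apply \<phi> (G w))"
    for \<phi> :: "'e \<Rightarrow>\<^sub>L real" and A
    using assms(1) unfolding set_lebesgue_integral_def
    by (auto intro!: Bochner_Integration.integrable_cong Bochner_Integration.integral_cong)
  show ?thesis using assms(2) unfolding pettis_witnessed_def * .
qed

lemma pettis_witnessed_scaleR:
  fixes y :: "'e::banach"
  assumes g: "integrable M g"
  shows "pettis_witnessed M (\<lambda>w. g w *\<^sub>R y)"
  unfolding pettis_witnessed_def blinfun.scaleR_right
proof (intro conjI allI ballI)
  show "integrable M (\<lambda>w. g w *\<^sub>R blinfun_apply \<phi> y)" for \<phi> :: "'e \<Rightarrow>\<^sub>L real"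
    using g by simp
  fix A assume "A \<in> sets M"
  show "\<exists>v. \<forall>\<phi> :: 'e \<Rightarrow>\<^sub>L real. blinfun_apply \<phi> v = set_lebesgue_integral M A (\<lambda>w. g w *\<^sub>R blinfun_apply \<phi> y)"
    by (intro exI[of _ "set_lebesgue_integral M A g *\<^sub>R y"])
      (simp add: blinfun.scaleR_right set_lebesgue_integral_def mult.assoc[symmetric])
qed

lemma pettis_witnessed_sum:
  fixes F :: "'k \<Rightarrow> 'w \<Rightarrow> 'e::banach"
  assumes F: "\<And>k. k \<in> K \<Longrightarrow> pettis_witnessed M (F k)"
  shows "pettis_witnessed M (\<lambda>w. \<Sum>k\<in>K. F k w)"
  unfolding pettis_witnessed_def blinfun.sum_right
proof (intro conjI allI ballI)
  have int: "integrable M (\<lambda>w. blinfun_apply \<phi> (F k w))" if "k \<in> K" for \<phi> :: "'e \<Rightarrow>\<^sub>L real" and k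
    using F[OF that] by (simp add: pettis_witnessed_def)
  then show "integrable M (\<lambda>w. \<Sum>k\<in>K. blinfun_apply \<phi> (F k w))" for \<phi> :: "'e \<Rightarrow>\<^sub>L real"
    by (intro Bochner_Integration.integrable_sum)
  fix A assume A: "A \<in> sets M"
  have "\<exists>v. \<forall>\<phi> :: 'e \<Rightarrow>\<^sub>L real. blinfun_apply \<phi> v = set_lebesgue_integral M A (\<lambda>w. blinfun_apply \<phi> (F k w))"
    if "k \<in> K" for k
    using F[OF that] A by (simp add: pettis_witnessed_def)
  then obtain v where v: "\<And>k (\<phi> :: 'e \<Rightarrow>\<^sub>L real). k \<in> K \<Longrightarrow>
      blinfun_apply \<phi> (v k) = set_lebesgue_integral M A (\<lambda>w. blinfun_apply \<phi> (F k w))"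
    by metis
  have "blinfun_apply \<phi> (\<Sum>k\<in>K. v k) = set_lebesgue_integral M A (\<lambda>w. \<Sum>k\<in>K. blinfun_apply \<phi> (F k w))" for \<phi> :: "'e \<Rightarrow>\<^sub>L real"
    unfolding set_lebesgue_integral_def scaleR_sum_right
    by (subst Bochner_Integration.integral_sum)
      (use A in \<open>auto simp: blinfun.sum_right v set_lebesgue_integral_def intro!: sum.cong integrable_mult_indicator[where 'b = real, simplified] int\<close>)
  then show "\<exists>v. \<forall>\<phi> :: 'e \<Rightarrow>\<^sub>L real. blinfun_apply \<phi> v = set_lebesgue_integral M A (\<lambda>w. \<Sum>k\<in>K. blinfun_apply \<phi> (F k w))"
    by blast
qed

text \<open>The estimate is uniform over the unit ball of the dual, and functionals of norm at most
  1 determine the norm. So v is a Cauchy sequence in E itself, and the limit functional is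
  represented in E and not merely in its bidual.\<close>

lemma weak_limit_exists:
  fixes v :: "nat \<Rightarrow> 'e::banach" and I :: "('e \<Rightarrow>\<^sub>L real) \<Rightarrow> real"
  assumes \<delta>: "\<delta> \<longlonglongrightarrow> 0" and close: "\<And>\<phi> n. \<bar>blinfun_apply \<phi> (v n) - I \<phi>\<bar> \<le> norm \<phi> * \<delta> n"
  shows "\<exists>v'. \<forall>\<phi>. blinfun_apply \<phi> v' = I \<phi>"
proof -
  have vv: "norm (v m - v n) \<le> \<bar>\<delta> m\<bar> + \<bar>\<delta> n\<bar>" for m n
  proof (rule norm_le_of_functionals)
    fix \<phi> :: "'e \<Rightarrow>\<^sub>L real" assume \<phi>: "norm \<phi> \<le> 1"
    have le: "norm \<phi> * \<delta> k \<le> \<bar>\<delta> k\<bar>" for k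
    proof -
      have "norm \<phi> * \<delta> k \<le> norm \<phi> * \<bar>\<delta> k\<bar>" by (intro mult_left_mono) auto
      also have "\<dots> \<le> \<bar>\<delta> k\<bar>" using \<phi> by (intro mult_left_le_one_le) auto
      finally show ?thesis .
    qed
    show "\<bar>blinfun_apply \<phi> (v m - v n)\<bar> \<le> \<bar>\<delta> m\<bar> + \<bar>\<delta> n\<bar>"
      using close[of \<phi> m] close[of \<phi> n] le[of m] le[of n] by (simp add: blinfun.diff_right)
  qed
  have "Cauchy v"
  proof (rule CauchyI)
    fix r :: real assume "0 < r"
    then have "\<forall>\<^sub>F n in sequentially. \<bar>\<delta> n\<bar> < r / 2"
      using tendstoD[OF \<delta>, of "r / 2"] by simp
    then obtain m0 where "\<And>m. m0 \<le> m \<Longrightarrow> \<bar>\<delta> m\<bar> < r / 2" unfolding eventually_sequentially by blast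
    then have "norm (v m - v n) < r" if "m0 \<le> m" "m0 \<le> n" for m n
      using vv[of m n] that by (smt (verit) field_sum_of_halves)
    then show "\<exists>m0. \<forall>m\<ge>m0. \<forall>n\<ge>m0. norm (v m - v n) < r" by blast
  qed
  then obtain v' where v': "v \<longlonglongrightarrow> v'" by (auto simp: Cauchy_convergent_iff convergent_def)
  have "blinfun_apply \<phi> v' = I \<phi>" for \<phi>
  proof (rule LIMSEQ_unique)
    show "(\<lambda>n. blinfun_apply \<phi> (v n)) \<longlonglongrightarrow> blinfun_apply \<phi> v'"
      by (rule bounded_linear.tendsto[OF blinfun.bounded_linear_right v'])
    have "(\<lambda>n. blinfun_apply \<phi> (v n) - I \<phi>) \<longlonglongrightarrow> 0"
    proof (rule Lim_null_comparison)
      show "\<forall>\<^sub>F n in sequentially. norm (blinfun_apply \<phi> (v n) - I \<phi>) \<le> norm \<phi> * \<delta> n"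
        using close by simp
      show "(\<lambda>n. norm \<phi> * \<delta> n) \<longlonglongrightarrow> 0" using tendsto_mult[OF tendsto_const \<delta>] by simp
    qed
    then show "(\<lambda>n. blinfun_apply \<phi> (v n)) \<longlonglongrightarrow> I \<phi>" by (rule LIM_zero_cancel)
  qed
  then show ?thesis by blast
qed

lemma pettis_witnessed_finite_range:
  fixes y :: "'v \<Rightarrow> 'e::banach"
  assumes g: "integrable M g" and T: "T \<in> measurable M (count_space V)" and V: "finite V"
  shows "pettis_witnessed M (\<lambda>w. g w *\<^sub>R y (T w))"
proof (rule pettis_witnessed_cong)
  show "pettis_witnessed M (\<lambda>w. \<Sum>v\<in>V. (indicator (T -` {v} \<inter> space M) w *\<^sub>R g w) *\<^sub>R y v)"
    by (intro pettis_witnessed_sum pettis_witnessed_scaleR integrable_mult_indicator g measurable_sets[OF T]) simp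
  fix w assume w: "w \<in> space M"
  then have "T w \<in> V" using measurable_space[OF T] by simp
  have "(\<Sum>v\<in>V. (indicator (T -` {v} \<inter> space M) w *\<^sub>R g w) *\<^sub>R y v) = (\<Sum>v\<in>V. if T w = v then g w *\<^sub>R y v else 0)"
    using w by (intro sum.cong) auto
  then show "g w *\<^sub>R y (T w) = (\<Sum>v\<in>V. (indicator (T -` {v} \<inter> space M) w *\<^sub>R g w) *\<^sub>R y v)"
    using V \<open>T w \<in> V\<close> by simp
qed

section \<open>Passage from grid paths to exact paths\<close>

context slots
begin

text \<open>Interpolates between the discretised tuple (S empty) and the exact one (S everything).
  The slots enter S singly because \<open>jump_tendsto\<close> controls one limit at a time.\<close>

definition mixed_path :: "'n set \<Rightarrow> ('n \<Rightarrow> nat) \<Rightarrow> 'w \<Rightarrow> 'n \<Rightarrow> 1 skorokhod" where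
  "mixed_path S n w i = indicator_path (if i \<in> S then U i w else \<sigma> i (n i) (U i w))"

lemma norm_mixed_path_le: "norm (mixed_path S n w i) \<le> 1"
  by (simp add: mixed_path_def norm_indicator_path_le)

lemma grid_values_measurable:
  "(\<lambda>w i. \<sigma> i (n i) (U i w)) \<in> measurable M (count_space (PiE UNIV (\<lambda>i. range (\<sigma> i (n i)))))"
proof (subst measurable_count_space_eq_countable)
  show "countable (PiE UNIV (\<lambda>i. range (\<sigma> i (n i))))"
    by (intro countable_finite finite_PiE finite_range_\<sigma>) simp
  have "(\<lambda>w i. \<sigma> i (n i) (U i w)) -` {v} \<inter> space M = {w\<in>space M. \<forall>i. \<sigma> i (n i) (U i w) = v i}" for v
    by (auto simp: fun_eq_iff)
  moreover have "{w\<in>space M. \<forall>i. \<sigma> i (n i) (U i w) = v i} \<in> sets M" for v by measurable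
  ultimately show "(\<lambda>w i. \<sigma> i (n i) (U i w)) \<in> space M \<rightarrow> PiE UNIV (\<lambda>i. range (\<sigma> i (n i))) \<and>
     (\<forall>v\<in>PiE UNIV (\<lambda>i. range (\<sigma> i (n i))). (\<lambda>w i. \<sigma> i (n i) (U i w)) -` {v} \<inter> space M \<in> sets M)"
    by auto
qed

lemma finite_grid_values: "finite (PiE UNIV (\<lambda>i. range (\<sigma> i (n i))))"
  by (intro finite_PiE finite_range_\<sigma>) simp

lemma mixed_path_measurable:
  fixes \<beta> :: "('n \<Rightarrow> 1 skorokhod) \<Rightarrow> real"
  assumes ml: "multilinear_on UNIV C \<beta>"
  shows "(\<lambda>w. \<beta> (mixed_path S n w)) \<in> borel_measurable M"
proof -
  obtain js where js: "set js = S" "distinct js" using finite_distinct_list[of S] by auto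
  define f where "f v w = \<beta> (\<lambda>i. if i \<in> S then indicator_path (U i w) else indicator_path (v i))" for v w
  have "(\<lambda>w. f (\<lambda>i. \<sigma> i (n i) (U i w)) w) \<in> borel_measurable M"
  proof (rule measurable_compose_countable'[where f = f, OF _ grid_values_measurable])
    show "f v \<in> borel_measurable M" for v
      using jump_path[OF ml, of "[]" js "\<lambda>i. indicator_path (v i)"] js
      by (simp add: norm_indicator_path_le f_def[abs_def])
  qed (rule countable_finite[OF finite_grid_values])
  then show ?thesis by (simp add: f_def mixed_path_def[abs_def] if_distrib)
qed

text \<open>Refining slot j alone leaves an error that tends to a jump in that slot, and this
  vanishes almost surely by \<open>jump_path\<close>. The exceptional set depends on the grid values
  in the other slots, of which there are finitely many.\<close>

lemma mixed_path_tendsto: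
  fixes \<beta> :: "('n \<Rightarrow> 1 skorokhod) \<Rightarrow> real"
  assumes ml: "multilinear_on UNIV C \<beta>" and j: "j \<notin> S"
  shows "AE w in M. (\<lambda>k. \<beta> (mixed_path S (n(j := k)) w)) \<longlonglongrightarrow> \<beta> (mixed_path (insert j S) n w)"
proof -
  obtain js where js: "set js = S" "distinct js" using finite_distinct_list[of S] by auto
  define x where "x v w = (\<lambda>i. if i \<in> S then indicator_path (U i w) else indicator_path (v i))" for v w
  define V where "V = PiE UNIV (\<lambda>i. range (\<sigma> i (n i)))"
  have "AE w in M. \<forall>v\<in>V. jump (\<lambda>i. U i w) [j] \<beta> (x v w) = 0"
  proof (subst AE_ball_countable)
    show "countable V" unfolding V_def by (rule countable_finite[OF finite_grid_values])
    show "\<forall>v\<in>V. AE w in M. jump (\<lambda>i. U i w) [j] \<beta> (x v w) = 0"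
      using jump_path[OF ml, of "[j]" js "\<lambda>i. indicator_path (_ i)"] js j
      by (simp add: norm_indicator_path_le x_def)
  qed
  with AE_space show ?thesis
  proof eventually_elim
    case (elim w)
    define v where "v = (\<lambda>i. \<sigma> i (n i) (U i w))"
    have "v \<in> V" by (auto simp: v_def V_def)
    then have "jump (\<lambda>i. U i w) [j] \<beta> (x v w) = 0" using elim by blast
    moreover have "(\<lambda>k. jump (\<lambda>i. U i w) [] \<beta> ((x v w)(j := increment j k (U j w)))) \<longlonglongrightarrow>
        jump (\<lambda>i. U i w) [j] \<beta> (x v w)"
      by (rule jump_tendsto[OF ml]) (use U_range[OF elim(1)] in auto)
    ultimately have lim: "(\<lambda>k. \<beta> ((x v w)(j := increment j k (U j w)))) \<longlonglongrightarrow> 0" by simp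
    note lin = multilinear_on_linear[OF ml UNIV_I, where i = j and x = "x v w"]
    have 1: "mixed_path (insert j S) n w = (x v w)(j := indicator_path (U j w))"
      by (auto simp: mixed_path_def x_def v_def)
    have 2: "mixed_path S (n(j := k)) w = (x v w)(j := indicator_path (\<sigma> j k (U j w)))" for k
      using j by (auto simp: mixed_path_def x_def v_def)
    have "\<beta> (mixed_path S (n(j := k)) w) =
        \<beta> (mixed_path (insert j S) n w) - \<beta> ((x v w)(j := increment j k (U j w)))" for k
      unfolding 1 2 linear_diff[OF lin, symmetric] by (simp add: increment_def)
    moreover have "(\<lambda>k. \<beta> (mixed_path (insert j S) n w) - \<beta> ((x v w)(j := increment j k (U j w)))) \<longlonglongrightarrow>
        \<beta> (mixed_path (insert j S) n w) - 0"
      by (intro tendsto_intros lim)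
    ultimately show ?case by simp
  qed
qed

text \<open>Exact slots are reached from the grid estimate by letting their levels tend to infinity
  one after the other, under the integrable bound 2 C. The estimate does not deteriorate, since it
  is uniform in all levels from m on.\<close>

lemma expectation_mixed_path_difference:
  fixes \<beta> :: "('n \<Rightarrow> 1 skorokhod) \<Rightarrow> real"
  assumes ml: "multilinear_on UNIV C \<beta>" and n: "\<And>i. m \<le> n i"
  shows "expectation (\<lambda>w. \<bar>\<beta> (mixed_path S n w) - \<beta> (mixed_path {} (\<lambda>_. m) w)\<bar>) \<le> C * grid_error m"
proof -
  have "finite S" by simp
  then show ?thesis using n
  proof (induction S arbitrary: n)
    case empty
    then show ?case using expectation_grid_difference[OF ml, of m n] by (simp add: mixed_path_def[abs_def])
  next
    case (insert j S)
    define f where "f T n w = \<bar>\<beta> (mixed_path T n w) - \<beta> (mixed_path {} (\<lambda>_. m) w)\<bar>" for T n w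
    have meas: "f T n \<in> borel_measurable M" for T n
      unfolding f_def using mixed_path_measurable[OF ml] by measurable
    have bound: "norm (f T n w) \<le> 2 * C" for T n w
      using multilinear_on_bound[OF ml, of "mixed_path T n w"] multilinear_on_bound[OF ml, of "mixed_path {} (\<lambda>_. m) w"]
      by (simp add: norm_mixed_path_le f_def)
    have "(\<lambda>k. expectation (f S (n(j := k)))) \<longlonglongrightarrow> expectation (f (insert j S) n)"
    proof (rule integral_dominated_convergence[where w = "\<lambda>_. 2 * C"])
      show "AE w in M. (\<lambda>k. f S (n(j := k)) w) \<longlonglongrightarrow> f (insert j S) n w"
        using mixed_path_tendsto[OF ml insert.hyps(2), of n]
        by eventually_elim (auto simp: f_def intro!: tendsto_intros)
    qed (use meas bound in auto)
    moreover have "\<forall>\<^sub>F k in sequentially. expectation (f S (n(j := k))) \<le> C * grid_error m"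
      unfolding eventually_sequentially f_def
      by (intro exI[of _ m] allI impI insert.IH) (use insert.prems in auto)
    ultimately have "expectation (f (insert j S) n) \<le> C * grid_error m"
      by (intro tendsto_upperbound) auto
    then show ?case by (simp add: f_def[abs_def])
  qed
qed

text \<open>The integrals of the discretised integrand are finite sums in E. They approximate those
  of the exact one with error at most |\<phi>| B C \<open>grid_error m\<close>, so
  \<open>weak_limit_exists\<close> provides the integral over each A.\<close>

lemma pettis_witnessed_path:
  fixes \<tau> :: "('n \<Rightarrow> 1 skorokhod) \<Rightarrow> 'e::banach"
  assumes ml: "multilinear_on UNIV C \<tau>" and V[measurable]: "V \<in> borel_measurable M"
    and B: "\<And>w. w \<in> space M \<Longrightarrow> \<bar>V w\<bar> \<le> B"
  shows "pettis_witnessed M (\<lambda>w. V w *\<^sub>R \<tau> (\<lambda>i. indicator_path (U i w)))"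
proof -
  have B0: "0 \<le> B" using B not_empty by fastforce
  define G where "G n w = mixed_path {} (\<lambda>_. n) w" for n w
  define H where "H w = mixed_path UNIV (\<lambda>_. 0) w" for w
  have mlc: "multilinear_on UNIV (norm \<phi> * C) (\<lambda>x. blinfun_apply \<phi> (\<tau> x))" for \<phi> :: "'e \<Rightarrow>\<^sub>L real"
    by (rule multilinear_on_compose[OF ml])
  have G_meas[measurable]: "(\<lambda>w. blinfun_apply \<phi> (\<tau> (G n w))) \<in> borel_measurable M" for \<phi> :: "'e \<Rightarrow>\<^sub>L real" and n
    unfolding G_def by (rule mixed_path_measurable[OF mlc])
  have H_meas[measurable]: "(\<lambda>w. blinfun_apply \<phi> (\<tau> (H w))) \<in> borel_measurable M" for \<phi> :: "'e \<Rightarrow>\<^sub>L real"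
    unfolding H_def by (rule mixed_path_measurable[OF mlc])
  have G_le: "\<bar>blinfun_apply \<phi> (\<tau> (G n w))\<bar> \<le> norm \<phi> * C" for \<phi> :: "'e \<Rightarrow>\<^sub>L real" and n w
    using multilinear_on_bound[OF mlc, of "G n w" \<phi>] by (simp add: G_def norm_mixed_path_le)
  have H_le: "\<bar>blinfun_apply \<phi> (\<tau> (H w))\<bar> \<le> norm \<phi> * C" for \<phi> :: "'e \<Rightarrow>\<^sub>L real" and w
    using multilinear_on_bound[OF mlc, of "H w" \<phi>] by (simp add: H_def norm_mixed_path_le)
  have bdd_int: "integrable M f" if "f \<in> borel_measurable M" "\<And>w. w \<in> space M \<Longrightarrow> \<bar>f w\<bar> \<le> D"
    for f :: "'w \<Rightarrow> real" and D
    by (rule integrable_const_bound[of _ D]) (use that in auto)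
  have VH: "integrable M (\<lambda>w. V w * blinfun_apply \<phi> (\<tau> (H w)))" for \<phi> :: "'e \<Rightarrow>\<^sub>L real"
    by (rule bdd_int[of _ "B * (norm \<phi> * C)"]) (auto simp: abs_mult intro!: mult_mono B B0 H_le)
  have ind: "integrable M (\<lambda>w. indicator A w * f w)" if "A \<in> sets M" "integrable M f" for A and f :: "'w \<Rightarrow> real"
    using integrable_mult_indicator[OF that] by simp
  have diff: "\<bar>(\<integral>w. indicator A w * (V w * f w) \<partial>M) - (\<integral>w. indicator A w * (V w * g w) \<partial>M)\<bar>
      \<le> B * expectation (\<lambda>w. \<bar>f w - g w\<bar>)"
    if A: "A \<in> sets M" and f[measurable]: "f \<in> borel_measurable M" and g[measurable]: "g \<in> borel_measurable M"
      and D: "\<And>w. \<bar>f w\<bar> \<le> D" "\<And>w. \<bar>g w\<bar> \<le> D" for A f g D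
  proof -
    have int: "integrable M (\<lambda>w. indicator A w * (V w * f w))" "integrable M (\<lambda>w. indicator A w * (V w * g w))"
      by (intro ind A bdd_int[of _ "B * D"]; auto simp: abs_mult intro!: mult_mono B B0 D)+
    have int2: "integrable M (\<lambda>w. \<bar>f w - g w\<bar>)"
    proof (rule bdd_int[of _ "D + D"])
      show "\<bar>\<bar>f w - g w\<bar>\<bar> \<le> D + D" for w using D(1)[of w] D(2)[of w] by linarith
    qed simp
    have "\<bar>(\<integral>w. indicator A w * (V w * f w) \<partial>M) - (\<integral>w. indicator A w * (V w * g w) \<partial>M)\<bar>
        = \<bar>\<integral>w. indicator A w * (V w * f w) - indicator A w * (V w * g w) \<partial>M\<bar>"
      by (subst Bochner_Integration.integral_diff[OF int]) simp
    also have "\<dots> \<le> (\<integral>w. \<bar>indicator A w * (V w * f w) - indicator A w * (V w * g w)\<bar> \<partial>M)"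
      by (rule integral_abs_bound)
    also have "\<dots> \<le> (\<integral>w. B * \<bar>f w - g w\<bar> \<partial>M)"
    proof (rule integral_mono)
      show "integrable M (\<lambda>w. \<bar>indicator A w * (V w * f w) - indicator A w * (V w * g w)\<bar>)"
        by (intro integrable_abs Bochner_Integration.integrable_diff int)
      show "integrable M (\<lambda>w. B * \<bar>f w - g w\<bar>)" using int2 by simp
      fix w assume w: "w \<in> space M"
      have "indicator A w * (V w * f w) - indicator A w * (V w * g w) = indicator A w * (V w * (f w - g w))"
        by (simp add: right_diff_distrib)
      then show "\<bar>indicator A w * (V w * f w) - indicator A w * (V w * g w)\<bar> \<le> B * \<bar>f w - g w\<bar>"
        using B[OF w] B0 by (auto simp: abs_mult indicator_def intro!: mult_right_mono)
    qed
    finally show ?thesis by simp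
  qed
  have PG: "pettis_witnessed M (\<lambda>w. V w *\<^sub>R \<tau> (G n w))" for n
    unfolding G_def mixed_path_def[abs_def] if_False empty_iff
    by (rule pettis_witnessed_finite_range[OF _ grid_values_measurable finite_grid_values,
          where y = "\<lambda>v. \<tau> (\<lambda>i. indicator_path (v i))"])
      (rule bdd_int[OF V B])
  have H_eq: "H w = (\<lambda>i. indicator_path (U i w))" for w
    by (simp add: H_def mixed_path_def fun_eq_iff)
  show ?thesis
    unfolding pettis_witnessed_def H_eq[symmetric]
  proof (intro conjI allI ballI)
    show "integrable M (\<lambda>w. blinfun_apply \<phi> (V w *\<^sub>R \<tau> (H w)))" for \<phi> :: "'e \<Rightarrow>\<^sub>L real"
      using VH by (simp add: blinfun.scaleR_right)
    fix A assume A: "A \<in> sets M"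
    define I where "I \<phi> n = (\<integral>w. indicator A w * (V w * blinfun_apply \<phi> (\<tau> (G n w))) \<partial>M)" for \<phi> :: "'e \<Rightarrow>\<^sub>L real" and n
    define I' where "I' \<phi> = (\<integral>w. indicator A w * (V w * blinfun_apply \<phi> (\<tau> (H w))) \<partial>M)" for \<phi> :: "'e \<Rightarrow>\<^sub>L real"
    have "\<exists>v. \<forall>\<phi> :: 'e \<Rightarrow>\<^sub>L real. blinfun_apply \<phi> v = I \<phi> n" for n
      using PG[of n] A by (simp add: pettis_witnessed_def set_lebesgue_integral_def blinfun.scaleR_right I_def)
    then obtain v where v: "\<And>n (\<phi> :: 'e \<Rightarrow>\<^sub>L real). blinfun_apply \<phi> (v n) = I \<phi> n" by metis
    have II': "\<bar>I' \<phi> - I \<phi> m\<bar> \<le> B * (norm \<phi> * C * grid_error m)" for \<phi> :: "'e \<Rightarrow>\<^sub>L real" and m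
    proof -
      have "H = mixed_path UNIV (\<lambda>_. m)" by (simp add: H_def[abs_def] mixed_path_def fun_eq_iff)
      then have *: "expectation (\<lambda>w. \<bar>blinfun_apply \<phi> (\<tau> (H w)) - blinfun_apply \<phi> (\<tau> (G m w))\<bar>) \<le> norm \<phi> * C * grid_error m"
        unfolding G_def using expectation_mixed_path_difference[OF mlc, of m "\<lambda>_. m" \<phi> UNIV] by simp
      have "\<bar>I' \<phi> - I \<phi> m\<bar> \<le> B * expectation (\<lambda>w. \<bar>blinfun_apply \<phi> (\<tau> (H w)) - blinfun_apply \<phi> (\<tau> (G m w))\<bar>)"
        unfolding I_def I'_def by (rule diff[OF A H_meas G_meas H_le G_le])
      also have "\<dots> \<le> B * (norm \<phi> * C * grid_error m)"
        by (intro mult_left_mono B0 *)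
      finally show ?thesis .
    qed
    have err: "(\<lambda>m. B * (C * grid_error m)) \<longlonglongrightarrow> 0"
      using tendsto_mult[OF tendsto_const tendsto_mult[OF tendsto_const grid_error_tendsto], of B C] by simp
    have "\<exists>v'. \<forall>\<phi> :: 'e \<Rightarrow>\<^sub>L real. blinfun_apply \<phi> v' = I' \<phi>"
    proof (rule weak_limit_exists[OF err])
      show "\<bar>blinfun_apply \<phi> (v m) - I' \<phi>\<bar> \<le> norm \<phi> * (B * (C * grid_error m))" for \<phi> m
        using II'[of \<phi> m] by (simp add: v abs_minus_commute ac_simps)
    qed
    then show "\<exists>v. \<forall>\<phi> :: 'e \<Rightarrow>\<^sub>L real. blinfun_apply \<phi> v = set_lebesgue_integral M A (\<lambda>w. blinfun_apply \<phi> (V w *\<^sub>R \<tau> (H w)))"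
      by (auto simp: I'_def set_lebesgue_integral_def blinfun.scaleR_right)
  qed
qed

end

theorem pettis_witnessed_indicator_paths:
  fixes \<tau> :: "('n::finite \<Rightarrow> 1 skorokhod) \<Rightarrow> 'e::banach" and U :: "'n \<Rightarrow> 'w \<Rightarrow> real"
  assumes M: "prob_space M" and ml: "multilinear_on UNIV C \<tau>"
    and U: "\<And>i. U i \<in> borel_measurable M" "\<And>i w. w \<in> space M \<Longrightarrow> U i w \<in> {0..2}"
    and V: "V \<in> borel_measurable M" "\<And>w. w \<in> space M \<Longrightarrow> \<bar>V w\<bar> \<le> B"
  shows "pettis_witnessed M (\<lambda>w. V w *\<^sub>R \<tau> (\<lambda>i. indicator_path (U i w)))"
proof -
  have "\<exists>\<sigma> \<kappa> e. slot_grid M (U i) \<sigma> \<kappa> e" for i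
    using slot_grid_exists[OF M U(1) U(2)] by metis
  then obtain \<sigma> \<kappa> e where "\<And>i. slot_grid M (U i) (\<sigma> i) (\<kappa> i) (e i)" by metis
  then interpret slots M U \<sigma> \<kappa> e
    using M U by (intro slots.intro slots_axioms.intro)
  show ?thesis by (rule pettis_witnessed_path[OF ml V])
qed

section \<open>Approximation of cadlag functions by step functions\<close>

lemma eval_right_tendsto:
  fixes f :: "'m::finite skorokhod"
  assumes t: "t \<in> unit_cube" and s: "\<And>n. s n \<in> unit_cube" "\<And>n i. t $ i \<le> s n $ i" "s \<longlonglongrightarrow> t"
  shows "(\<lambda>n. eval f (s n)) \<longlonglongrightarrow> eval f t"
proof -
  define F where "F = inf (nhds t) (principal (cube_orthant t {}))"
  obtain y where y: "(eval f \<longlongrightarrow> y) F"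
    using eval[of f] t unfolding cadlag_on_cube_def F_def by blast
  have mem: "t \<in> cube_orthant t {}" using t by (simp add: cube_orthant_def)
  \<comment> \<open>The orthant with L empty contains t, so a property that holds eventually in F
    holds at t itself.\<close>
  have "y = eval f t"
  proof (rule ccontr)
    assume "y \<noteq> eval f t"
    then have "\<forall>\<^sub>F s in F. dist (eval f s) y < dist (eval f t) y" by (intro tendstoD[OF y]) auto
    then have "\<forall>\<^sub>F s in nhds t. s \<in> cube_orthant t {} \<longrightarrow> dist (eval f s) y < dist (eval f t) y"
      by (simp add: F_def eventually_inf_principal)
    from eventually_nhds_x_imp_x[OF this] mem show False by simp
  qed
  moreover have "filterlim s F sequentially"
    unfolding F_def filterlim_inf filterlim_principal
    using s by (auto simp: cube_orthant_def intro: always_eventually)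
  ultimately show ?thesis using filterlim_compose[OF y] by blast
qed

lemma cadlag_local_oscillation:
  fixes f :: "'m::finite skorokhod"
  assumes t: "t \<in> unit_cube" and e: "0 < e"
  obtains r where "0 < r" "\<And>s s'. s \<in> unit_cube \<Longrightarrow> s' \<in> unit_cube \<Longrightarrow> (\<And>i. \<bar>s $ i - t $ i\<bar> < r) \<Longrightarrow>
      (\<And>i. \<bar>s' $ i - t $ i\<bar> < r) \<Longrightarrow> (\<And>i. s $ i < t $ i \<longleftrightarrow> s' $ i < t $ i) \<Longrightarrow>
      \<bar>eval f s - eval f s'\<bar> \<le> e"
proof -
  have "\<exists>y. (eval f \<longlongrightarrow> y) (inf (nhds t) (principal (cube_orthant t L)))" if "L \<in> Pow {i. 0 < t $ i}" for L
    using eval[of f] t that unfolding cadlag_on_cube_def by blast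
  then obtain y where y: "\<And>L. L \<in> Pow {i. 0 < t $ i} \<Longrightarrow>
      (eval f \<longlongrightarrow> y L) (inf (nhds t) (principal (cube_orthant t L)))" by metis
  have "\<forall>\<^sub>F s in nhds t. s \<in> cube_orthant t L \<longrightarrow> dist (eval f s) (y L) < e / 2"
    if "L \<in> Pow {i. 0 < t $ i}" for L
    using tendstoD[OF y[OF that], of "e / 2"] e by (simp add: eventually_inf_principal)
  then have "\<forall>\<^sub>F s in nhds t. \<forall>L\<in>Pow {i. 0 < t $ i}. s \<in> cube_orthant t L \<longrightarrow> dist (eval f s) (y L) < e / 2"
    by (intro eventually_ball_finite) auto
  then obtain r where r: "0 < r" "\<And>s L. dist s t < r \<Longrightarrow> L \<in> Pow {i. 0 < t $ i} \<Longrightarrow> s \<in> cube_orthant t L \<Longrightarrow>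
      dist (eval f s) (y L) < e / 2"
    unfolding eventually_nhds_metric by blast
  \<comment> \<open>The l1 bound on the norm fits a coordinate box into the ball; later arguments
    treat the coordinates separately.\<close>
  have close: "dist s t < r" if "\<And>i. \<bar>s $ i - t $ i\<bar> < r / CARD('m)" for s
  proof -
    have "dist s t \<le> (\<Sum>i\<in>UNIV. \<bar>(s - t) $ i\<bar>)" unfolding dist_norm by (rule norm_le_l1_cart)
    also have "\<dots> < (\<Sum>i\<in>(UNIV :: 'm set). r / CARD('m))"
      using that by (intro sum_strict_mono) auto
    finally show ?thesis by simp
  qed
  show ?thesis
  proof
    show "0 < r / CARD('m)" using r(1) by simp
    fix s s' :: "real ^ 'm"
    assume s: "s \<in> unit_cube" "s' \<in> unit_cube" "\<And>i. \<bar>s $ i - t $ i\<bar> < r / CARD('m)"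
      "\<And>i. \<bar>s' $ i - t $ i\<bar> < r / CARD('m)" "\<And>i. s $ i < t $ i \<longleftrightarrow> s' $ i < t $ i"
    define L where "L = {i. s $ i < t $ i}"
    have L: "L \<in> Pow {i. 0 < t $ i}" using s(1) by (auto simp: L_def unit_cube_def intro: le_less_trans)
    have "s \<in> cube_orthant t L" "s' \<in> cube_orthant t L"
      using s(1,2,5) by (auto simp: cube_orthant_def L_def not_less[symmetric])
    with r(2)[OF close[OF s(3)] L] r(2)[OF close[OF s(4)] L]
    show "\<bar>eval f s - eval f s'\<bar> \<le> e" unfolding dist_real_def by linarith
  qed
qed

text \<open>Compactness gives a finite cover by boxes on whose orthants f oscillates by at most e.
  If \<Gamma> contains the coordinates of all centres and faces, two points of the same cell lie
  near the same centre and in the same orthant about it.\<close>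

lemma cadlag_grid:
  fixes f :: "'m::finite skorokhod"
  assumes e: "0 < e"
  obtains \<Gamma> where "finite \<Gamma>" "1 \<in> \<Gamma>"
    "\<And>s s'. s \<in> unit_cube \<Longrightarrow> s' \<in> unit_cube \<Longrightarrow> (\<And>i \<gamma>. \<gamma> \<in> \<Gamma> \<Longrightarrow> \<gamma> \<le> s $ i \<longleftrightarrow> \<gamma> \<le> s' $ i) \<Longrightarrow>
      \<bar>eval f s - eval f s'\<bar> \<le> e"
proof -
  have "\<exists>r. 0 < r \<and> (\<forall>s s'. s \<in> unit_cube \<longrightarrow> s' \<in> unit_cube \<longrightarrow> (\<forall>i. \<bar>s $ i - t $ i\<bar> < r) \<longrightarrow>
      (\<forall>i. \<bar>s' $ i - t $ i\<bar> < r) \<longrightarrow> (\<forall>i. s $ i < t $ i \<longleftrightarrow> s' $ i < t $ i) \<longrightarrow>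
      \<bar>eval f s - eval f s'\<bar> \<le> e)" if "t \<in> unit_cube" for t
    using cadlag_local_oscillation[OF that e, of f] by metis
  then obtain r where r: "\<And>t. t \<in> unit_cube \<Longrightarrow> 0 < r t"
    "\<And>t s s'. t \<in> unit_cube \<Longrightarrow> s \<in> unit_cube \<Longrightarrow> s' \<in> unit_cube \<Longrightarrow> (\<forall>i. \<bar>s $ i - t $ i\<bar> < r t) \<Longrightarrow>
      (\<forall>i. \<bar>s' $ i - t $ i\<bar> < r t) \<Longrightarrow> (\<forall>i. s $ i < t $ i \<longleftrightarrow> s' $ i < t $ i) \<Longrightarrow>
      \<bar>eval f s - eval f s'\<bar> \<le> e"
    by metis
  define U where "U t = {s :: real ^ 'm. \<forall>i. \<bar>s $ i - t $ i\<bar> < r t / 2}" for t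
  have U: "open (U t)" for t
    unfolding U_def Collect_all_eq by (intro open_INT ballI open_Collect_less continuous_intros finite)
  obtain D where D: "D \<subseteq> unit_cube" "finite D" "unit_cube \<subseteq> (\<Union>t\<in>D. U t)"
    using compactE_image[OF compact_unit_cube, of unit_cube U] U r(1) by (force simp: U_def)
  \<comment> \<open>The boxes have half the admissible radius because s' may lie on a lower face, at
    distance exactly r t / 2. The point 1 is added so that the oscillation times below can stop
    there.\<close>
  define \<Gamma> where "\<Gamma> = insert 1 (\<Union>t\<in>D. \<Union>i. {t $ i, t $ i - r t / 2, t $ i + r t / 2})"
  show ?thesis
  proof
    show "finite \<Gamma>" "1 \<in> \<Gamma>" using D(2) by (auto simp: \<Gamma>_def)
    fix s s' :: "real ^ 'm"
    assume s: "s \<in> unit_cube" "s' \<in> unit_cube" and cell: "\<And>i \<gamma>. \<gamma> \<in> \<Gamma> \<Longrightarrow> \<gamma> \<le> s $ i \<longleftrightarrow> \<gamma> \<le> s' $ i"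
    obtain t where t: "t \<in> D" "s \<in> U t" using D(3) s(1) by blast
    then have tc: "t \<in> unit_cube" using D(1) by blast
    have g: "t $ i \<in> \<Gamma>" "t $ i - r t / 2 \<in> \<Gamma>" "t $ i + r t / 2 \<in> \<Gamma>" for i using t(1) by (auto simp: \<Gamma>_def)
    have near: "\<bar>s $ i - t $ i\<bar> < r t / 2" for i using t(2) by (simp add: U_def)
    have r0: "0 < r t" by (rule r(1)[OF tc])
    have "\<bar>s' $ i - t $ i\<bar> < r t" for i
      using cell[OF g(2), of i i] cell[OF g(3), of i i] near[of i] r0 by (auto simp: abs_if split: if_splits)
    moreover have "\<bar>s $ i - t $ i\<bar> < r t" for i using near[of i] r0 by linarith
    moreover have "s $ i < t $ i \<longleftrightarrow> s' $ i < t $ i" for i using cell[OF g(1), of i i] by linarith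
    ultimately show "\<bar>eval f s - eval f s'\<bar> \<le> e" using r(2)[OF tc s] by blast
  qed
qed

section \<open>Measurability by approximation from the right through rational points\<close>

definition dyadic_above :: "nat \<Rightarrow> real ^ 'm \<Rightarrow> real ^ 'm::finite" where
  "dyadic_above n t = (\<chi> i. min 1 (real_of_int \<lceil>2 ^ n * t $ i\<rceil> / 2 ^ n))"

definition rational_cube :: "(real ^ 'm::finite) set" where
  "rational_cube = {t \<in> unit_cube. \<forall>i. t $ i \<in> \<rat>}"

lemma countable_rational_cube: "countable (rational_cube :: (real ^ 'm::finite) set)"
proof -
  have "countable (PiE (UNIV :: 'm set) (\<lambda>_. \<rat> :: real set))"
    by (intro countable_PiE) (auto simp: countable_rat)
  then have "countable ((\<lambda>x. \<chi> i. x i) ` PiE (UNIV :: 'm set) (\<lambda>_. \<rat> :: real set))" by (rule countable_image)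
  moreover have "rational_cube \<subseteq> (\<lambda>x. \<chi> i. x i) ` PiE (UNIV :: 'm set) (\<lambda>_. \<rat> :: real set)"
  proof
    fix t :: "real ^ 'm" assume "t \<in> rational_cube"
    then show "t \<in> (\<lambda>x. \<chi> i. x i) ` PiE (UNIV :: 'm set) (\<lambda>_. \<rat> :: real set)"
      by (intro image_eqI[where x = "\<lambda>i. t $ i"]) (auto simp: rational_cube_def)
  qed
  ultimately show ?thesis by (rule countable_subset[rotated])
qed

lemma rational_cube_subset: "rational_cube \<subseteq> unit_cube"
  by (auto simp: rational_cube_def)

lemma dyadic_above:
  assumes t: "t \<in> unit_cube"
  shows "dyadic_above n t \<in> rational_cube" "t $ i \<le> dyadic_above n t $ i" "(\<lambda>n. dyadic_above n t) \<longlonglongrightarrow> t"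
proof -
  have t01: "0 \<le> t $ i" "t $ i \<le> 1" for i using t by (auto simp: unit_cube_def)
  have ge: "t $ i \<le> real_of_int \<lceil>2 ^ n * t $ i\<rceil> / 2 ^ n" for n i
    by (simp add: field_simps)
  then show *: "t $ i \<le> dyadic_above n t $ i" for n i
    using t01[of i] by (simp add: dyadic_above_def)
  have "min 1 (real_of_int k / 2 ^ n) \<in> \<rat>" for k n
    by (auto simp: min_def intro!: Rats_divide Rats_power)
  moreover have "0 \<le> dyadic_above n t $ i" for i by (rule order_trans[OF t01(1) *])
  ultimately show "dyadic_above n t \<in> rational_cube"
    by (auto simp: rational_cube_def unit_cube_def dyadic_above_def)
  show "(\<lambda>n. dyadic_above n t) \<longlonglongrightarrow> t"
  proof (rule vec_tendstoI)
    fix i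
    show "(\<lambda>n. dyadic_above n t $ i) \<longlonglongrightarrow> t $ i"
    proof (rule tendsto_sandwich[where f = "\<lambda>_. t $ i" and h = "\<lambda>n. t $ i + (1 / 2) ^ n"])
      have "dyadic_above n t $ i \<le> t $ i + (1 / 2) ^ n" for n
      proof -
        have "real_of_int \<lceil>2 ^ n * t $ i\<rceil> \<le> 2 ^ n * t $ i + 1" by linarith
        then have "real_of_int \<lceil>2 ^ n * t $ i\<rceil> / 2 ^ n \<le> t $ i + (1 / 2) ^ n"
          by (simp add: field_simps power_one_over)
        then show ?thesis by (simp add: dyadic_above_def)
      qed
      then show "\<forall>\<^sub>F n in sequentially. dyadic_above n t $ i \<le> t $ i + (1 / 2) ^ n" by simp
      have "(\<lambda>n. t $ i + (1 / 2) ^ n) \<longlonglongrightarrow> t $ i + 0"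
        by (intro tendsto_intros LIMSEQ_realpow_zero) auto
      then show "(\<lambda>n. t $ i + (1 / 2) ^ n) \<longlonglongrightarrow> t $ i" by simp
    qed (use * in auto)
  qed
qed

lemma eval_dyadic_above_tendsto:
  "t \<in> unit_cube \<Longrightarrow> (\<lambda>n. eval f (dyadic_above n t)) \<longlonglongrightarrow> eval f t"
  using dyadic_above rational_cube_subset by (intro eval_right_tendsto) blast+

lemma norm_skorokhod_rational:
  fixes f :: "'m::finite skorokhod"
  shows "norm f = (SUP t\<in>rational_cube. \<bar>eval f t\<bar>)"
proof (rule antisym)
  have bdd: "bdd_above ((\<lambda>t. \<bar>eval f t\<bar>) ` rational_cube)"
    using bdd_above_eval[of f] rational_cube_subset by (meson bdd_above_mono image_mono)
  show "norm f \<le> (SUP t\<in>rational_cube. \<bar>eval f t\<bar>)"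
  proof (rule norm_skorokhod_least)
    fix t :: "real ^ 'm" assume t: "t \<in> unit_cube"
    show "\<bar>eval f t\<bar> \<le> (SUP t\<in>rational_cube. \<bar>eval f t\<bar>)"
      using dyadic_above(1)[OF t]
      by (intro LIMSEQ_le_const2[OF tendsto_rabs[OF eval_dyadic_above_tendsto[OF t]]])
        (auto intro!: cSUP_upper[OF _ bdd])
  qed
  have "(0 :: real ^ 'm) \<in> rational_cube" by (simp add: rational_cube_def unit_cube_def)
  then show "(SUP t\<in>rational_cube. \<bar>eval f t\<bar>) \<le> norm f"
    by (intro cSUP_least abs_eval_le_norm) auto
qed

lemma norm_measurable:
  fixes X :: "'w \<Rightarrow> 'm::finite skorokhod"
  assumes "X \<in> measurable M skorokhod_algebra"
  shows "(\<lambda>w. norm (X w)) \<in> borel_measurable M"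
  unfolding norm_skorokhod_rational
proof (rule borel_measurable_cSUP[OF countable_rational_cube])
  show "(\<lambda>w. \<bar>eval (X w) t\<bar>) \<in> borel_measurable M" if "t \<in> rational_cube" for t
    using that assms rational_cube_subset unfolding measurable_skorokhod_algebra by (intro borel_measurable_abs) blast
  show "bdd_above ((\<lambda>t. \<bar>eval (X w) t\<bar>) ` rational_cube)" for w
    using bdd_above_eval[of "X w"] rational_cube_subset by (meson bdd_above_mono image_mono)
qed

text \<open>X is only measurable at each fixed t. Rounding the random point up leaves countably many
  positions, and right-continuity restores the value in the limit.\<close>

lemma eval_random_point_measurable:
  fixes X :: "'w \<Rightarrow> 'm::finite skorokhod"
  assumes X: "X \<in> measurable M skorokhod_algebra"
    and T[measurable]: "\<And>i. T i \<in> borel_measurable M" and T01: "\<And>i w. w \<in> space M \<Longrightarrow> T i w \<in> {0..1}"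
  shows "(\<lambda>w. eval (X w) (\<chi> i. T i w)) \<in> borel_measurable M"
proof (rule borel_measurable_LIMSEQ_real)
  have cube: "(\<chi> i. T i w) \<in> unit_cube" if "w \<in> space M" for w using T01[OF that] by (auto simp: unit_cube_def)
  show "(\<lambda>n. eval (X w) (dyadic_above n (\<chi> i. T i w))) \<longlonglongrightarrow> eval (X w) (\<chi> i. T i w)" if "w \<in> space M" for w
    by (rule eval_dyadic_above_tendsto[OF cube[OF that]])
  fix n
  show "(\<lambda>w. eval (X w) (dyadic_above n (\<chi> i. T i w))) \<in> borel_measurable M"
  proof (rule measurable_compose_countable'[where f = "\<lambda>t w. eval (X w) t" and I = rational_cube])
    show "(\<lambda>w. eval (X w) t) \<in> borel_measurable M" if "t \<in> rational_cube" for t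
      using that X rational_cube_subset unfolding measurable_skorokhod_algebra by blast
    show "(\<lambda>w. dyadic_above n (\<chi> i. T i w)) \<in> measurable M (count_space rational_cube)"
    proof (subst measurable_count_space_eq_countable[OF countable_rational_cube], intro conjI ballI)
      show "(\<lambda>w. dyadic_above n (\<chi> i. T i w)) \<in> space M \<rightarrow> rational_cube"
        using dyadic_above(1)[OF cube] by blast
      fix t :: "real ^ 'm"
      have "(\<lambda>w. dyadic_above n (\<chi> i. T i w)) -` {t} \<inter> space M =
          {w\<in>space M. \<forall>i. min 1 (real_of_int \<lceil>2 ^ n * T i w\<rceil> / 2 ^ n) = t $ i}"
        by (auto simp: dyadic_above_def vec_eq_iff)
      also have "\<dots> \<in> sets M" by measurable
      finally show "(\<lambda>w. dyadic_above n (\<chi> i. T i w)) -` {t} \<inter> space M \<in> sets M" .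
    qed
  qed (rule countable_rational_cube)
qed

text \<open>One coordinate moves in [a,b) while the others stay fixed anywhere in the cube. A single
  list of times thus serves all axes, and a point can be moved to a corner of its cell coordinate by
  coordinate.\<close>

definition oscillation_le :: "'m::finite skorokhod \<Rightarrow> real \<Rightarrow> real \<Rightarrow> real \<Rightarrow> bool" where
  "oscillation_le f e a b \<longleftrightarrow>
     (\<forall>i. \<forall>s\<in>unit_cube. \<forall>s'\<in>unit_cube. (\<forall>j. j \<noteq> i \<longrightarrow> s $ j = s' $ j) \<longrightarrow>
        s $ i \<in> {a..<b} \<longrightarrow> s' $ i \<in> {a..<b} \<longrightarrow> \<bar>eval f s - eval f s'\<bar> \<le> e)"

lemma oscillation_le_mono: "oscillation_le f e a b \<Longrightarrow> b' \<le> b \<Longrightarrow> oscillation_le f e a b'"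
  unfolding oscillation_le_def by (meson atLeastLessThan_iff less_le_trans)

text \<open>Rounding up acts on each coordinate separately, so the fixed coordinates still agree,
  and the moving one stays at least a and is eventually below b. The half-open interval fits
  approximation from the right.\<close>

lemma oscillation_le_rational:
  fixes f :: "'m::finite skorokhod"
  shows "oscillation_le f e a b \<longleftrightarrow>
     (\<forall>i. \<forall>s\<in>rational_cube. \<forall>s'\<in>rational_cube. (\<forall>j. j \<noteq> i \<longrightarrow> s $ j = s' $ j) \<longrightarrow>
        s $ i \<in> {a..<b} \<longrightarrow> s' $ i \<in> {a..<b} \<longrightarrow> \<bar>eval f s - eval f s'\<bar> \<le> e)"
  (is "_ \<longleftrightarrow> ?R")
proof
  assume "oscillation_le f e a b"
  then show ?R
    unfolding oscillation_le_def using rational_cube_subset by blast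
next
  assume R: ?R
  show "oscillation_le f e a b"
    unfolding oscillation_le_def
  proof (intro allI ballI impI)
    fix i and s s' :: "real ^ 'm"
    assume s: "s \<in> unit_cube" "s' \<in> unit_cube" "\<forall>j. j \<noteq> i \<longrightarrow> s $ j = s' $ j" "s $ i \<in> {a..<b}" "s' $ i \<in> {a..<b}"
    have ev: "\<forall>\<^sub>F n in sequentially. dyadic_above n t $ i < b" if "t \<in> unit_cube" "t $ i \<in> {a..<b}" for t :: "real ^ 'm"
      using order_tendstoD(2)[OF tendsto_vec_nth[OF dyadic_above(3)[OF that(1)], of i], of b] that(2) by simp
    have "\<forall>\<^sub>F n in sequentially. \<bar>eval f (dyadic_above n s) - eval f (dyadic_above n s')\<bar> \<le> e"
      using ev[OF s(1,4)] ev[OF s(2,5)]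
    proof eventually_elim
      case (elim n)
      have "\<forall>j. j \<noteq> i \<longrightarrow> dyadic_above n s $ j = dyadic_above n s' $ j"
        using s(3) by (simp add: dyadic_above_def)
      moreover have "a \<le> dyadic_above n s $ i" "a \<le> dyadic_above n s' $ i"
        using dyadic_above(2)[OF s(1), of i n] dyadic_above(2)[OF s(2), of i n] s(4,5) by auto
      ultimately show ?case
        using R elim dyadic_above(1)[OF s(1), of n] dyadic_above(1)[OF s(2), of n] by simp
    qed
    then show "\<bar>eval f s - eval f s'\<bar> \<le> e"
      by (intro tendsto_upperbound[OF tendsto_rabs[OF tendsto_diff[OF
            eval_dyadic_above_tendsto[OF s(1)] eval_dyadic_above_tendsto[OF s(2)]]]]) auto
  qed
qed

definition next_time :: "'m::finite skorokhod \<Rightarrow> real \<Rightarrow> real \<Rightarrow> real" where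
  "next_time f e a = Sup (insert a {b\<in>{a..1}. oscillation_le f e a b})"

text \<open>The supremum is attained because the interval is open at its right end: two points below
  the supremum already lie below some admissible b.\<close>

lemma next_time:
  fixes f :: "'m::finite skorokhod"
  assumes "a \<le> 1"
  shows "a \<le> next_time f e a" "next_time f e a \<le> 1" "oscillation_le f e a (next_time f e a)"
    and "a \<le> b \<Longrightarrow> b \<le> 1 \<Longrightarrow> oscillation_le f e a b \<Longrightarrow> b \<le> next_time f e a"
proof -
  let ?S = "insert a {b\<in>{a..1}. oscillation_le f e a b}"
  have bdd: "bdd_above ?S" using assms by (auto intro!: bdd_aboveI[of _ 1])
  show "a \<le> next_time f e a" unfolding next_time_def by (rule cSup_upper[OF _ bdd]) simp
  show "next_time f e a \<le> 1" unfolding next_time_def by (rule cSup_least) (use assms in auto)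
  show "b \<le> next_time f e a" if "a \<le> b" "b \<le> 1" "oscillation_le f e a b"
    unfolding next_time_def by (rule cSup_upper[OF _ bdd]) (use that in auto)
  show "oscillation_le f e a (next_time f e a)"
    unfolding oscillation_le_def
  proof (intro allI ballI impI)
    fix i and s s' :: "real ^ 'm"
    assume s: "s \<in> unit_cube" "s' \<in> unit_cube" "\<forall>j. j \<noteq> i \<longrightarrow> s $ j = s' $ j"
      "s $ i \<in> {a..<next_time f e a}" "s' $ i \<in> {a..<next_time f e a}"
    then have "max (s $ i) (s' $ i) < Sup ?S" by (simp add: next_time_def)
    then obtain b where "b \<in> ?S" "max (s $ i) (s' $ i) < b" using less_cSup_iff[OF _ bdd] by blast
    then show "\<bar>eval f s - eval f s'\<bar> \<le> e" using s unfolding oscillation_le_def by auto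
  qed
qed

primrec osc_time :: "'m::finite skorokhod \<Rightarrow> real \<Rightarrow> nat \<Rightarrow> real" where
  "osc_time f e 0 = 0"
| "osc_time f e (Suc k) = next_time f e (osc_time f e k)"

lemma osc_time_le: "osc_time f e k \<le> 1"
  by (induction k) (simp_all add: next_time)

lemma osc_time_Suc: "osc_time f e k \<le> osc_time f e (Suc k)"
  by (simp add: next_time osc_time_le del: osc_time.simps(1))

lemma osc_time_mono: "j \<le> k \<Longrightarrow> osc_time f e j \<le> osc_time f e k"
  by (rule lift_Suc_mono_le[of "osc_time f e"]) (rule osc_time_Suc)

lemma osc_time_range: "osc_time f e k \<in> {0..1}"
  using osc_time_mono[of 0 k f e] osc_time_le[of f e k] by simp

text \<open>Let g be the next point of \<Gamma> after the current time. Moving one coordinate within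
  [current time, g) changes no comparison with \<Gamma>, so the next time is at least g. Each step
  therefore passes a point of the finite set \<Gamma> until 1 is reached.\<close>

lemma osc_time_reaches:
  fixes f :: "'m::finite skorokhod"
  assumes e: "0 < e"
  obtains k where "osc_time f e k = 1"
proof -
  obtain \<Gamma> where \<Gamma>: "finite \<Gamma>" "1 \<in> \<Gamma>"
    "\<And>s s'. s \<in> unit_cube \<Longrightarrow> s' \<in> unit_cube \<Longrightarrow> (\<And>i \<gamma>. \<gamma> \<in> \<Gamma> \<Longrightarrow> \<gamma> \<le> s $ i \<longleftrightarrow> \<gamma> \<le> s' $ i) \<Longrightarrow>
      \<bar>eval f s - eval f s'\<bar> \<le> e"
    using cadlag_grid[OF e, of f] by blast
  define R where "R k = {\<gamma>\<in>\<Gamma>. osc_time f e k < \<gamma> \<and> \<gamma> \<le> 1}" for k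
  have step: "card (R (Suc k)) < card (R k)" if ne: "osc_time f e k \<noteq> 1" for k
  proof -
    have fin: "finite (R k)" using \<Gamma>(1) by (simp add: R_def)
    have "1 \<in> R k" using \<Gamma>(2) ne osc_time_le[of f e k] by (simp add: R_def)
    then have ne': "R k \<noteq> {}" by blast
    define g where "g = Min (R k)"
    have gR: "g \<in> R k" unfolding g_def by (rule Min_in[OF fin ne'])
    have "oscillation_le f e (osc_time f e k) g"
      unfolding oscillation_le_def
    proof (intro allI ballI impI \<Gamma>(3))
      fix i and s s' :: "real ^ 'm" and j \<gamma>
      assume s: "\<forall>j. j \<noteq> i \<longrightarrow> s $ j = s' $ j" "s $ i \<in> {osc_time f e k..<g}" "s' $ i \<in> {osc_time f e k..<g}" "\<gamma> \<in> \<Gamma>"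
      show "\<gamma> \<le> s $ j \<longleftrightarrow> \<gamma> \<le> s' $ j"
      proof (cases "j = i")
        case True
        have "\<gamma> \<le> osc_time f e k \<or> g \<le> \<gamma>"
          using Min_le[OF fin, of \<gamma>] s(4) gR by (force simp: R_def g_def)
        then show ?thesis using s(2,3) True by auto
      qed (use s in simp)
    qed
    then have "g \<le> osc_time f e (Suc k)"
      using gR next_time(4)[OF osc_time_le[of f e k], of g f e] by (simp add: R_def)
    then have "g \<notin> R (Suc k)" by (simp add: R_def)
    moreover have "R (Suc k) \<subseteq> R k" using osc_time_Suc[of f e k] unfolding R_def by (auto simp del: osc_time.simps)
    ultimately have "R (Suc k) \<subset> R k" using gR by blast
    then show ?thesis by (rule psubset_card_mono[OF fin])
  qed
  have "\<exists>k. osc_time f e k = 1"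
  proof (rule ccontr)
    assume "\<nexists>k. osc_time f e k = 1"
    with step have lt: "card (R (Suc k)) < card (R k)" for k by blast
    have "card (R k) + k \<le> card (R 0)" for k
    proof (induction k)
      case (Suc k)
      then show ?case using lt[of k] by linarith
    qed simp
    from this[of "Suc (card (R 0))"] show False by simp
  qed
  then show ?thesis using that by blast
qed

text \<open>As the supremum is attained, the next time is at least c \<le> 1 exactly when T is, or
  when the oscillation on [T, c) is at most e. By \<open>oscillation_le_rational\<close> the latter
  is a countable intersection of events.\<close>

lemma osc_time_measurable:
  fixes X :: "'w \<Rightarrow> 'm::finite skorokhod"
  assumes X: "X \<in> measurable M skorokhod_algebra"
  shows "(\<lambda>w. osc_time (X w) e k) \<in> borel_measurable M"
proof (induction k)
  case (Suc k)
  define T where "T w = osc_time (X w) e k" for w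
  have [measurable]: "T \<in> borel_measurable M" using Suc by (simp add: T_def[abs_def])
  have ev[measurable]: "(\<lambda>w. eval (X w) t) \<in> borel_measurable M" if "t \<in> rational_cube" for t
    using that X rational_cube_subset unfolding measurable_skorokhod_algebra by blast
  show ?case
  proof (rule borel_measurableI_ge)
    fix c :: real
    show "{w \<in> space M. c \<le> osc_time (X w) e (Suc k)} \<in> sets M"
    proof (cases "c \<le> 1")
      case False
      then have "{w \<in> space M. c \<le> osc_time (X w) e (Suc k)} = {}"
        using osc_time_le[of _ e "Suc k"] by (auto simp del: osc_time.simps intro: order_trans)
      then show ?thesis by (simp only: sets.empty_sets)
    next
      case True
      have iff: "c \<le> osc_time (X w) e (Suc k) \<longleftrightarrow> c \<le> T w \<or> oscillation_le (X w) e (T w) c" for w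
        using next_time(1-3)[OF osc_time_le[of "X w" e k], of "X w" e] next_time(4)[OF osc_time_le[of "X w" e k], of c "X w" e] True
          oscillation_le_mono[of "X w" e "T w"]
        by (cases "c \<le> T w") (auto simp: T_def)
      have "{w \<in> space M. oscillation_le (X w) e (T w) c} =
        {w \<in> space M. \<forall>i. \<forall>s\<in>rational_cube. \<forall>s'\<in>rational_cube. (\<forall>j. j \<noteq> i \<longrightarrow> s $ j = s' $ j) \<longrightarrow>
          T w \<le> s $ i \<and> s $ i < c \<longrightarrow> T w \<le> s' $ i \<and> s' $ i < c \<longrightarrow> \<bar>eval (X w) s - eval (X w) s'\<bar> \<le> e}"
        unfolding oscillation_le_rational atLeastLessThan_iff ..
      also have "\<dots> \<in> sets M"
      proof -
        have "{w \<in> space M. (\<forall>j. j \<noteq> i \<longrightarrow> s $ j = s' $ j) \<longrightarrow>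
            T w \<le> s $ i \<and> s $ i < c \<longrightarrow> T w \<le> s' $ i \<and> s' $ i < c \<longrightarrow> \<bar>eval (X w) s - eval (X w) s'\<bar> \<le> e} \<in> sets M"
          if [measurable]: "s \<in> rational_cube" "s' \<in> rational_cube" for i s s'
          using ev[OF that(1)] ev[OF that(2)] by measurable
        then show ?thesis
          by (intro sets.sets_Collect_countable_All sets.sets_Collect_countable_All' countable_rational_cube)
      qed
      finally have "{w \<in> space M. oscillation_le (X w) e (T w) c} \<in> sets M" .
      then have "{w \<in> space M. c \<le> T w} \<union> {w \<in> space M. oscillation_le (X w) e (T w) c} \<in> sets M" by measurable
      also have "{w \<in> space M. c \<le> T w} \<union> {w \<in> space M. oscillation_le (X w) e (T w) c} =
          {w \<in> space M. c \<le> osc_time (X w) e (Suc k)}"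
        unfolding iff by auto
      finally show ?thesis .
    qed
  qed
qed simp

section \<open>Tensor powers of cadlag functions\<close>

text \<open>The approximants need to be good only on sets H N that exhaust the space, since the
  number of oscillation times and the norm of X are finite but not bounded. The error in the
  integrals splits into e times the integral of g, and the integral of g off H N, which tends to 0
  by dominated convergence.\<close>

lemma pettis_witnessed_approx:
  fixes F :: "'w \<Rightarrow> 'e::banach"
  assumes g: "integrable M g" and Fg: "\<And>w. w \<in> space M \<Longrightarrow> norm (F w) \<le> g w"
    and approx: "\<And>e. 0 < e \<Longrightarrow> \<exists>(H :: nat \<Rightarrow> 'w set) G. (\<forall>N. H N \<in> sets M) \<and> incseq H \<and> (\<Union>N. H N) = space M \<and>
      (\<forall>N. pettis_witnessed M (G N)) \<and> (\<forall>N. \<forall>w\<in>H N. norm (F w - G N w) \<le> e * g w)"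
  shows "pettis_witnessed M F"
proof -
  define \<epsilon> where "\<epsilon> j = inverse (real (Suc j))" for j
  have \<epsilon>: "0 < \<epsilon> j" "\<epsilon> \<longlonglongrightarrow> 0" for j
    using LIMSEQ_inverse_real_of_nat by (simp_all add: \<epsilon>_def[abs_def] del: of_nat_Suc)
  have "\<exists>(H :: nat \<Rightarrow> 'w set) G. (\<forall>N. H N \<in> sets M) \<and> incseq H \<and> (\<Union>N. H N) = space M \<and>
      (\<forall>N. pettis_witnessed M (G N)) \<and> (\<forall>N. \<forall>w\<in>H N. norm (F w - G N w) \<le> \<epsilon> j * g w)" for j
    by (rule approx[OF \<epsilon>(1)])
  then obtain H :: "nat \<Rightarrow> nat \<Rightarrow> 'w set" and G where HG: "\<And>j. (\<forall>N. H j N \<in> sets M) \<and> incseq (H j) \<and> (\<Union>N. H j N) = space M \<and>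
      (\<forall>N. pettis_witnessed M (G j N)) \<and> (\<forall>N. \<forall>w\<in>H j N. norm (F w - G j N w) \<le> \<epsilon> j * g w)" by metis
  then have H[measurable]: "H j N \<in> sets M" and inc: "incseq (H j)" and UN: "(\<Union>N. H j N) = space M"
    and G: "pettis_witnessed M (G j N)" and FG: "w \<in> H j N \<Longrightarrow> norm (F w - G j N w) \<le> \<epsilon> j * g w" for j N w
    by blast+
  have g0: "0 \<le> g w" if "w \<in> space M" for w using Fg[OF that] norm_ge_zero order_trans by blast
  have Gint: "integrable M (\<lambda>w. blinfun_apply \<phi> (G j N w))" for \<phi> :: "'e \<Rightarrow>\<^sub>L real" and j N
    using G[of j N] by (simp add: pettis_witnessed_def)
  have \<phi>_le: "\<bar>blinfun_apply \<phi> x\<bar> \<le> norm \<phi> * norm x" for \<phi> :: "'e \<Rightarrow>\<^sub>L real" and x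
    using norm_blinfun[of \<phi> x] by simp
  have \<phi>FG: "\<bar>blinfun_apply \<phi> (F w) - blinfun_apply \<phi> (G j N w)\<bar> \<le> norm \<phi> * (\<epsilon> j * g w)"
    if "w \<in> H j N" for \<phi> :: "'e \<Rightarrow>\<^sub>L real" and j N w
    using order_trans[OF \<phi>_le mult_left_mono[OF FG[OF that] norm_ge_zero]] by (simp add: blinfun.diff_right)
  have F_meas: "(\<lambda>w. blinfun_apply \<phi> (F w)) \<in> borel_measurable M" for \<phi> :: "'e \<Rightarrow>\<^sub>L real"
  proof (rule borel_measurable_LIMSEQ_real)
    \<comment> \<open>For measurability each w gets the first set that contains it, so the
      approximation is valid at every point.\<close>
    define n where "n j w = (LEAST N. w \<in> H j N)" for j w
    have n: "w \<in> H j (n j w)" if "w \<in> space M" for j w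
    proof -
      have "w \<in> (\<Union>N. H j N)" using that by (simp only: UN)
      then obtain N where "w \<in> H j N" by blast
      then show ?thesis unfolding n_def by (rule LeastI)
    qed
    show "(\<lambda>w. blinfun_apply \<phi> (G j (n j w) w)) \<in> borel_measurable M" for j
    proof (rule measurable_compose_countable'[where f = "\<lambda>N w. blinfun_apply \<phi> (G j N w)" and g = "n j" and I = UNIV])
      show "n j \<in> measurable M (count_space UNIV)" unfolding n_def by measurable
    qed (use Gint in auto)
    show "(\<lambda>j. blinfun_apply \<phi> (G j (n j w) w)) \<longlonglongrightarrow> blinfun_apply \<phi> (F w)" if w: "w \<in> space M" for w
    proof -
      have "(\<lambda>j. blinfun_apply \<phi> (F w) - blinfun_apply \<phi> (G j (n j w) w)) \<longlonglongrightarrow> 0"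
      proof (rule Lim_null_comparison)
        show "\<forall>\<^sub>F j in sequentially. norm (blinfun_apply \<phi> (F w) - blinfun_apply \<phi> (G j (n j w) w)) \<le> norm \<phi> * (\<epsilon> j * g w)"
          using \<phi>FG[OF n[OF w]] by simp
        have "(\<lambda>j. norm \<phi> * (\<epsilon> j * g w)) \<longlonglongrightarrow> norm \<phi> * (0 * g w)" by (intro tendsto_intros \<epsilon>(2))
        then show "(\<lambda>j. norm \<phi> * (\<epsilon> j * g w)) \<longlonglongrightarrow> 0" by simp
      qed
      from tendsto_diff[OF tendsto_const[of "blinfun_apply \<phi> (F w)"] this] show ?thesis by simp
    qed
  qed
  have \<phi>F: "\<bar>blinfun_apply \<phi> (F w)\<bar> \<le> norm \<phi> * g w" if "w \<in> space M" for \<phi> :: "'e \<Rightarrow>\<^sub>L real" and w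
    using order_trans[OF \<phi>_le mult_left_mono[OF Fg[OF that] norm_ge_zero]] .
  have Fint: "integrable M (\<lambda>w. blinfun_apply \<phi> (F w))" for \<phi> :: "'e \<Rightarrow>\<^sub>L real"
    by (rule Bochner_Integration.integrable_bound[OF integrable_mult_right[OF g, of "norm \<phi>"] F_meas])
      (use \<phi>F g0 in \<open>auto simp: abs_mult\<close>)
  have "\<exists>N. (\<integral>w. indicator (space M - H j N) w * g w \<partial>M) \<le> \<epsilon> j" for j
  proof -
    have "(\<lambda>N. \<integral>w. indicator (space M - H j N) w * g w \<partial>M) \<longlonglongrightarrow> (\<integral>w. 0 \<partial>M)"
    proof (rule integral_dominated_convergence[OF _ _ g])
      show "AE w in M. (\<lambda>N. indicator (space M - H j N) w * g w) \<longlonglongrightarrow> 0"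
      proof (rule AE_I2, rule tendsto_eventually)
        fix w assume "w \<in> space M"
        then have "w \<in> (\<Union>N. H j N)" by (simp only: UN)
        then obtain N0 where "w \<in> H j N0" by blast
        then have "w \<in> H j N" if "N0 \<le> N" for N using inc[of j] that by (meson incseqD subsetD)
        then show "\<forall>\<^sub>F N in sequentially. indicator (space M - H j N) w * g w = 0"
          unfolding eventually_sequentially by (intro exI[of _ N0]) auto
      qed
      show "AE w in M. norm (indicator (space M - H j N) w * g w) \<le> g w" for N
        using g0 by (intro AE_I2) (auto simp: indicator_def)
      show "(\<lambda>w. indicator (space M - H j N) w * g w) \<in> borel_measurable M" for N
        using borel_measurable_integrable[OF g] by measurable
    qed simp
    then have "\<forall>\<^sub>F N in sequentially. (\<integral>w. indicator (space M - H j N) w * g w \<partial>M) < \<epsilon> j"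
      using order_tendstoD(2)[of _ 0 sequentially "\<epsilon> j"] \<epsilon>(1) by simp
    then show ?thesis unfolding eventually_sequentially by (meson less_imp_le order_refl)
  qed
  then obtain N where N: "\<And>j. (\<integral>w. indicator (space M - H j (N j)) w * g w \<partial>M) \<le> \<epsilon> j" by metis
  define c where "c = (\<integral>w. g w \<partial>M)"
  show ?thesis
    unfolding pettis_witnessed_def
  proof (intro conjI allI ballI Fint)
    fix A assume A: "A \<in> sets M"
    have "\<exists>v. \<forall>\<phi> :: 'e \<Rightarrow>\<^sub>L real. blinfun_apply \<phi> v =
        (\<integral>w. indicator (A \<inter> H j (N j)) w * blinfun_apply \<phi> (G j (N j) w) \<partial>M)" for j
      using G[of j "N j"] sets.Int[OF A H[of j "N j"]] by (simp add: pettis_witnessed_def set_lebesgue_integral_def)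
    then obtain v where v: "\<And>j (\<phi> :: 'e \<Rightarrow>\<^sub>L real). blinfun_apply \<phi> (v j) =
        (\<integral>w. indicator (A \<inter> H j (N j)) w * blinfun_apply \<phi> (G j (N j) w) \<partial>M)" by metis
    have "\<exists>v'. \<forall>\<phi> :: 'e \<Rightarrow>\<^sub>L real. blinfun_apply \<phi> v' = (\<integral>w. indicator A w * blinfun_apply \<phi> (F w) \<partial>M)"
    proof (rule weak_limit_exists)
      show "(\<lambda>j. \<epsilon> j * c + \<epsilon> j) \<longlonglongrightarrow> 0"
        using tendsto_add[OF tendsto_mult[OF \<epsilon>(2) tendsto_const[of c]] \<epsilon>(2)] by simp
      fix \<phi> :: "'e \<Rightarrow>\<^sub>L real" and j
      let ?K = "H j (N j)"
      have int1: "integrable M (\<lambda>w. indicator (A \<inter> ?K) w * blinfun_apply \<phi> (G j (N j) w))"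
        using integrable_mult_indicator[OF sets.Int[OF A H[of j "N j"]] Gint[of \<phi> j "N j"]] by simp
      have int2: "integrable M (\<lambda>w. indicator A w * blinfun_apply \<phi> (F w))"
        using integrable_mult_indicator[OF A Fint[of \<phi>]] by simp
      have int3: "integrable M (\<lambda>w. indicator (space M - ?K) w * g w)"
        using integrable_mult_indicator[OF _ g, of "space M - ?K"] by simp
      have "\<bar>blinfun_apply \<phi> (v j) - (\<integral>w. indicator A w * blinfun_apply \<phi> (F w) \<partial>M)\<bar> =
          \<bar>\<integral>w. indicator (A \<inter> ?K) w * blinfun_apply \<phi> (G j (N j) w) - indicator A w * blinfun_apply \<phi> (F w) \<partial>M\<bar>"
        by (simp add: v Bochner_Integration.integral_diff[OF int1 int2])
      also have "\<dots> \<le> (\<integral>w. \<bar>indicator (A \<inter> ?K) w * blinfun_apply \<phi> (G j (N j) w) - indicator A w * blinfun_apply \<phi> (F w)\<bar> \<partial>M)"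
        by (rule integral_abs_bound)
      also have "\<dots> \<le> (\<integral>w. norm \<phi> * (\<epsilon> j * g w) + norm \<phi> * (indicator (space M - ?K) w * g w) \<partial>M)"
      proof (rule integral_mono)
        show "integrable M (\<lambda>w. \<bar>indicator (A \<inter> ?K) w * blinfun_apply \<phi> (G j (N j) w) - indicator A w * blinfun_apply \<phi> (F w)\<bar>)"
          by (intro integrable_abs Bochner_Integration.integrable_diff int1 int2)
        show "integrable M (\<lambda>w. norm \<phi> * (\<epsilon> j * g w) + norm \<phi> * (indicator (space M - ?K) w * g w))"
          by (intro Bochner_Integration.integrable_add integrable_mult_right int3 g)
        fix w assume w: "w \<in> space M"
        have nn: "0 \<le> norm \<phi> * (\<epsilon> j * g w)" "0 \<le> norm \<phi> * g w" using g0[OF w] \<epsilon>(1)[of j] by simp_all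
        show "\<bar>indicator (A \<inter> ?K) w * blinfun_apply \<phi> (G j (N j) w) - indicator A w * blinfun_apply \<phi> (F w)\<bar>
          \<le> norm \<phi> * (\<epsilon> j * g w) + norm \<phi> * (indicator (space M - ?K) w * g w)"
          using nn \<phi>FG[of w j "N j" \<phi>] \<phi>F[OF w, of \<phi>] w
          by (cases "w \<in> A"; cases "w \<in> ?K") (auto simp: abs_minus_commute)
      qed
      also have "\<dots> = norm \<phi> * (\<epsilon> j * c) + norm \<phi> * (\<integral>w. indicator (space M - ?K) w * g w \<partial>M)"
        by (subst Bochner_Integration.integral_add)
          (auto intro!: Bochner_Integration.integrable_add integrable_mult_right int3 g simp: c_def)
      also have "\<dots> \<le> norm \<phi> * (\<epsilon> j * c) + norm \<phi> * \<epsilon> j"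
        by (intro add_left_mono mult_left_mono N) simp
      finally show "\<bar>blinfun_apply \<phi> (v j) - (\<integral>w. indicator A w * blinfun_apply \<phi> (F w) \<partial>M)\<bar> \<le> norm \<phi> * (\<epsilon> j * c + \<epsilon> j)"
        by (simp add: distrib_left)
    qed
    then show "\<exists>v. \<forall>\<phi> :: 'e \<Rightarrow>\<^sub>L real. blinfun_apply \<phi> v = set_lebesgue_integral M A (\<lambda>w. blinfun_apply \<phi> (F w))"
      by (simp add: set_lebesgue_integral_def)
  qed
qed

lemma multilinear_on_product_path: "multilinear_on UNIV 1 product_path"
  unfolding multilinear_on_def
  by (intro conjI ballI allI linear_product_path) (simp_all add: norm_product_path_le)

text \<open>Changing the entry at (l, j) changes the product path of slot l alone, and that one
  linearly; both maps are then linear in the entry.\<close>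

lemma multilinear_on_compose_product_path:
  fixes \<tau> :: "('l::finite \<Rightarrow> 'm::finite skorokhod) \<Rightarrow> 'e::real_normed_vector"
  assumes ml: "multilinear_on UNIV C \<tau>"
  shows "multilinear_on UNIV C (\<lambda>x :: 'l \<times> 'm \<Rightarrow> 1 skorokhod. \<tau> (\<lambda>l. product_path (\<lambda>j. x (l, j))))"
  unfolding multilinear_on_def
proof (intro conjI ballI allI)
  show C: "0 \<le> C" by (rule multilinear_on_nonneg[OF ml])
  fix x :: "'l \<times> 'm \<Rightarrow> 1 skorokhod"
  have "norm (\<tau> (\<lambda>l. product_path (\<lambda>j. x (l, j)))) \<le> C * (\<Prod>l\<in>UNIV. norm (product_path (\<lambda>j. x (l, j))))"
    by (rule multilinear_on_norm_le[OF ml])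
  also have "\<dots> \<le> C * (\<Prod>l\<in>UNIV. \<Prod>j\<in>UNIV. norm (x (l, j)))"
    by (intro mult_left_mono prod_mono conjI norm_product_path_le C) auto
  also have "(\<Prod>l\<in>UNIV. \<Prod>j\<in>UNIV. norm (x (l, j))) = (\<Prod>i\<in>UNIV. norm (x i))"
    by (subst prod.cartesian_product) (simp add: case_prod_beta)
  finally show "norm (\<tau> (\<lambda>l. product_path (\<lambda>j. x (l, j)))) \<le> C * (\<Prod>i\<in>UNIV. norm (x i))" .
  fix i :: "'l \<times> 'm"
  obtain l j where i: "i = (l, j)" by (cases i)
  have eq: "(\<lambda>l'. product_path (\<lambda>j'. (x(i := a)) (l', j'))) =
      (\<lambda>l'. product_path (\<lambda>j'. x (l', j')))(l := product_path ((\<lambda>j'. x (l, j'))(j := a)))" for a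
  proof
    fix l'
    have "(\<lambda>j'. (x(i := a)) (l', j')) = (if l' = l then (\<lambda>j'. x (l, j'))(j := a) else (\<lambda>j'. x (l', j')))"
      by (auto simp: i)
    then show "product_path (\<lambda>j'. (x(i := a)) (l', j')) =
        ((\<lambda>l'. product_path (\<lambda>j'. x (l', j')))(l := product_path ((\<lambda>j'. x (l, j'))(j := a)))) l'"
      by simp
  qed
  show "linear (\<lambda>a. \<tau> (\<lambda>l'. product_path (\<lambda>j'. (x(i := a)) (l', j'))))"
    unfolding eq
    using linear_compose[OF linear_product_path multilinear_on_linear[OF ml UNIV_I]]
    by (simp add: o_def)
qed

lemma pettis_witnessed_products:
  fixes \<tau> :: "('l::finite \<Rightarrow> 'm::finite skorokhod) \<Rightarrow> 'e::banach"
    and c :: "'k \<Rightarrow> 'w \<Rightarrow> real" and T :: "'k \<Rightarrow> 'm \<Rightarrow> 'w \<Rightarrow> real"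
  assumes M: "prob_space M" and ml: "multilinear_on UNIV C \<tau>" and K: "finite K"
    and c: "\<And>k. k \<in> K \<Longrightarrow> c k \<in> borel_measurable M" "\<And>k w. k \<in> K \<Longrightarrow> w \<in> space M \<Longrightarrow> \<bar>c k w\<bar> \<le> B"
    and T: "\<And>k j. k \<in> K \<Longrightarrow> T k j \<in> borel_measurable M" "\<And>k j w. k \<in> K \<Longrightarrow> w \<in> space M \<Longrightarrow> T k j w \<in> {0..2}"
  shows "pettis_witnessed M (\<lambda>w. \<tau> (\<lambda>_. \<Sum>k\<in>K. c k w *\<^sub>R product_path (\<lambda>j. indicator_path (T k j w))))"
proof -
  define y where "y k w = product_path (\<lambda>j. indicator_path (T k j w))" for k w
  have "\<tau> (\<lambda>_. \<Sum>k\<in>K. c k w *\<^sub>R y k w) =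
      (\<Sum>\<kappa>\<in>PiE UNIV (\<lambda>_. K). (\<Prod>l\<in>UNIV. c (\<kappa> l) w) *\<^sub>R \<tau> (\<lambda>l. y (\<kappa> l) w))" for w
    using multilinear_on_expand[OF ml, of UNIV "\<lambda>_. K" "\<lambda>_ k. c k w *\<^sub>R y k w"]
      multilinear_on_scale[OF ml, of UNIV "\<lambda>l. c (_ l) w" "\<lambda>l. y (_ l) w"] K
    by simp
  moreover have "pettis_witnessed M (\<lambda>w. \<Sum>\<kappa>\<in>PiE UNIV (\<lambda>_. K). (\<Prod>l\<in>UNIV. c (\<kappa> l) w) *\<^sub>R \<tau> (\<lambda>l. y (\<kappa> l) w))"
  proof (rule pettis_witnessed_sum)
    fix \<kappa> :: "'l \<Rightarrow> 'k" assume "\<kappa> \<in> PiE UNIV (\<lambda>_. K)"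
    then have \<kappa>: "\<kappa> l \<in> K" for l by auto
    have "pettis_witnessed M (\<lambda>w. (\<Prod>l\<in>UNIV. c (\<kappa> l) w) *\<^sub>R
        (\<lambda>x. \<tau> (\<lambda>l. product_path (\<lambda>j. x (l, j)))) (\<lambda>i. indicator_path ((\<lambda>(l, j). T (\<kappa> l) j) i w)))"
    proof (rule pettis_witnessed_indicator_paths[OF M multilinear_on_compose_product_path[OF ml]])
      show "(\<lambda>w. \<Prod>l\<in>UNIV. c (\<kappa> l) w) \<in> borel_measurable M"
        by (intro borel_measurable_prod c \<kappa>)
      show "\<bar>\<Prod>l\<in>UNIV. c (\<kappa> l) w\<bar> \<le> (\<Prod>l\<in>(UNIV :: 'l set). B)" if "w \<in> space M" for w
        unfolding abs_prod by (intro prod_mono conjI c \<kappa> that) auto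
    qed (use T \<kappa> in \<open>auto split: prod.splits\<close>)
    then show "pettis_witnessed M (\<lambda>w. (\<Prod>l\<in>UNIV. c (\<kappa> l) w) *\<^sub>R \<tau> (\<lambda>l. y (\<kappa> l) w))"
      by (simp add: y_def)
  qed
  ultimately show ?thesis by (simp add: y_def)
qed

text \<open>Exchanging x for y slot by slot costs at most C d R^(l-1) each time. The condition 1
  \<le> R allows the exponent to be rounded up to l, which fits the moment of order l.\<close>

lemma norm_multilinear_diag_diff_le:
  fixes \<tau> :: "('l::finite \<Rightarrow> 'a::real_normed_vector) \<Rightarrow> 'e::real_normed_vector"
  assumes ml: "multilinear_on UNIV C \<tau>" and R: "1 \<le> R" "norm x \<le> R" "norm y \<le> R" and d: "norm (x - y) \<le> d"
  shows "norm (\<tau> (\<lambda>_. x) - \<tau> (\<lambda>_. y)) \<le> C * CARD('l) * d * R ^ CARD('l)"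
proof -
  define p where "p S = (\<lambda>i. if i \<in> S then y else x)" for S :: "'l set"
  have "norm (\<tau> (\<lambda>_. x) - \<tau> (p S)) \<le> C * card S * d * R ^ CARD('l)" for S
  using finite[of S] proof induction
    case (insert j S)
    note lin = multilinear_on_linear[OF ml UNIV_I, where i = j and x = "p S"]
    have "p S = (p S)(j := x)" "p (insert j S) = (p S)(j := y)" using insert(2) by (auto simp: p_def)
    then have "\<tau> (p S) - \<tau> (p (insert j S)) = \<tau> ((p S)(j := x - y))"
      using linear_diff[OF lin, of x y] by simp
    then have "norm (\<tau> (p S) - \<tau> (p (insert j S))) \<le> C * (\<Prod>i\<in>UNIV. norm (((p S)(j := x - y)) i))"
      using multilinear_on_norm_le[OF ml, of "(p S)(j := x - y)"] by simp
    also have "(\<Prod>i\<in>UNIV. norm (((p S)(j := x - y)) i)) = norm (x - y) * (\<Prod>i\<in>UNIV - {j}. norm (p S i))"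
      by (subst prod.remove[of _ j]) auto
    also have "\<dots> \<le> d * (\<Prod>i\<in>UNIV - {j}. R)"
      by (intro mult_mono prod_mono d prod_nonneg order_trans[OF norm_ge_zero d]) (auto simp: p_def R)
    also have "(\<Prod>i\<in>(UNIV :: 'l set) - {j}. R) \<le> R ^ CARD('l)"
      using R(1) by (simp add: power_increasing)
    finally have "norm (\<tau> (p S) - \<tau> (p (insert j S))) \<le> C * (d * R ^ CARD('l))"
      using multilinear_on_nonneg[OF ml] order_trans[OF norm_ge_zero d] by (simp add: mult_left_mono)
    moreover have "norm (\<tau> (\<lambda>_. x) - \<tau> (p (insert j S))) \<le>
        norm (\<tau> (\<lambda>_. x) - \<tau> (p S)) + norm (\<tau> (p S) - \<tau> (p (insert j S)))"
      using norm_triangle_ineq[of "\<tau> (\<lambda>_. x) - \<tau> (p S)" "\<tau> (p S) - \<tau> (p (insert j S))"] by simp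
    ultimately show ?case using insert by (simp add: algebra_simps)
  qed (simp_all add: p_def)
  from this[of UNIV] show ?thesis by (simp add: p_def)
qed

text \<open>The cell \<open>N\<close> is \<open>[1, 2)\<close> and only catches the end point of the unit interval.\<close>
definition cell_end :: "'m::finite skorokhod \<Rightarrow> real \<Rightarrow> nat \<Rightarrow> nat \<Rightarrow> real" where
  "cell_end f e N k = (if k \<le> N then osc_time f e k else 2)"

lemma cell_end_range: "cell_end f e N k \<in> {0..2}"
  using osc_time_range[of f e k] by (auto simp: cell_end_def)

lemma cell_end_mono: "j \<le> k \<Longrightarrow> cell_end f e N j \<le> cell_end f e N k"
  using osc_time_mono[of j k f e] osc_time_range[of f e j] by (auto simp: cell_end_def)

definition cell_point :: "'m::finite skorokhod \<Rightarrow> real \<Rightarrow> ('m \<Rightarrow> nat) \<Rightarrow> real ^ 'm" where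
  "cell_point f e \<kappa> = (\<chi> i. osc_time f e (\<kappa> i))"

definition step_approx :: "'m::finite skorokhod \<Rightarrow> real \<Rightarrow> nat \<Rightarrow> 'm skorokhod" where
  "step_approx f e N = (\<Sum>\<kappa>\<in>PiE UNIV (\<lambda>_. {..N}). eval f (cell_point f e \<kappa>) *\<^sub>R
     product_path (\<lambda>j. indicator_path (cell_end f e N (\<kappa> j)) - indicator_path (cell_end f e N (Suc (\<kappa> j)))))"

text \<open>At t the step function equals f at the lower corner of the cell of t. The way to that
  corner takes \<open>CARD('m)\<close> moves in a single coordinate, each within one oscillation
  interval and so of cost at most e.\<close>

lemma norm_step_approx_le:
  fixes f :: "'m::finite skorokhod" and e :: real
  assumes e: "0 < e" and N: "osc_time f e N = 1"
  shows "norm (f - step_approx f e N) \<le> CARD('m) * e"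
proof (rule norm_skorokhod_least)
  fix t :: "real ^ 'm" assume t: "t \<in> unit_cube"
  then have t01: "t $ j \<in> {0..1}" for j by (simp add: unit_cube_def)
  let ?W = "cell_end f e N"
  have "\<exists>k\<le>N. ?W k \<le> t $ j \<and> t $ j < ?W (Suc k)" for j
  proof -
    define S where "S = {k. k \<le> N \<and> osc_time f e k \<le> t $ j}"
    have S: "finite S" "0 \<in> S" using t01[of j] by (auto simp: S_def)
    define k where "k = Max S"
    have k: "k \<in> S" unfolding k_def using S by (intro Max_in) auto
    have "t $ j < ?W (Suc k)"
    proof (cases "Suc k \<le> N")
      case True
      have "Suc k \<notin> S" using Max_ge[OF S(1), of "Suc k"] by (auto simp: k_def)
      then show ?thesis using True by (simp add: S_def cell_end_def del: osc_time.simps)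
    qed (use t01[of j] in \<open>simp add: cell_end_def\<close>)
    then show ?thesis using k by (intro exI[of _ k]) (auto simp: S_def cell_end_def)
  qed
  then obtain k where k: "\<And>j. k j \<le> N" "\<And>j. ?W (k j) \<le> t $ j" "\<And>j. t $ j < ?W (Suc (k j))" by metis
  have uniq: "l = k j" if "?W l \<le> t $ j" "t $ j < ?W (Suc l)" for j l
  proof (rule ccontr)
    assume "l \<noteq> k j"
    then consider "Suc l \<le> k j" | "Suc (k j) \<le> l" by linarith
    then show False
      using cell_end_mono[of "Suc l" "k j" f e N] cell_end_mono[of "Suc (k j)" l f e N] k(2,3)[of j] that
      by cases auto
  qed
  have prod: "eval (product_path (\<lambda>j. indicator_path (?W (\<kappa> j)) - indicator_path (?W (Suc (\<kappa> j))))) t = (if k = \<kappa> then 1 else 0)" for \<kappa>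
  proof -
    have "eval (indicator_path (?W (\<kappa> j)) - indicator_path (?W (Suc (\<kappa> j)))) (vec (t $ j)) = (if \<kappa> j = k j then 1 else 0)" for j
    proof -
      have "(vec (t $ j) :: real ^ 1) \<in> unit_cube" using t01[of j] by (simp add: unit_cube_def)
      moreover have "?W (\<kappa> j) \<le> ?W (Suc (\<kappa> j))" by (rule cell_end_mono) simp
      moreover have "\<kappa> j = k j \<longleftrightarrow> ?W (\<kappa> j) \<le> t $ j \<and> t $ j < ?W (Suc (\<kappa> j))"
        using k(2,3)[of j] uniq[of "\<kappa> j" j] by metis
      ultimately show ?thesis by (simp add: eval_simps eval_indicator_path)
    qed
    then show ?thesis unfolding eval_product_path by (auto simp: fun_eq_iff) metis
  qed
  have "eval (step_approx f e N) t = (\<Sum>\<kappa>\<in>PiE UNIV (\<lambda>_. {..N}). if k = \<kappa> then eval f (cell_point f e \<kappa>) else 0)"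
    unfolding step_approx_def eval_sum by (intro sum.cong) (auto simp: eval_simps prod)
  also have "\<dots> = eval f (cell_point f e k)"
    using k(1) by (subst sum.delta') (auto intro!: finite_PiE)
  finally have ev: "eval (step_approx f e N) t = eval f (cell_point f e k)" .
  define p where "p S = (\<chi> i. if i \<in> S then osc_time f e (k i) else t $ i)" for S
  have "\<bar>eval f t - eval f (p S)\<bar> \<le> card S * e" for S
    using finite[of S]
  proof induction
    case (insert j S)
    have "\<bar>eval f (p S) - eval f (p (insert j S))\<bar> \<le> e"
    proof (cases "k j < N")
      case True
      then have W: "?W (k j) = osc_time f e (k j)" "?W (Suc (k j)) = osc_time f e (Suc (k j))"
        by (simp_all add: cell_end_def)
      have "oscillation_le f e (osc_time f e (k j)) (osc_time f e (Suc (k j)))"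
        using next_time(3)[OF osc_time_le[of f e "k j"]] by simp
      moreover have "p T \<in> unit_cube" for T
        using t01 osc_time_range[of f e] by (auto simp: p_def unit_cube_def)
      moreover have "\<forall>i. i \<noteq> j \<longrightarrow> p S $ i = p (insert j S) $ i" by (simp add: p_def)
      moreover have "p S $ j \<in> {osc_time f e (k j)..<osc_time f e (Suc (k j))}"
        "p (insert j S) $ j \<in> {osc_time f e (k j)..<osc_time f e (Suc (k j))}"
        using k(2,3)[of j] insert(2) unfolding W p_def by (auto simp del: osc_time.simps)
      ultimately show ?thesis unfolding oscillation_le_def by blast
    next
      \<comment> \<open>The last cell meets the unit interval only in the point 1, which is its own
        lower end point, so this move is trivial.\<close>
      case False
      then have "k j = N" using k(1)[of j] by simp
      then have "osc_time f e (k j) = t $ j" using k(2)[of j] t01[of j] N by (simp add: cell_end_def)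
      then have "p (insert j S) = p S" by (auto simp: p_def vec_eq_iff)
      then show ?thesis using e by simp
    qed
    then show ?case using insert by (simp add: algebra_simps)
  qed (simp add: p_def)
  from this[of UNIV] show "\<bar>eval (f - step_approx f e N) t\<bar> \<le> CARD('m) * e"
    by (simp add: eval_simps ev cell_point_def p_def)
qed

lemma pettis_witnessed_step_approx:
  fixes \<tau> :: "('l::finite \<Rightarrow> 'm::finite skorokhod) \<Rightarrow> 'e::banach" and X :: "'w \<Rightarrow> 'm skorokhod"
  assumes M: "prob_space M" and ml: "multilinear_on UNIV C \<tau>" and X: "X \<in> measurable M skorokhod_algebra"
    and H: "H \<in> sets M" and B: "\<And>w. w \<in> H \<Longrightarrow> norm (X w) \<le> B" "0 \<le> B"
  shows "pettis_witnessed M (\<lambda>w. \<tau> (\<lambda>_. indicator H w *\<^sub>R step_approx (X w) e N))"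
proof -
  \<comment> \<open>The Boolean vector chooses in each coordinate the lower or the upper end of the
    cell, the upper end with sign -1. Expanding the product of differences turns each cell into 2^m
    signed orthant indicators.\<close>
  define K where "K = PiE (UNIV :: 'm set) (\<lambda>_. {..N}) \<times> (UNIV :: ('m \<Rightarrow> bool) set)"
  define c where "c k w = (indicator H w * eval (X w) (cell_point (X w) e (fst k))) * (\<Prod>j\<in>UNIV. if snd k j then - 1 else 1)"
    for k :: "('m \<Rightarrow> nat) \<times> ('m \<Rightarrow> bool)" and w
  define T where "T k j w = cell_end (X w) e N (if snd k j then Suc (fst k j) else fst k j)"
    for k :: "('m \<Rightarrow> nat) \<times> ('m \<Rightarrow> bool)" and j w
  have osc[measurable]: "(\<lambda>w. osc_time (X w) e k) \<in> borel_measurable M" for k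
    by (rule osc_time_measurable[OF X])
  have expand: "product_path (\<lambda>j. indicator_path (cell_end (X w) e N (\<kappa> j)) - indicator_path (cell_end (X w) e N (Suc (\<kappa> j)))) =
      (\<Sum>b\<in>UNIV. (\<Prod>j\<in>UNIV. if b j then - 1 else 1) *\<^sub>R product_path (\<lambda>j. indicator_path (T (\<kappa>, b) j w)))" for \<kappa> w
  proof -
    let ?z = "\<lambda>j b. indicator_path (cell_end (X w) e N (if b then Suc (\<kappa> j) else \<kappa> j))"
    have "product_path (\<lambda>j. indicator_path (cell_end (X w) e N (\<kappa> j)) - indicator_path (cell_end (X w) e N (Suc (\<kappa> j)))) =
        product_path (\<lambda>j. if j \<in> UNIV then \<Sum>b\<in>UNIV. (if b then - 1 else 1) *\<^sub>R ?z j b else 0)"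
      by (rule arg_cong[where f = product_path]) (auto simp: UNIV_bool)
    also have "\<dots> = (\<Sum>b\<in>PiE UNIV (\<lambda>_. UNIV). product_path (\<lambda>j. if j \<in> UNIV then (if b j then - 1 else 1) *\<^sub>R ?z j (b j) else 0))"
      by (rule multilinear_on_expand[OF multilinear_on_product_path]) auto
    also have "\<dots> = (\<Sum>b\<in>UNIV. (\<Prod>j\<in>UNIV. if b j then - 1 else 1) *\<^sub>R product_path (\<lambda>j. ?z j (b j)))"
    proof (rule sum.cong)
      fix b :: "'m \<Rightarrow> bool"
      show "product_path (\<lambda>j. if j \<in> UNIV then (if b j then - 1 else 1) *\<^sub>R ?z j (b j) else 0) =
          (\<Prod>j\<in>UNIV. if b j then - 1 else 1) *\<^sub>R product_path (\<lambda>j. ?z j (b j))"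
        using multilinear_on_scale[OF multilinear_on_product_path subset_UNIV,
            of UNIV "\<lambda>j. if b j then - 1 else 1" "\<lambda>j. ?z j (b j)"] by simp
    qed (simp add: PiE_UNIV_domain)
    finally show ?thesis unfolding T_def fst_conv snd_conv .
  qed
  have "indicator H w *\<^sub>R step_approx (X w) e N = (\<Sum>k\<in>K. c k w *\<^sub>R product_path (\<lambda>j. indicator_path (T k j w)))" for w
    unfolding step_approx_def expand K_def
    by (simp add: scaleR_sum_right sum.cartesian_product c_def case_prod_beta mult.assoc)
  moreover have "pettis_witnessed M (\<lambda>w. \<tau> (\<lambda>_. \<Sum>k\<in>K. c k w *\<^sub>R product_path (\<lambda>j. indicator_path (T k j w))))"
  proof (rule pettis_witnessed_products[OF M ml])
    show "finite K" unfolding K_def by (intro finite_cartesian_product finite_PiE) auto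
    fix k :: "('m \<Rightarrow> nat) \<times> ('m \<Rightarrow> bool)"
    have "(\<lambda>w. eval (X w) (cell_point (X w) e (fst k))) \<in> borel_measurable M"
      unfolding cell_point_def by (rule eval_random_point_measurable[OF X osc osc_time_range])
    then show "c k \<in> borel_measurable M" unfolding c_def[abs_def] using H by measurable
    show "T k j \<in> borel_measurable M" for j
      unfolding T_def[abs_def] cell_end_def by (cases "(if snd k j then Suc (fst k j) else fst k j) \<le> N") (simp_all add: osc)
    fix w
    show "T k j w \<in> {0..2}" for j unfolding T_def by (rule cell_end_range)
    have "\<bar>\<Prod>j\<in>(UNIV :: 'm set). if snd k j then - 1 else 1 :: real\<bar> = 1"
      unfolding abs_prod by (rule prod.neutral) simp
    then show "\<bar>c k w\<bar> \<le> B"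
      using B abs_eval_le_norm[of "X w" "cell_point (X w) e (fst k)"]
      by (auto simp: c_def abs_mult indicator_def intro: order_trans)
  qed
  ultimately show ?thesis by simp
qed

text \<open>On H N the N-th oscillation time is 1, so the same finite list of cells works for all w,
  and the coefficients are bounded by N. The dominating function (1 + |X|)^l bounds the integrand
  and also the factor R^l of the approximation error; it is integrable by the moment
  assumption.\<close>

theorem pettis_witnessed_multilinear:
  fixes \<tau> :: "('l::finite \<Rightarrow> 'm::finite skorokhod) \<Rightarrow> 'e::banach" and X :: "'w \<Rightarrow> 'm skorokhod"
  assumes M: "prob_space M" and X: "X \<in> measurable M skorokhod_algebra"
    and fin: "(\<integral>\<^sup>+ w. ennreal (norm (X w) ^ CARD('l)) \<partial>M) < \<infinity>"
    and ml: "multilinear_on UNIV 1 \<tau>"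
  shows "pettis_witnessed M (\<lambda>w. \<tau> (\<lambda>_. X w))"
proof (rule pettis_witnessed_approx)
  interpret prob_space M by (rule M)
  have [measurable]: "(\<lambda>w. norm (X w)) \<in> borel_measurable M" by (rule norm_measurable[OF X])
  define g where "g w = (1 + norm (X w)) ^ CARD('l)" for w
  have "integrable M (\<lambda>w. norm (X w) ^ CARD('l))"
    by (rule integrableI_bounded) (use fin in simp_all)
  then have int: "integrable M (\<lambda>w. 2 ^ CARD('l) * (1 + norm (X w) ^ CARD('l)))" by simp
  have g_le: "g w \<le> 2 ^ CARD('l) * (1 + norm (X w) ^ CARD('l))" for w
  proof -
    have "g w \<le> (2 * max 1 (norm (X w))) ^ CARD('l)" unfolding g_def by (intro power_mono) auto
    also have "\<dots> = 2 ^ CARD('l) * max 1 (norm (X w)) ^ CARD('l)" by (rule power_mult_distrib)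
    also have "max 1 (norm (X w)) ^ CARD('l) \<le> 1 + norm (X w) ^ CARD('l)" by (auto simp: max_def)
    finally show ?thesis by simp
  qed
  have "g \<in> borel_measurable M" unfolding g_def[abs_def] by measurable
  then show "integrable M g"
    by (intro Bochner_Integration.integrable_bound[OF int] AE_I2) (use g_le in \<open>simp_all add: g_def\<close>)
  show "norm (\<tau> (\<lambda>_. X w)) \<le> g w" for w
  proof -
    have "norm (\<tau> (\<lambda>_. X w)) \<le> norm (X w) ^ CARD('l)"
      using multilinear_on_norm_le[OF ml, of "\<lambda>_. X w"] by simp
    also have "\<dots> \<le> g w" unfolding g_def by (intro power_mono) auto
    finally show ?thesis .
  qed
  fix \<epsilon> :: real assume \<epsilon>: "0 < \<epsilon>"
  define m where "m = real CARD('m)"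
  \<comment> \<open>The bound 1 keeps the step function below 1 + |X| in norm. The factor l undoes
    the number of exchanged slots, and e = d / m the number of coordinate moves.\<close>
  define d where "d = min 1 (\<epsilon> / CARD('l))"
  define e where "e = d / m"
  have m: "0 < m" by (simp add: m_def)
  have d: "0 < d" "d \<le> 1" "CARD('l) * d \<le> \<epsilon>" using \<epsilon> by (auto simp: d_def min_def field_simps)
  have e: "0 < e" "m * e = d" using d m by (auto simp: e_def)
  define H where "H N = {w\<in>space M. osc_time (X w) e N = 1 \<and> norm (X w) \<le> real N}" for N
  have osc[measurable]: "(\<lambda>w. osc_time (X w) e N) \<in> borel_measurable M" for N
    by (rule osc_time_measurable[OF X])
  have H: "H N \<in> sets M" for N unfolding H_def by measurable
  have "incseq H"
  proof (rule incseq_SucI, rule subsetI)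
    fix N w assume "w \<in> H N"
    then show "w \<in> H (Suc N)"
      using osc_time_Suc[of "X w" e N] osc_time_le[of "X w" e "Suc N"] by (auto simp: H_def simp del: osc_time.simps)
  qed
  moreover have "(\<Union>N. H N) = space M"
  proof (intro equalityI subsetI)
    fix w assume w: "w \<in> space M"
    obtain k where k: "osc_time (X w) e k = 1" using osc_time_reaches[OF e(1)] .
    obtain l where l: "norm (X w) \<le> real l" using real_arch_simple by blast
    have "osc_time (X w) e (max k l) = 1"
      using osc_time_mono[of k "max k l" "X w" e] osc_time_le[of "X w" e "max k l"] k by simp
    moreover have "norm (X w) \<le> real (max k l)" using l by simp
    ultimately show "w \<in> (\<Union>N. H N)" using w unfolding H_def by blast
  qed (auto simp: H_def)
  moreover have "pettis_witnessed M (\<lambda>w. \<tau> (\<lambda>_. indicator (H N) w *\<^sub>R step_approx (X w) e N))" for N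
    by (rule pettis_witnessed_step_approx[OF M ml X H, where B = "real N"]) (auto simp: H_def)
  moreover have "norm (\<tau> (\<lambda>_. X w) - \<tau> (\<lambda>_. indicator (H N) w *\<^sub>R step_approx (X w) e N)) \<le> \<epsilon> * g w"
    if w: "w \<in> H N" for N w
  proof -
    have close: "norm (X w - step_approx (X w) e N) \<le> d"
      using norm_step_approx_le[OF e(1), of "X w" N] w e(2) by (simp add: H_def m_def)
    have "norm (step_approx (X w) e N) \<le> 1 + norm (X w)"
      using norm_triangle_ineq4[of "X w" "X w - step_approx (X w) e N"] close d(2) by simp
    then have "norm (\<tau> (\<lambda>_. X w) - \<tau> (\<lambda>_. step_approx (X w) e N)) \<le> 1 * real CARD('l) * d * (1 + norm (X w)) ^ CARD('l)"
      using close by (intro norm_multilinear_diag_diff_le[OF ml]) auto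
    also have "\<dots> \<le> \<epsilon> * (1 + norm (X w)) ^ CARD('l)" using d(3) by (intro mult_right_mono) auto
    finally show ?thesis using w by (simp add: g_def)
  qed
  ultimately show "\<exists>(H :: nat \<Rightarrow> 'w set) G. (\<forall>N. H N \<in> sets M) \<and> incseq H \<and> (\<Union>N. H N) = space M \<and>
      (\<forall>N. pettis_witnessed M (G N)) \<and> (\<forall>N. \<forall>w\<in>H N. norm (\<tau> (\<lambda>_. X w) - G N w) \<le> \<epsilon> * g w)"
    using H by (intro exI[of _ H] exI[of _ "\<lambda>N w. \<tau> (\<lambda>_. indicator (H N) w *\<^sub>R step_approx (X w) e N)"]) blast
qed

section \<open>The two tensor powers as bounded multilinear maps\<close>

lemma multilinear_on_projective:
  "multilinear_on UNIV 1 (\<lambda>x :: 'l::finite \<Rightarrow> 'b::real_normed_vector.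
     to_completion (Abs_pre_projective (pure_tensor x)))"
  unfolding multilinear_on_def
proof (intro conjI ballI allI)
  fix x :: "'l \<Rightarrow> 'b" and i
  have "linear (\<lambda>a. Abs_pre_projective (pure_tensor (x(i := a))))"
  proof
    show "Abs_pre_projective (pure_tensor (x(i := a + b))) =
        Abs_pre_projective (pure_tensor (x(i := a))) + Abs_pre_projective (pure_tensor (x(i := b)))" for a b
      by (simp add: pure_tensor_add plus_pre_projective.abs_eq eq_onp_def)
    show "Abs_pre_projective (pure_tensor (x(i := r *\<^sub>R a))) =
        r *\<^sub>R Abs_pre_projective (pure_tensor (x(i := a)))" for r a
      by (simp add: pure_tensor_scaleR scaleR_pre_projective.abs_eq eq_onp_def)
  qed
  from linear_compose[OF this linear_to_completion]
  show "linear (\<lambda>a. to_completion (Abs_pre_projective (pure_tensor (x(i := a)))))" by (simp add: o_def)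
  show "norm (to_completion (Abs_pre_projective (pure_tensor x))) \<le> 1 * (\<Prod>i\<in>UNIV. norm (x i))"
    using projective_norm_le[of "[x]"]
    by (simp add: norm_to_completion seminorm_pre_projective.abs_eq eq_onp_def)
qed simp

lemma injective_norm_pure_le:
  fixes x :: "'l::finite \<Rightarrow> 'b::real_normed_vector"
  shows "injective_norm (pure_tensor x) \<le> (\<Prod>i\<in>UNIV. norm (x i))"
proof (rule injective_norm_least)
  fix \<phi> :: "'l \<Rightarrow> 'b \<Rightarrow>\<^sub>L real" assume \<phi>: "\<And>i. norm (\<phi> i) \<le> 1"
  have "\<bar>blinfun_apply (\<phi> i) (x i)\<bar> \<le> norm (x i)" for i
    using order_trans[OF norm_blinfun mult_right_mono[OF \<phi> norm_ge_zero]] by simp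
  then show "\<bar>tensor_functional \<phi> (pure_tensor x)\<bar> \<le> (\<Prod>i\<in>UNIV. norm (x i))"
    unfolding tensor_functional_pure abs_prod by (intro prod_mono) simp
qed

lemma multilinear_on_injective:
  "multilinear_on UNIV 1 (\<lambda>x :: 'l::finite \<Rightarrow> 'b::real_normed_vector.
     to_completion (Abs_pre_injective (pure_tensor x)))"
  unfolding multilinear_on_def
proof (intro conjI ballI allI)
  fix x :: "'l \<Rightarrow> 'b" and i
  have "linear (\<lambda>a. Abs_pre_injective (pure_tensor (x(i := a))))"
  proof
    show "Abs_pre_injective (pure_tensor (x(i := a + b))) =
        Abs_pre_injective (pure_tensor (x(i := a))) + Abs_pre_injective (pure_tensor (x(i := b)))" for a b
      by (simp add: pure_tensor_add plus_pre_injective.abs_eq eq_onp_def)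
    show "Abs_pre_injective (pure_tensor (x(i := r *\<^sub>R a))) =
        r *\<^sub>R Abs_pre_injective (pure_tensor (x(i := a)))" for r a
      by (simp add: pure_tensor_scaleR scaleR_pre_injective.abs_eq eq_onp_def)
  qed
  from linear_compose[OF this linear_to_completion]
  show "linear (\<lambda>a. to_completion (Abs_pre_injective (pure_tensor (x(i := a)))))" by (simp add: o_def)
  show "norm (to_completion (Abs_pre_injective (pure_tensor x))) \<le> 1 * (\<Prod>i\<in>UNIV. norm (x i))"
    using injective_norm_pure_le[of x]
    by (simp add: norm_to_completion seminorm_pre_injective.abs_eq eq_onp_def)
qed simp

theorem theorem8p4:
  fixes M :: "'w measure" and X :: "'w \<Rightarrow> 'm::finite skorokhod"
  assumes "prob_space M"
    and "X \<in> measurable M skorokhod_algebra"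
    and "(\<integral>\<^sup>+ w. ennreal (norm (X w) ^ CARD('l::finite)) \<partial>M) < \<infinity>"
  shows "pettis_integrable M
           (\<lambda>w. projective_power (X w) :: ('m skorokhod, 'l) projective_tensor_power) \<and>
         pettis_integrable M
           (\<lambda>w. injective_power (X w) :: ('m skorokhod, 'l) injective_tensor_power)"
  unfolding projective_power_def injective_power_def
  using pettis_witnessed_multilinear[OF assms multilinear_on_projective]
    pettis_witnessed_multilinear[OF assms multilinear_on_injective]
  by (blast intro: pettis_witnessed_imp_pettis_integrable)

end
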